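(* Let $\mathcal{A}=(\Sigma,Q,I,\delta,\gamma)$ be a universal co-Büchi automaton and let $\mathcal{C}$ be the NBA obtained from $\mathcal{A}$ by the rank-based construction. Then $\mathcal{L}(\mathcal{C})=\mathcal{L}(\mathcal{A})$ and $\mathcal{C}$ is good-for-MDPs.
   Context: $\mathcal{A}$ has finite alphabet $\Sigma$, finite state set $Q$ with $n=|Q|$, initial states $I\subseteq Q$, transitions $\delta:Q\times\Sigma\to2^Q$, and distinguished transitions $\gamma:Q\times\Sigma\to 2^Q$ with $\gamma(q,\sigma)\subseteq\delta(q,\sigma)$. Read as a UCA, $\mathcal{L}(\mathcal{A})$ is the set of words with no run from $I$ using transitions of $\gamma$ infinitely often. For $S\subseteq Q$, $\delta(S,\sigma)=\bigcup_{q\in S}\delta(q,\sigma)$, $\gamma(S,\sigma)=\bigcup_{q\in S}\gamma(q,\sigma)$. A function $f:S\to\mathbb{N}$ is $S$-tight if for some $m\le|S|$ it maps $S$ into $\{0,\ldots,2m-1\}$ and onto $\{1,3,\ldots,2m-1\}$; $\mathcal{T}_S$ is the set of $S$-tight functions, $\mathsf{rank}(f)=\max_{q\in S} f(q)$. The rank-based construction is the NBA $\mathcal{C}=(\Sigma,Q',\{I\},\delta',\gamma')$ with $Q'=Q_1\cup Q_2$, $Q_1=2^Q$, $Q_2=\{(S,O,f,i)\in2^Q\times2^Q\times\mathcal{T}_S\times\{0,2,\ldots,2n-2\}\mid O\subseteq f^{-1}(i)\}$, initial state $I\in Q_1$, and $\delta'=\delta_1\cup\delta_2\cup\delta_3$: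 $\delta_1(S,\sigma)=\{\delta(S,\sigma)\}$; $(S',O,f,i)\in\delta_2(S,\sigma)$ iff $S'=\delta(S,\sigma)$, $O=\emptyset$, $i=0$ ($f\in\mathcal{T}_{S'}$ arbitrary); $(S',O',f',i')\in\delta_3((S,O,f,i),\sigma)$ iff $S'=\delta(S,\sigma)$ and, with $g(q)=\{j\mid q\in\delta(f^{-1}(j),\sigma)\}\cup\{2\lfloor j/2\rfloor\mid q\in\gamma(f^{-1}(j),\sigma)\}$ for $q\in S'$, the function $f'(q)=\min g(q)$ is $S'$-tight (otherwise no transition), and with $O''=\delta(O,\sigma)\cap f'^{-1}(i)$: if $O''\neq\emptyset$ then $O'=O''$, $i'=i$ (case (2)); else $i'=(i+2)\bmod(\mathsf{rank}(f')+1)$, $O'=f'^{-1}(i')$ (case (3)). Accepting transitions $\gamma'$: the $\delta_3$-transitions of case (3) and the transitions from the state $\emptyset\in Q_1$. An NBA over $\Sigma=2^{AP}$ is good-for-MDPs if for every finite MDP $\mathcal{M}=(S,s_0,A,T,AP,L)$ the maximal probability (over strategies of $\mathcal{M}$) that the label sequence $L(s_0)L(s_1)\ldots$ is in the language of the NBA equals the maximal probability (over strategies of the product MDP $\mathcal{M}\times\mathcal{C}$, in which the controller additionally resolves the automaton's nondeterminism on the fly by choosing the next automaton state consistent with the current label) of traversing accepting automaton transitions infinitely often. *)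

theory Defs
  imports "HOL-Probability.Probability"
begin

section \<open>Automata with distinguished transitions\<close>

record ('q, 'l) aut =
  alphabet :: "'l set"
  states :: "'q set"
  initial :: "'q set"
  trans :: "'q \<Rightarrow> 'l \<Rightarrow> 'q set"
  dist_trans :: "'q \<Rightarrow> 'l \<Rightarrow> 'q set"

definition automaton :: "('q, 'l) aut \<Rightarrow> bool" where
  "automaton A \<longleftrightarrow>
     finite (alphabet A) \<and> finite (states A) \<and> initial A \<subseteq> states A \<and>
     (\<forall>q\<in>states A. \<forall>\<sigma>\<in>alphabet A. trans A q \<sigma> \<subseteq> states A \<and> dist_trans A q \<sigma> \<subseteq> trans A q \<sigma>)"

definition words :: "'l set \<Rightarrow> (nat \<Rightarrow> 'l) set" where
  "words \<Sigma> = {w. \<forall>k. w k \<in> \<Sigma>}"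

definition is_run :: "('q, 'l) aut \<Rightarrow> (nat \<Rightarrow> 'l) \<Rightarrow> (nat \<Rightarrow> 'q) \<Rightarrow> bool" where
  "is_run A w r \<longleftrightarrow> r 0 \<in> initial A \<and> (\<forall>k. r (Suc k) \<in> trans A (r k) (w k))"

definition inf_dist :: "('q, 'l) aut \<Rightarrow> (nat \<Rightarrow> 'l) \<Rightarrow> (nat \<Rightarrow> 'q) \<Rightarrow> bool" where
  "inf_dist A w r \<longleftrightarrow> (\<exists>\<^sub>\<infinity>k. r (Suc k) \<in> dist_trans A (r k) (w k))"

definition UCA_lang :: "('q, 'l) aut \<Rightarrow> (nat \<Rightarrow> 'l) set" where
  "UCA_lang A = {w \<in> words (alphabet A). \<not> (\<exists>r. is_run A w r \<and> inf_dist A w r)}"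

definition NBA_lang :: "('q, 'l) aut \<Rightarrow> (nat \<Rightarrow> 'l) set" where
  "NBA_lang A = {w \<in> words (alphabet A). \<exists>r. is_run A w r \<and> inf_dist A w r}"

definition post :: "('q, 'l) aut \<Rightarrow> 'q set \<Rightarrow> 'l \<Rightarrow> 'q set" where
  "post A S \<sigma> = (\<Union>q\<in>S. trans A q \<sigma>)"

definition dist_post :: "('q, 'l) aut \<Rightarrow> 'q set \<Rightarrow> 'l \<Rightarrow> 'q set" where
  "dist_post A S \<sigma> = (\<Union>q\<in>S. dist_trans A q \<sigma>)"


section \<open>The rank-based construction\<close>

text \<open>Functions with domain \<open>S\<close> are represented by functions that are extensional on \<open>S\<close>.\<close>

definition tight_funs :: "'q set \<Rightarrow> ('q \<Rightarrow> nat) set" where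
  "tight_funs S =
     {f. \<exists>m\<le>card S. f \<in> S \<rightarrow>\<^sub>E {..<2 * m} \<and> {j. odd j \<and> j < 2 * m} \<subseteq> f ` S}"

definition level :: "'q set \<Rightarrow> ('q \<Rightarrow> nat) \<Rightarrow> nat \<Rightarrow> 'q set" where
  "level S f j = {q \<in> S. f q = j}"

text \<open>The element \<open>0\<close> only matters for \<open>S = {}\<close>, where it fixes the rank of the
  empty function to be \<open>0\<close>.\<close>

definition rank :: "'q set \<Rightarrow> ('q \<Rightarrow> nat) \<Rightarrow> nat" where
  "rank S f = Max (insert 0 (f ` S))"

datatype 'q rb_state =
    Subset "'q set"
  | Ranked "'q set" "'q set" "'q \<Rightarrow> nat" nat

definition rb_states :: "('q, 'l) aut \<Rightarrow> 'q rb_state set" where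
  "rb_states A =
     {Subset S | S. S \<subseteq> states A} \<union>
     {Ranked S O' f i | S O' f i.
        S \<subseteq> states A \<and> f \<in> tight_funs S \<and> even i \<and> i < 2 * card (states A) \<and> O' \<subseteq> level S f i}"

definition succ_ranks :: "('q, 'l) aut \<Rightarrow> 'q set \<Rightarrow> ('q \<Rightarrow> nat) \<Rightarrow> 'l \<Rightarrow> 'q \<Rightarrow> nat set" where
  "succ_ranks A S f \<sigma> q =
     {j. q \<in> post A (level S f j) \<sigma>} \<union> {2 * (j div 2) | j. q \<in> dist_post A (level S f j) \<sigma>}"

definition succ_fun :: "('q, 'l) aut \<Rightarrow> 'q set \<Rightarrow> ('q \<Rightarrow> nat) \<Rightarrow> 'l \<Rightarrow> 'q \<Rightarrow> nat" where
  "succ_fun A S f \<sigma> = (\<lambda>q\<in>post A S \<sigma>. Min (succ_ranks A S f \<sigma> q))"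

definition keep_set ::
  "('q, 'l) aut \<Rightarrow> 'q set \<Rightarrow> 'q set \<Rightarrow> ('q \<Rightarrow> nat) \<Rightarrow> nat \<Rightarrow> 'l \<Rightarrow> 'q set" where
  "keep_set A S O' f i \<sigma> = post A O' \<sigma> \<inter> level (post A S \<sigma>) (succ_fun A S f \<sigma>) i"

text \<open>\<open>delta3_keep\<close> and \<open>delta3_break\<close> are the transitions between ranked states
  with nonempty and with empty \<open>keep_set\<close>, respectively; only the latter are
  accepting.\<close>

definition delta1 :: "('q, 'l) aut \<Rightarrow> 'q set \<Rightarrow> 'l \<Rightarrow> 'q rb_state set" where
  "delta1 A S \<sigma> = {Subset (post A S \<sigma>)}"

definition delta2 :: "('q, 'l) aut \<Rightarrow> 'q set \<Rightarrow> 'l \<Rightarrow> 'q rb_state set" where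
  "delta2 A S \<sigma> = {Ranked (post A S \<sigma>) {} f 0 | f. f \<in> tight_funs (post A S \<sigma>)}"

definition delta3_keep ::
  "('q, 'l) aut \<Rightarrow> 'q set \<Rightarrow> 'q set \<Rightarrow> ('q \<Rightarrow> nat) \<Rightarrow> nat \<Rightarrow> 'l \<Rightarrow> 'q rb_state set" where
  "delta3_keep A S O' f i \<sigma> =
     (let S' = post A S \<sigma>; f' = succ_fun A S f \<sigma>; O'' = keep_set A S O' f i \<sigma>
      in if f' \<in> tight_funs S' \<and> O'' \<noteq> {} then {Ranked S' O'' f' i} else {})"

definition delta3_break ::
  "('q, 'l) aut \<Rightarrow> 'q set \<Rightarrow> 'q set \<Rightarrow> ('q \<Rightarrow> nat) \<Rightarrow> nat \<Rightarrow> 'l \<Rightarrow> 'q rb_state set" where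
  "delta3_break A S O' f i \<sigma> =
     (let S' = post A S \<sigma>; f' = succ_fun A S f \<sigma>; O'' = keep_set A S O' f i \<sigma>;
          i' = (i + 2) mod (rank S' f' + 1)
      in if f' \<in> tight_funs S' \<and> O'' = {} then {Ranked S' (level S' f' i') f' i'} else {})"

text \<open>The intersection with \<open>rb_states\<close> expresses that targets are states of the construction.
  It is only effective for \<open>states A = {}\<close>, where there are no ranked states.\<close>

fun rb_trans :: "('q, 'l) aut \<Rightarrow> 'q rb_state \<Rightarrow> 'l \<Rightarrow> 'q rb_state set" where
  "rb_trans A (Subset S) \<sigma> = (delta1 A S \<sigma> \<union> delta2 A S \<sigma>) \<inter> rb_states A"
| "rb_trans A (Ranked S O' f i) \<sigma> =
     (delta3_keep A S O' f i \<sigma> \<union> delta3_break A S O' f i \<sigma>) \<inter> rb_states A"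

fun rb_acc :: "('q, 'l) aut \<Rightarrow> 'q rb_state \<Rightarrow> 'l \<Rightarrow> 'q rb_state set" where
  "rb_acc A (Subset S) \<sigma> = (if S = {} then rb_trans A (Subset S) \<sigma> else {})"
| "rb_acc A (Ranked S O' f i) \<sigma> = delta3_break A S O' f i \<sigma> \<inter> rb_states A"

definition rank_construction :: "('q, 'l) aut \<Rightarrow> ('q rb_state, 'l) aut" where
  "rank_construction A =
     \<lparr>alphabet = alphabet A, states = rb_states A, initial = {Subset (initial A)},
      trans = rb_trans A, dist_trans = rb_acc A\<rparr>"


section \<open>Markov decision processes\<close>

text \<open>The transition function is partial: action \<open>a\<close> is enabled in \<open>s\<close> iff
  \<open>mdp_trans M s a \<noteq> None\<close>.\<close>

record ('s, 'a, 'l) mdp =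
  mdp_states :: "'s set"
  mdp_init :: "'s"
  mdp_acts :: "'a set"
  mdp_trans :: "'s \<Rightarrow> 'a \<Rightarrow> 's pmf option"
  mdp_label :: "'s \<Rightarrow> 'l"

definition enabled :: "('s, 'a, 'l) mdp \<Rightarrow> 's \<Rightarrow> 'a set" where
  "enabled M s = {a \<in> mdp_acts M. mdp_trans M s a \<noteq> None}"

text \<open>The alphabet \<open>\<Sigma>\<close> plays the role of \<open>2\<^sup>A\<^sup>P\<close>; for \<open>\<Sigma> = Pow AP\<close> the labelling
  is a function from states to sets of atomic propositions.\<close>

definition finite_MDP :: "'l set \<Rightarrow> ('s, 'a, 'l) mdp \<Rightarrow> bool" where
  "finite_MDP \<Sigma> M \<longleftrightarrow>
     finite (mdp_states M) \<and> finite (mdp_acts M) \<and> mdp_init M \<in> mdp_states M \<and>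
     (\<forall>s\<in>mdp_states M. \<forall>a\<in>mdp_acts M. \<forall>p.
        mdp_trans M s a = Some p \<longrightarrow> set_pmf p \<subseteq> mdp_states M) \<and>
     (\<forall>s\<in>mdp_states M. enabled M s \<noteq> {}) \<and>
     (\<forall>s\<in>mdp_states M. mdp_label M s \<in> \<Sigma>)"

text \<open>A strategy maps the past state-action pairs and the current state to a distribution on
  enabled actions. Nothing is required in states without enabled actions, which can occur in
  the product with an automaton.\<close>

type_synonym ('s, 'a) strategy = "('s \<times> 'a) list \<Rightarrow> 's \<Rightarrow> 'a pmf"

definition strategies :: "('s, 'a, 'l) mdp \<Rightarrow> ('s, 'a) strategy set" where
  "strategies M =
     {\<pi>. \<forall>h. \<forall>s\<in>mdp_states M. enabled M s \<noteq> {} \<longrightarrow> set_pmf (\<pi> h s) \<subseteq> enabled M s}"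

text \<open>A path is a sequence of optional state-action pairs; it continues with \<open>None\<close> once a state
  without enabled actions has been reached. \<open>step_pmf M \<pi> k \<omega>\<close> is the distribution of the entry
  at position \<open>k\<close> given the entries of \<open>\<omega>\<close> at the positions below \<open>k\<close>.\<close>

definition choose_pmf ::
  "('s, 'a, 'l) mdp \<Rightarrow> ('s, 'a) strategy \<Rightarrow> ('s \<times> 'a) list \<Rightarrow> 's \<Rightarrow> ('s \<times> 'a) option pmf" where
  "choose_pmf M \<pi> h s =
     (if enabled M s = {} then return_pmf None else map_pmf (\<lambda>a. Some (s, a)) (\<pi> h s))"

fun step_pmf ::
  "('s, 'a, 'l) mdp \<Rightarrow> ('s, 'a) strategy \<Rightarrow> nat \<Rightarrow> (nat \<Rightarrow> ('s \<times> 'a) option) \<Rightarrow> ('s \<times> 'a) option pmf"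
where
  "step_pmf M \<pi> 0 \<omega> = choose_pmf M \<pi> [] (mdp_init M)"
| "step_pmf M \<pi> (Suc k) \<omega> =
     (case \<omega> k of
        None \<Rightarrow> return_pmf None
      | Some (s, a) \<Rightarrow>
          (case mdp_trans M s a of
             None \<Rightarrow> return_pmf None
           | Some p \<Rightarrow> bind_pmf p (choose_pmf M \<pi> (map (the \<circ> \<omega>) [0..<Suc k]))))"

definition entries :: "('s, 'a, 'l) mdp \<Rightarrow> ('s \<times> 'a) option set" where
  "entries M = insert None (Some ` (mdp_states M \<times> mdp_acts M))"

definition step_measure ::
  "('s, 'a, 'l) mdp \<Rightarrow> ('s, 'a) strategy \<Rightarrow> nat \<Rightarrow> (nat \<Rightarrow> ('s \<times> 'a) option) \<Rightarrow> ('s \<times> 'a) option measure"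
where
  "step_measure M \<pi> k \<omega> = restrict_space (measure_pmf (step_pmf M \<pi> k \<omega>)) (entries M)"

text \<open>The measure on infinite paths given by the Ionescu-Tulcea theorem for the
  kernels \<open>step_measure M \<pi>\<close>.\<close>

definition path_measure ::
  "('s, 'a, 'l) mdp \<Rightarrow> ('s, 'a) strategy \<Rightarrow> (nat \<Rightarrow> ('s \<times> 'a) option) measure" where
  "path_measure M \<pi> =
     (let N = (\<lambda>_. count_space (entries M))
      in projective_family.lim UNIV (Ionescu_Tulcea.CI (step_measure M \<pi>) N) N)"


section \<open>Good-for-MDPs automata\<close>

definition lang_event ::
  "('s, 'a, 'l) mdp \<Rightarrow> (nat \<Rightarrow> 'l) set \<Rightarrow> (nat \<Rightarrow> ('s \<times> 'a) option) set" where
  "lang_event M L =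
     {\<omega>. (\<forall>k. \<omega> k \<in> entries M \<and> \<omega> k \<noteq> None) \<and> (\<lambda>k. mdp_label M (fst (the (\<omega> k)))) \<in> L}"

definition sem_value :: "('s, 'a, 'l) mdp \<Rightarrow> ('q, 'l) aut \<Rightarrow> ennreal" where
  "sem_value M C = (SUP \<pi>\<in>strategies M. emeasure (path_measure M \<pi>) (lang_event M (NBA_lang C)))"

text \<open>In state \<open>(s, q)\<close> the controller chooses an action \<open>a\<close> of the MDP together with a successor
  \<open>q'\<close> of \<open>q\<close> under the label of \<open>s\<close>.\<close>

definition product ::
  "('s, 'a, 'l) mdp \<Rightarrow> ('q, 'l) aut \<Rightarrow> 'q \<Rightarrow> ('s \<times> 'q, 'a \<times> 'q, 'l) mdp" where
  "product M C q\<^sub>0 =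
     \<lparr>mdp_states = mdp_states M \<times> states C,
      mdp_init = (mdp_init M, q\<^sub>0),
      mdp_acts = mdp_acts M \<times> states C,
      mdp_trans = (\<lambda>(s, q) (a, q').
        if q' \<in> trans C q (mdp_label M s)
        then map_option (map_pmf (\<lambda>s'. (s', q'))) (mdp_trans M s a) else None),
      mdp_label = (\<lambda>(s, q). mdp_label M s)\<rparr>"

definition acc_event ::
  "('s, 'a, 'l) mdp \<Rightarrow> ('q, 'l) aut \<Rightarrow> 'q \<Rightarrow> (nat \<Rightarrow> (('s \<times> 'q) \<times> ('a \<times> 'q)) option) set" where
  "acc_event M C q\<^sub>0 =
     {\<omega>. (\<forall>k. \<omega> k \<in> entries (product M C q\<^sub>0)) \<and>
         (\<exists>\<^sub>\<infinity>k. \<exists>s q a q'. \<omega> k = Some ((s, q), (a, q')) \<and> q' \<in> dist_trans C q (mdp_label M s))}"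

definition syn_value :: "('s, 'a, 'l) mdp \<Rightarrow> ('q, 'l) aut \<Rightarrow> ennreal" where
  "syn_value M C =
     (SUP q\<^sub>0\<in>initial C. SUP \<pi>\<in>strategies (product M C q\<^sub>0).
        emeasure (path_measure (product M C q\<^sub>0) \<pi>) (acc_event M C q\<^sub>0))"

text \<open>The type arguments are the types of states and actions of the MDPs.\<close>

definition good_for_MDPs :: "'s itself \<Rightarrow> 'a itself \<Rightarrow> ('q, 'l) aut \<Rightarrow> bool" where
  "good_for_MDPs _ _ C \<longleftrightarrow>
     (\<forall>M :: ('s, 'a, 'l) mdp. finite_MDP (alphabet C) M \<longrightarrow> sem_value M C = syn_value M C)"

end

theory Submission
  imports Defs
begin

text \<open>
  Once the construction has jumped to a ranked state it is deterministic, and a jump to ranks \<open>f\<close> at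
  time \<open>t\<close> is accepting iff the ranks stay tight and no path of the universal automaton keeps a constant
  even rank forever. On a path of constant odd rank there are no distinguished transitions, so an
  accepting jump shows that the word is accepted by the universal automaton. Conversely, for an
  accepted word one takes the ranks of Kupferman and Vardi at a late enough time: every odd rank is
  realised by an infinite path, which keeps the ranks tight, and the paths of odd rank that start later
  eventually merge with earlier ones, so that every path ends up with its proper odd rank.

  The criterion does not mention the breakpoint component, so an accepting jump at \<open>t\<close> yields an
  accepting jump at every later time. The language is therefore an increasing union of finite unions of
  measurable events, one for each jump at a fixed time, and each of these events is approximated by
  an event that depends only on a prefix of the word. Hence for every strategy of an MDP and every
  \<open>e > 0\<close> there is a resolver of the nondeterminism that loses at most probability \<open>e\<close>; it turns the
  strategy into one of the product. In the other direction a product strategy is projected to the MDP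
  by taking conditional distributions of actions given the projected history.
\<close>

section \<open>Measures on sequences over a finite set\<close>

text \<open>The right ranks depend on the whole future of a word, while a controller commits after
  finitely many letters. Both \<open>sem_value\<close> and \<open>syn_value\<close> are suprema, so
  an error of \<open>e\<close> is affordable for every single strategy. A postponed jump does not
  continue the run of the earlier one: it restarts with an empty obligation set and index
  \<open>0\<close>. This is why acceptance is first expressed through the ranks alone. Words whose
  set of reachable states becomes empty are accepted without any jump, which adds an alternative to
  each description of the language. On the side of measures, path measures enter through their
  one-step kernels, and two measures are equal or comparable once they are so on cylinders. Lifting
  a strategy is a causal map on paths, so its image measure is identified exactly. Projecting gives
  only an inequality, because the product may get stuck where the MDP cannot; it is shown for
  prefixes without \<open>None\<close> and carries over to the language event, whose paths avoid
  \<open>None\<close>.\<close>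

definition seqs :: "'e set \<Rightarrow> (nat \<Rightarrow> 'e) set" where
  "seqs E = {z. \<forall>k. z k \<in> E}"

definition seq_space :: "'e set \<Rightarrow> (nat \<Rightarrow> 'e) measure" where
  "seq_space E = PiM UNIV (\<lambda>_. count_space E)"

definition cyl :: "'e set \<Rightarrow> nat \<Rightarrow> (nat \<Rightarrow> 'e) \<Rightarrow> (nat \<Rightarrow> 'e) set" where
  "cyl E n y = {z \<in> seqs E. \<forall>j<n. z j = y j}"

text \<open>For finite \<open>E\<close> these are the finite unions of cylinders of length
  \<open>n\<close>. Over all \<open>n\<close> they form an algebra that generates
  \<open>seq_space E\<close>; measures are approximated and compared on it.\<close>

definition determined :: "'e set \<Rightarrow> nat \<Rightarrow> (nat \<Rightarrow> 'e) set \<Rightarrow> bool" where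
  "determined E n X \<longleftrightarrow>
     X \<subseteq> seqs E \<and> (\<forall>z\<in>X. \<forall>z'\<in>seqs E. (\<forall>j<n. z' j = z j) \<longrightarrow> z' \<in> X)"

lemma space_seq_space [simp]: "space (seq_space E) = seqs E"
  by (auto simp: seq_space_def space_PiM seqs_def PiE_iff)

lemma component_measurable: "(\<lambda>z. z k) \<in> measurable (seq_space E) (count_space E)"
  unfolding seq_space_def by measurable

lemma cyl_0 [simp]: "cyl E 0 y = seqs E"
  by (simp add: cyl_def)

lemma cyl_self: "y \<in> seqs E \<Longrightarrow> y \<in> cyl E n y"
  by (simp add: cyl_def)

lemma cyl_sets [simp]: "cyl E n y \<in> sets (seq_space E)"
proof -
  have "{z \<in> space (seq_space E). z j = y j} \<in> sets (seq_space E)" for j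
  proof -
    have "(\<lambda>z. z j) -` ({y j} \<inter> E) \<inter> space (seq_space E) \<in> sets (seq_space E)"
      by (rule measurable_sets[OF component_measurable]) auto
    moreover have "(\<lambda>z. z j) -` ({y j} \<inter> E) \<inter> space (seq_space E)
        = {z \<in> space (seq_space E). z j = y j}"
      by (auto simp: seqs_def)
    ultimately show ?thesis by simp
  qed
  then have "{z \<in> space (seq_space E). \<forall>j\<in>{..<n}. z j = y j} \<in> sets (seq_space E)"
    by (intro sets.sets_Collect_finite_All) auto
  moreover have "{z \<in> space (seq_space E). \<forall>j\<in>{..<n}. z j = y j} = cyl E n y"
    by (auto simp: cyl_def)
  ultimately show ?thesis by metis
qed

lemma determined_mono: "determined E n X \<Longrightarrow> n \<le> m \<Longrightarrow> determined E m X"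
  unfolding determined_def
proof (intro conjI ballI impI)
  fix z z'
  assume *: "X \<subseteq> seqs E \<and> (\<forall>z\<in>X. \<forall>z'\<in>seqs E. (\<forall>j<n. z' j = z j) \<longrightarrow> z' \<in> X)" "n \<le> m"
    and z: "z \<in> X" "z' \<in> seqs E" "\<forall>j<m. z' j = z j"
  have "\<forall>j<n. z' j = z j"
    using z(3) *(2) less_le_trans by metis
  then show "z' \<in> X"
    using *(1) z(1,2) by metis
qed auto

lemma determined_Collect:
  assumes "\<And>z z'. z \<in> seqs E \<Longrightarrow> z' \<in> seqs E \<Longrightarrow> (\<And>j. j < n \<Longrightarrow> z' j = z j) \<Longrightarrow> R z \<Longrightarrow> R z'"
  shows "determined E n {z \<in> seqs E. R z}"
  unfolding determined_def
proof (intro conjI ballI impI)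
  fix z z' assume *: "z \<in> {z \<in> seqs E. R z}" "z' \<in> seqs E" "\<forall>j<n. z' j = z j"
  then have "R z'"
    by (intro assms[of z z']) simp_all
  then show "z' \<in> {z \<in> seqs E. R z}"
    using *(2) by simp
qed auto

lemma cyl_eq_restrict:
  "cyl E n y = cyl E n (restrict y {..<n})"
  by (simp add: cyl_def)

lemma finite_cyls:
  assumes "finite E" "X \<subseteq> seqs E"
  shows "finite (cyl E n ` X)"
proof -
  have "cyl E n ` X \<subseteq> cyl E n ` ({..<n} \<rightarrow>\<^sub>E E)"
  proof
    fix C assume "C \<in> cyl E n ` X"
    then obtain y where y: "y \<in> X" "C = cyl E n y" by auto
    then have "restrict y {..<n} \<in> {..<n} \<rightarrow>\<^sub>E E"
      using assms by (auto simp: seqs_def)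
    then show "C \<in> cyl E n ` ({..<n} \<rightarrow>\<^sub>E E)"
      using y cyl_eq_restrict by blast
  qed
  then show ?thesis
    using assms by (meson finite_PiE finite_imageI finite_lessThan finite_subset)
qed

lemma determined_Union_cyl:
  assumes "determined E n X"
  shows "X = \<Union> (cyl E n ` X)"
proof
  show "X \<subseteq> \<Union> (cyl E n ` X)"
    using assms cyl_self unfolding determined_def by blast
  show "\<Union> (cyl E n ` X) \<subseteq> X"
  proof
    fix z assume "z \<in> \<Union> (cyl E n ` X)"
    then obtain y where "y \<in> X" "z \<in> cyl E n y" by blast
    then show "z \<in> X"
      using assms unfolding determined_def by (simp add: cyl_def)
  qed
qed

lemma cyl_eqI:
  assumes "z \<in> cyl E n y"
  shows "cyl E n z = cyl E n y"
proof -
  have "(\<forall>j<n. x j = z j) \<longleftrightarrow> (\<forall>j<n. x j = y j)" for x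
    using assms unfolding cyl_def by (metis (mono_tags, lifting) mem_Collect_eq)
  then show ?thesis
    unfolding cyl_def by blast
qed

lemma disjoint_cyls: "disjoint (cyl E n ` X)"
proof (rule disjointI)
  fix C D assume "C \<in> cyl E n ` X" "D \<in> cyl E n ` X" "C \<noteq> D"
  then obtain c d where cd: "C = cyl E n c" "D = cyl E n d" by blast
  have False if "z \<in> C" "z \<in> D" for z
    using cyl_eqI[of z E n c] cyl_eqI[of z E n d] that cd \<open>C \<noteq> D\<close> by simp
  then show "C \<inter> D = {}" by blast
qed

lemma determined_sets:
  assumes "finite E" "determined E n X"
  shows "X \<in> sets (seq_space E)"
proof -
  have "\<Union> (cyl E n ` X) \<in> sets (seq_space E)"
    using assms finite_cyls[of E X n] by (intro sets.finite_Union) (auto simp: determined_def)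
  then show ?thesis
    using determined_Union_cyl[OF assms(2)] by simp
qed

text \<open>Two cylinders of the same length are equal or disjoint. The sum runs over the set of
  cylinders rather than over the points of \<open>X\<close>, so it is finite and counts each
  cylinder once.\<close>

lemma measure_determined:
  assumes "finite_measure P" "sets P = sets (seq_space E)" "finite E" "determined E n X"
    "Y \<in> sets P"
  shows "measure P (X \<inter> Y) = (\<Sum>C\<in>cyl E n ` X. measure P (C \<inter> Y))"
proof -
  interpret finite_measure P by fact
  have "X \<inter> Y = (\<Union>C\<in>cyl E n ` X. C \<inter> Y)"
    using determined_Union_cyl[OF assms(4)] by blast
  moreover have "measure P (\<Union>C\<in>cyl E n ` X. C \<inter> Y) = (\<Sum>C\<in>cyl E n ` X. measure P (C \<inter> Y))"
  proof (rule finite_measure_finite_Union)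
    show "finite (cyl E n ` X)"
      using assms finite_cyls by (auto simp: determined_def)
    show "(\<lambda>C. C \<inter> Y) ` cyl E n ` X \<subseteq> sets P"
    proof (rule image_subsetI)
      fix C assume "C \<in> cyl E n ` X"
      then have "C \<in> sets P"
        unfolding assms(2) by (elim imageE) (simp only: cyl_sets)
      then show "C \<inter> Y \<in> sets P"
        using assms(5) by (rule sets.Int)
    qed
    show "disjoint_family_on (\<lambda>C. C \<inter> Y) (cyl E n ` X)"
      using disjoint_cyls[of E n X] unfolding disjoint_family_on_def disjoint_def by blast
  qed
  ultimately show ?thesis by simp
qed

lemma measure_determined_sum:
  assumes "finite_measure P" "sets P = sets (seq_space E)" "finite E" "determined E n X"
  shows "measure P X = (\<Sum>C\<in>cyl E n ` X. measure P C)"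
proof -
  have "seqs E \<in> sets P"
    using assms(2) sets.top[of "seq_space E"] by simp
  from measure_determined[OF assms this]
  have "measure P (X \<inter> seqs E) = (\<Sum>C\<in>cyl E n ` X. measure P (C \<inter> seqs E))" .
  also have "X \<inter> seqs E = X"
    using assms(4) by (auto simp: determined_def)
  also have "(\<Sum>C\<in>cyl E n ` X. measure P (C \<inter> seqs E)) = (\<Sum>C\<in>cyl E n ` X. measure P C)"
    by (intro sum.cong refl arg_cong[where f="measure P"]) (auto simp: cyl_def)
  finally show ?thesis .
qed

text \<open>The sets with this property include the one-coordinate events and are closed under
  complement and countable union. Two measures are treated at once because comparing them on
  \<open>X\<close> takes one event \<open>D\<close> that is close to \<open>X\<close> for
  both.\<close>

lemma approx_determined:
  assumes P: "finite_measure P" "sets P = sets (seq_space E)"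
    and Q: "finite_measure Q" "sets Q = sets (seq_space E)"
    and fin: "finite E" and X: "X \<in> sets (seq_space E)" and e: "(e::real) > 0"
  shows "\<exists>n D. determined E n D \<and> measure P (sym_diff X D) < e
      \<and> measure Q (sym_diff X D) < e"
proof -
  interpret P: finite_measure P by fact
  interpret Q: finite_measure Q by fact
  have meas: "D \<in> sets P" "D \<in> sets Q" if "determined E n D" for n D
    using determined_sets[OF fin that] P Q by auto
  have sig: "sigma_sets (seqs E) {{f \<in> seqs E. f i \<in> A} | i A. A \<subseteq> E} = sets (seq_space E)"
  proof -
    have "(\<Pi>\<^sub>E i\<in>(UNIV::nat set). E) = seqs E"
      by (auto simp: seqs_def PiE_iff)
    then show ?thesis
      unfolding seq_space_def sets_PiM_single by (simp add: Pow_def)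
  qed
  have "X \<in> sigma_sets (seqs E) {{f \<in> seqs E. f i \<in> A} | i A. A \<subseteq> E}"
    using X sig by simp
  then show ?thesis
    using e
  proof (induction arbitrary: e rule: sigma_sets.induct)
    case (Basic X)
    then obtain i A where X: "X = {f \<in> seqs E. f i \<in> A}" by auto
    have "determined E (Suc i) X"
      unfolding X by (rule determined_Collect) (auto simp: less_Suc_eq)
    then show ?case
      using \<open>0 < e\<close> by (intro exI[of _ "Suc i"] exI[of _ X]) auto
  next
    case Empty
    have "determined E 0 {}"
      by (auto simp: determined_def)
    then show ?case
      using \<open>0 < e\<close> by (intro exI[of _ 0] exI[of _ "{}"]) auto
  next
    case (Compl X)
    then obtain n D where D: "determined E n D" "measure P (sym_diff X D) < e"
      "measure Q (sym_diff X D) < e" by blast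
    have "determined E n (seqs E - D)"
      using D(1) unfolding determined_def by (metis DiffD1 DiffD2 DiffI Diff_subset)
    moreover have "(seqs E - X - (seqs E - D)) \<union> (seqs E - D - (seqs E - X)) = sym_diff X D"
    proof -
      have "X \<subseteq> seqs E"
        using Compl(1) sets.sets_into_space[of X "seq_space E"] sig by simp
      then show ?thesis
        using D(1) unfolding determined_def by blast
    qed
    ultimately show ?case
      using D by metis
  next
    case (Union a)
    have aP: "a i \<in> sets P" "a i \<in> sets Q" for i
      using Union(1) P Q sig by auto
    \<comment> \<open>These tolerances sum to at most \<open>e / 4\<close>, which together with a
      truncation error below \<open>e / 2\<close> stays below \<open>e\<close>.\<close>
    define d where "d i = e / 2 / 2 ^ (Suc (Suc i))" for i
    have d: "d i > 0" for i
      using Union by (simp add: d_def)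
    have "\<exists>n D. determined E n D \<and> measure P (sym_diff (a i) (D)) < d i
      \<and> measure Q (sym_diff (a i) (D)) < d i" for i
      using Union(2) d by blast
    then obtain n D where D: "\<And>i. determined E (n i) (D i)"
      "\<And>i. measure P (sym_diff (a i) (D i)) < d i"
      "\<And>i. measure Q (sym_diff (a i) (D i)) < d i" by metis
    define U where "U N = (\<Union>i<N. a i)" for N
    have Un: "(\<Union>N. U N) = (\<Union>i. a i)" by (auto simp: U_def)
    have inc: "incseq U"
      by (auto simp: incseq_def U_def) (meson lessThan_iff less_le_trans)
    have lim: "(\<lambda>N. measure R (U N)) \<longlonglongrightarrow> measure R (\<Union>i. a i)"
      if "finite_measure R" "\<And>i. a i \<in> sets R" for R
    proof -
      interpret finite_measure R by fact
      have "range U \<subseteq> sets R" using that by (auto simp: U_def)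
      from finite_Lim_measure_incseq[OF this inc] show ?thesis by (simp add: Un)
    qed
    have ev: "eventually (\<lambda>N. measure R (\<Union>i. a i) - e / 2 < measure R (U N)) sequentially"
      if "finite_measure R" "\<And>i. a i \<in> sets R" for R
      using lim[OF that] Union(3) by (intro order_tendstoD(1)) auto
    have "eventually (\<lambda>N. measure P (\<Union>i. a i) - e / 2 < measure P (U N)
        \<and> measure Q (\<Union>i. a i) - e / 2 < measure Q (U N)) sequentially"
      using ev[OF P(1)] ev[OF Q(1)] aP by (intro eventually_conj) auto
    then obtain N where N: "measure P (\<Union>i. a i) - e / 2 < measure P (U N)"
      "measure Q (\<Union>i. a i) - e / 2 < measure Q (U N)"
      by (auto simp: eventually_sequentially)
    define D' where "D' = (\<Union>i<N. D i)"
    define m where "m = Max (insert 0 (n ` {..<N}))"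
    have "determined E m (D i)" if "i < N" for i
      by (rule determined_mono[OF D(1)]) (use that in \<open>auto simp: m_def\<close>)
    then have det: "determined E m D'"
      unfolding D'_def determined_def by blast
    have bound: "measure R (sym_diff (\<Union>i. a i) D') < e"
      if R: "finite_measure R" "\<And>i. a i \<in> sets R" "\<And>i. D i \<in> sets R"
        and R1: "\<And>i. measure R (sym_diff (a i) (D i)) < d i"
        and R2: "measure R (\<Union>i. a i) - e / 2 < measure R (U N)" for R
    proof -
      interpret finite_measure R by fact
      note [measurable] = R(2,3)
      have UN [measurable]: "U N \<in> sets R" unfolding U_def by measurable
      have "measure R (sym_diff (\<Union>i. a i) D')
        \<le> measure R (((\<Union>i. a i) - U N) \<union> (\<Union>i<N. sym_diff (a i) (D i)))"
        by (rule finite_measure_mono) (auto simp: U_def D'_def)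
      also have "\<dots> \<le> measure R ((\<Union>i. a i) - U N) + measure R (\<Union>i<N. sym_diff (a i) (D i))"
        by (rule measure_Un_le) measurable
      also have "measure R ((\<Union>i. a i) - U N) = measure R (\<Union>i. a i) - measure R (U N)"
        by (rule finite_measure_Diff) (auto simp: U_def)
      also have "measure R (\<Union>i<N. sym_diff (a i) (D i))
          \<le> (\<Sum>i<N. measure R (sym_diff (a i) (D i)))"
        by (rule measure_UNION_le) auto
      also have "\<dots> \<le> (\<Sum>i<N. d i)"
        using R1 by (intro sum_mono less_imp_le)
      also have "\<dots> = e / 2 / 4 * (\<Sum>i<N. (1/2)^i)"
        by (simp add: d_def sum_distrib_left power_divide)
      also have "\<dots> \<le> e / 2 / 4 * 2"
        using Union(3) by (intro mult_left_mono) (auto simp: geometric_sum)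
      also have "\<dots> < e / 2" using Union(3) by simp
      finally show ?thesis using R2 by simp
    qed
    have "measure P (sym_diff (\<Union>i. a i) D') < e"
      using bound[OF P(1)] aP meas D N by blast
    moreover have "measure Q (sym_diff (\<Union>i. a i) D') < e"
      using bound[OF Q(1)] aP meas D N by blast
    ultimately show ?case using det by blast
  qed
qed

text \<open>The measures are compared on a finitary event that is close to \<open>X\<close> for
  both. The cylinder inequality is asked for only along \<open>F\<close>, which will serve to
  exclude \<open>None\<close>.\<close>

lemma measure_le_if_cyl_le:
  assumes P: "finite_measure P" "sets P = sets (seq_space E)"
    and Q: "finite_measure Q" "sets Q = sets (seq_space E)"
    and fin: "finite E" and X: "X \<in> sets (seq_space E)" "X \<subseteq> seqs F"
    and le: "\<And>n y. y \<in> seqs E \<Longrightarrow> (\<And>j. j < n \<Longrightarrow> y j \<in> F) \<Longrightarrow> measure Q (cyl E n y) \<le> measure P (cyl E n y)"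
  shows "measure Q X \<le> measure P X"
proof (rule field_le_epsilon)
  fix e :: real assume "e > 0"
  interpret P: finite_measure P by fact
  interpret Q: finite_measure Q by fact
  have "e / 2 > 0" using \<open>e > 0\<close> by simp
  from approx_determined[OF P Q fin X(1) this] obtain n D where
    D: "determined E n D" "measure P (sym_diff X D) < e / 2"
      "measure Q (sym_diff X D) < e / 2" by blast
  \<comment> \<open>Prefixes that leave \<open>F\<close> are dropped, as no inequality is available
    for them. No point of \<open>X\<close> is lost, since all its values lie in
    \<open>F\<close>.\<close>
  define D' where "D' = {z \<in> D. \<forall>j<n. z j \<in> F}"
  have D': "determined E n D'"
    using D(1) unfolding determined_def D'_def by auto
  have sets: "X \<in> sets P" "X \<in> sets Q" "D \<in> sets P" "D \<in> sets Q" "D' \<in> sets P" "D' \<in> sets Q"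
    using determined_sets[OF fin D(1)] determined_sets[OF fin D'] P Q X by auto
  have "measure Q X \<le> measure Q (D' \<union> (sym_diff X D))"
  proof (rule Q.finite_measure_mono)
    show "X \<subseteq> D' \<union> (sym_diff X D)"
      using X(2) unfolding D'_def seqs_def by blast
  qed (use sets in auto)
  also have "\<dots> \<le> measure Q D' + measure Q (sym_diff X D)"
    using sets by (intro measure_Un_le) auto
  also have "measure Q D' = (\<Sum>C\<in>cyl E n ` D'. measure Q C)"
    by (rule measure_determined_sum[OF Q fin D'])
  also have "\<dots> \<le> (\<Sum>C\<in>cyl E n ` D'. measure P C)"
  proof (rule sum_mono)
    fix C assume "C \<in> cyl E n ` D'"
    then obtain y where y: "y \<in> D'" "C = cyl E n y" by blast
    then have "y \<in> seqs E" "\<And>j. j < n \<Longrightarrow> y j \<in> F"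
      using D' unfolding determined_def D'_def by blast+
    then show "measure Q C \<le> measure P C"
      unfolding y(2) by (rule le)
  qed
  also have "\<dots> = measure P D'"
    by (rule measure_determined_sum[OF P fin D', symmetric])
  also have "\<dots> \<le> measure P (X \<union> (sym_diff X D))"
  proof (rule P.finite_measure_mono)
    show "D' \<subseteq> X \<union> (sym_diff X D)"
      unfolding D'_def by blast
  qed (use sets in auto)
  also have "\<dots> \<le> measure P X + measure P (sym_diff X D)"
    using sets by (intro measure_Un_le) auto
  finally show "measure Q X \<le> measure P X + e"
    using D by simp
qed

text \<open>The interface to path measures: \<open>P\<close> is pinned down by the kernels
  \<open>K\<close>, which give the next letter from a prefix. Facts about strategies are derived
  from these properties without returning to the Ionescu-Tulcea construction.\<close>

locale seq_process =
  fixes E :: "'e set" and K :: "nat \<Rightarrow> (nat \<Rightarrow> 'e) \<Rightarrow> 'e pmf" and P :: "(nat \<Rightarrow> 'e) measure"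
  assumes finite_E: "finite E"
    and prob_P: "prob_space P"
    and sets_P: "sets P = sets (seq_space E)"
    and K_cong: "\<And>n z z'. (\<And>j. j < n \<Longrightarrow> z j = z' j) \<Longrightarrow> K n z = K n z'"
    and K_support: "\<And>n z. z \<in> seqs E \<Longrightarrow> set_pmf (K n z) \<subseteq> E"
    and measure_cyl_Suc: "\<And>n y. y \<in> seqs E \<Longrightarrow>
      measure P (cyl E (Suc n) y) = measure P (cyl E n y) * pmf (K n y) (y n)"
begin

sublocale prob_space P
  by (rule prob_P)

lemma space_P: "space P = seqs E"
  using sets_eq_imp_space_eq[OF sets_P] by simp

lemma finite_P: "finite_measure P"
  by unfold_locales

lemma measure_cyl_step:
  assumes y: "y \<in> seqs E"
  shows "measure P {z \<in> cyl E n y. z n \<in> D} = measure P (cyl E n y) * measure (K n y) D"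
proof -
  have eq: "{z \<in> cyl E n y. z n \<in> D} = (\<Union>e\<in>D \<inter> E. cyl E (Suc n) (y(n := e)))"
    by (auto simp: cyl_def less_Suc_eq seqs_def)
  have yu: "y(n := e) \<in> seqs E" if "e \<in> E" for e
    using y that by (auto simp: seqs_def)
  have c: "cyl E n (y(n := e)) = cyl E n y" for e
    by (auto simp: cyl_def)
  have k: "K n (y(n := e)) = K n y" for e
    by (rule K_cong) auto
  have "measure P (\<Union>e\<in>D \<inter> E. cyl E (Suc n) (y(n := e)))
      = (\<Sum>e\<in>D \<inter> E. measure P (cyl E (Suc n) (y(n := e))))"
  proof (rule finite_measure_finite_Union)
    show "disjoint_family_on (\<lambda>e. cyl E (Suc n) (y(n := e))) (D \<inter> E)"
      unfolding disjoint_family_on_def cyl_def by fastforce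
    show "finite (D \<inter> E)"
      using finite_E by simp
    show "(\<lambda>e. cyl E (Suc n) (y(n := e))) ` (D \<inter> E) \<subseteq> events"
      unfolding sets_P by (intro image_subsetI cyl_sets)
  qed
  also have "\<dots> = (\<Sum>e\<in>D \<inter> E. measure P (cyl E n y) * pmf (K n y) e)"
  proof (rule sum.cong[OF refl])
    fix e assume "e \<in> D \<inter> E"
    then show "prob (cyl E (Suc n) (y(n := e))) = prob (cyl E n y) * pmf (K n y) e"
      using measure_cyl_Suc[OF yu, of e n] unfolding c k by simp
  qed
  also have "\<dots> = measure P (cyl E n y) * measure (K n y) (D \<inter> E)"
    using finite_E by (simp add: sum_distrib_left[symmetric] measure_measure_pmf_finite)
  also have "measure (K n y) (D \<inter> E) = measure (K n y) D"
    using K_support[OF y, of n] by (intro measure_pmf.finite_measure_eq_AE AE_pmfI) auto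
  finally show ?thesis unfolding eq .
qed

text \<open>On each cylinder of length \<open>n\<close> inside \<open>X\<close> both the kernel and
  the condition \<open>R\<close> are constant, so the cylinder contributes at most its mass times
  \<open>c\<close>.\<close>

lemma measure_step_le:
  assumes X: "determined E n X" and Y: "{z \<in> X. R z (z n)} \<in> sets P"
    and R: "\<And>z z' e. (\<And>j. j < n \<Longrightarrow> z j = z' j) \<Longrightarrow> R z e = R z' e"
    and le: "\<And>z. z \<in> X \<Longrightarrow> measure (K n z) {e. R z e} \<le> c"
  shows "measure P {z \<in> X. R z (z n)} \<le> measure P X * c"
proof -
  let ?Y = "{z \<in> X. R z (z n)}"
  have Xs: "X \<subseteq> seqs E" using X by (simp add: determined_def)
  have C: "measure P (cyl E n y \<inter> ?Y) = measure P (cyl E n y) * measure (K n y) {e. R y e}"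
    if "y \<in> X" for y
  proof -
    have "cyl E n y \<inter> ?Y = {z \<in> cyl E n y. z n \<in> {e. R y e}}"
    proof -
      have "z \<in> X" if "z \<in> cyl E n y" for z
        using that X \<open>y \<in> X\<close> unfolding determined_def by (simp add: cyl_def)
      moreover have "R z e = R y e" if "z \<in> cyl E n y" for z e
        using that unfolding cyl_def by (intro R) blast
      ultimately show ?thesis by auto
    qed
    then show ?thesis
      using measure_cyl_step[of y n "{e. R y e}"] that Xs by auto
  qed
  have "measure P ?Y = measure P (X \<inter> ?Y)"
    by (rule arg_cong[where f="measure P"]) auto
  also have "\<dots> = (\<Sum>C\<in>cyl E n ` X. measure P (C \<inter> ?Y))"
    by (rule measure_determined[OF finite_P sets_P finite_E X Y])
  also have "\<dots> \<le> (\<Sum>C\<in>cyl E n ` X. measure P C * c)"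
    using le by (intro sum_mono) (auto simp: C intro!: mult_left_mono)
  also have "\<dots> = measure P X * c"
    using measure_determined_sum[OF finite_P sets_P finite_E X] by (simp add: sum_distrib_right)
  finally show ?thesis .
qed

text \<open>The lower bound is the upper bound for the complementary condition, whose kernel
  probability is \<open>1 - c\<close>.\<close>

lemma measure_step_eq:
  assumes X: "determined E n X" and Y: "{z \<in> X. R z (z n)} \<in> sets P"
    and R: "\<And>z z' e. (\<And>j. j < n \<Longrightarrow> z j = z' j) \<Longrightarrow> R z e = R z' e"
    and eq: "\<And>z. z \<in> X \<Longrightarrow> measure (K n z) {e. R z e} = c"
  shows "measure P {z \<in> X. R z (z n)} = measure P X * c"
proof (rule antisym)
  show "measure P {z \<in> X. R z (z n)} \<le> measure P X * c"
  proof (rule measure_step_le[where R=R and n=n and X=X and c=c])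
    show "R z e = R z' e" if "\<And>j. j < n \<Longrightarrow> z j = z' j" for z z' e
      by (rule R) (rule that)
    show "measure (K n z) {e. R z e} \<le> c" if "z \<in> X" for z
      using eq[OF that] by simp
  qed (fact X, fact Y)
  have XP: "X \<in> sets P"
    using determined_sets[OF finite_E X] sets_P by simp
  have diff: "{z \<in> X. \<not> R z (z n)} = X - {z \<in> X. R z (z n)}" by auto
  have "measure P {z \<in> X. \<not> R z (z n)} \<le> measure P X * (1 - c)"
  proof (rule measure_step_le[where R="\<lambda>z e. \<not> R z e" and n=n and X=X and c="1-c", OF X])
    show "{z \<in> X. \<not> R z (z n)} \<in> sets P"
      unfolding diff using XP Y by auto
    show "measure (K n z) {e. \<not> R z e} \<le> 1 - c" if "z \<in> X" for z
      using measure_pmf.prob_compl[of "{e. R z e}" "K n z"] eq[OF that]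
      by (simp add: Compl_eq_Diff_UNIV[symmetric] Collect_neg_eq)
    show "(\<not> R z e) = (\<not> R z' e)" if "\<And>j. j < n \<Longrightarrow> z j = z' j" for z z' e
      using R[of z z' e] that by metis
  qed
  moreover have "measure P {z \<in> X. \<not> R z (z n)} = measure P X - measure P {z \<in> X. R z (z n)}"
    unfolding diff using XP Y by (intro finite_measure_Diff) auto
  ultimately show "measure P X * c \<le> measure P {z \<in> X. R z (z n)}"
    by (simp add: algebra_simps)
qed

text \<open>Violations have kernel probability \<open>0\<close>, so \<open>measure_step_le\<close>
  applies with \<open>c = 0\<close>.\<close>

lemma AE_step:
  assumes R: "\<And>z z' e. (\<And>j. j < n \<Longrightarrow> z j = z' j) \<Longrightarrow> R z e = R z' e"
    and supp: "\<And>z e. z \<in> seqs E \<Longrightarrow> e \<in> set_pmf (K n z) \<Longrightarrow> R z e"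
  shows "AE z in P. R z (z n)"
proof (rule AE_I')
  let ?N = "{z \<in> seqs E. \<not> R z (z n)}"
  have "determined E (Suc n) ?N"
  proof (rule determined_Collect)
    fix z z' assume "\<And>j. j < Suc n \<Longrightarrow> z' j = z j" "\<not> R z (z n)"
    then show "\<not> R z' (z' n)"
      using R[of z' z] by auto
  qed
  then have s: "?N \<in> sets P"
    using determined_sets[OF finite_E] sets_P by metis
  have "measure P ?N \<le> measure P (seqs E) * 0"
  proof (rule measure_step_le[where R="\<lambda>z e. \<not> R z e" and n=n and X="seqs E" and c=0])
    show "determined E n (seqs E)" by (auto simp: determined_def)
    show "measure (K n z) {e. \<not> R z e} \<le> 0" if "z \<in> seqs E" for z
    proof -
      have "set_pmf (K n z) \<inter> {e. \<not> R z e} = {}"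
        using supp[OF that] by blast
      then show ?thesis
        using measure_pmf_zero_iff[of "K n z"] by (metis order_refl)
    qed
    show "(\<not> R z e) = (\<not> R z' e)" if "\<And>j. j < n \<Longrightarrow> z j = z' j" for z z' e
      using R[of z z' e] that by metis
  qed (rule s)
  then show "?N \<in> null_sets P"
    using s by (auto simp: null_sets_def emeasure_eq_measure measure_le_0_iff)
  show "{z \<in> space P. \<not> R z (z n)} \<subseteq> ?N"
    by (auto simp: space_P)
qed

lemma cyl_eq_imp_eq:
  assumes "finite_measure Q" "sets Q = sets (seq_space E)"
    and "\<And>n y. y \<in> seqs E \<Longrightarrow> measure Q (cyl E n y) = measure P (cyl E n y)"
  shows "Q = P"
proof (rule measure_eqI)
  interpret Q: finite_measure Q by fact
  show "sets Q = sets P" using assms sets_P by simp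
  fix X assume X: "X \<in> sets Q"
  then have "X \<in> sets (seq_space E)" "X \<subseteq> seqs E"
    using assms(2) sets.sets_into_space[of X "seq_space E"] by auto
  then have "measure Q X = measure P X"
    using measure_le_if_cyl_le[OF finite_P sets_P assms(1,2) finite_E, of X E]
      measure_le_if_cyl_le[OF assms(1,2) finite_P sets_P finite_E, of X E] assms(3)
    by (intro antisym) auto
  then show "emeasure Q X = emeasure P X"
    by (simp add: Q.emeasure_eq_measure emeasure_eq_measure)
qed

end

text \<open>\<open>F\<close> is causal: its output at \<open>n\<close> depends on the input up to
  \<open>n\<close>. With matching kernels the image measure obeys the recursion of \<open>P'\<close>
  on cylinders, and cylinders determine the measure.\<close>

lemma seq_process_pushforward:
  assumes "seq_process E K P" "seq_process E' K' P'"
    and F_seqs: "\<And>z. z \<in> seqs E \<Longrightarrow> F z \<in> seqs E'"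
    and F_cong: "\<And>n z z'. (\<And>j. j \<le> n \<Longrightarrow> z j = z' j) \<Longrightarrow> F z n = F z' n"
    and step: "\<And>n z. z \<in> seqs E \<Longrightarrow> map_pmf (\<lambda>e. F (fun_upd z n e) n) (K n z) = K' n (F z)"
  shows "F \<in> measurable P (seq_space E')" "distr P (seq_space E') F = P'"
proof -
  interpret P: seq_process E K P by fact
  interpret P': seq_process E' K' P' by fact
  show F: "F \<in> measurable P (seq_space E')"
    unfolding seq_space_def
  proof (rule measurable_PiM_single')
    fix i
    show "(\<lambda>z. F z i) \<in> measurable P (count_space E')"
    proof (rule measurable_count_space_eq2[THEN iffD2, OF P'.finite_E], intro conjI ballI)
      show "(\<lambda>z. F z i) \<in> space P \<rightarrow> E'"
        using F_seqs by (auto simp: P.space_P seqs_def)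
      fix e assume "e \<in> E'"
      have "determined E (Suc i) {z \<in> seqs E. F z i = e}"
      proof (rule determined_Collect)
        fix z z' assume "\<And>j. j < Suc i \<Longrightarrow> z' j = z j" "F z i = e"
        then show "F z' i = e"
          using F_cong[of i z' z] by auto
      qed
      then have "{z \<in> seqs E. F z i = e} \<in> sets P"
        using determined_sets[OF P.finite_E] P.sets_P by metis
      moreover have "(\<lambda>z. F z i) -` {e} \<inter> space P = {z \<in> seqs E. F z i = e}"
        by (auto simp: P.space_P)
      ultimately show "(\<lambda>z. F z i) -` {e} \<inter> space P \<in> sets P" by simp
    qed
  qed (use F_seqs in \<open>auto simp: seqs_def P.space_P PiE_iff\<close>)
  let ?Q = "distr P (seq_space E') F"
  interpret Q: prob_space ?Q
    by (rule P.prob_space_distr[OF F])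
  show "?Q = P'"
  proof (rule P'.cyl_eq_imp_eq)
    show "finite_measure ?Q" by unfold_locales
    show "sets ?Q = sets (seq_space E')" by simp
    fix n y assume y: "y \<in> seqs E'"
    show "measure ?Q (cyl E' n y) = measure P' (cyl E' n y)"
    proof (induction n)
      case 0
      show ?case
        using Q.prob_space P'.prob_space by (simp add: P'.space_P)
    next
      case (Suc n)
      let ?X = "{z \<in> seqs E. \<forall>j<n. F z j = y j}"
      have m: "measure ?Q (cyl E' k y) = measure P {z \<in> seqs E. \<forall>j<k. F z j = y j}" for k
      proof -
        have "F -` cyl E' k y \<inter> space P = {z \<in> seqs E. \<forall>j<k. F z j = y j}"
          using F_seqs unfolding P.space_P cyl_def by blast
        then show ?thesis
          using measure_distr[OF F cyl_sets, of k y] by metis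
      qed
      have det: "determined E k {z \<in> seqs E. \<forall>j<k. F z j = y j}" for k
      proof (rule determined_Collect)
        fix z z' assume *: "\<And>j. j < k \<Longrightarrow> z' j = z j" "\<forall>j<k. F z j = y j"
        have "F z' j = F z j" if "j < k" for j
          by (rule F_cong) (use *(1) that in auto)
        then show "\<forall>j<k. F z' j = y j"
          using *(2) by metis
      qed
      \<comment> \<open>Writing the letter at \<open>n\<close> explicitly turns the condition on
        \<open>F z n\<close> into one on a prefix and the next letter, as
        \<open>measure_step_eq\<close> requires.\<close>
      define R where "R = (\<lambda>z e. F (fun_upd z n e) n = y n)"
      have eq: "{z \<in> seqs E. \<forall>j<Suc n. F z j = y j} = {z \<in> ?X. R z (z n)}"
        unfolding R_def All_less_Suc by auto
      have "measure P {z \<in> ?X. R z (z n)} = measure P ?X * pmf (K' n y) (y n)"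
      proof (rule P.measure_step_eq[where R=R and n=n and X="?X", OF det])
        show "{z \<in> ?X. R z (z n)} \<in> sets P"
          using determined_sets[OF P.finite_E det[of "Suc n"]] unfolding eq P.sets_P .
        show "R z e = R z' e" if "\<And>j. j < n \<Longrightarrow> z j = z' j" for z z' e
        proof -
          have "F (fun_upd z n e) n = F (fun_upd z' n e) n"
            by (rule F_cong) (use that in auto)
          then show ?thesis by (simp add: R_def)
        qed
        fix z assume z: "z \<in> ?X"
        have "measure (K n z) {e. R z e} = measure (map_pmf (\<lambda>e. F (fun_upd z n e) n) (K n z)) {y n}"
          by (simp add: R_def vimage_def)
        also have "\<dots> = pmf (K' n (F z)) (y n)"
          using step z by (simp add: measure_pmf_single)
        also have "K' n (F z) = K' n y"
          using z by (intro P'.K_cong) auto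
        finally show "measure (K n z) {e. R z e} = pmf (K' n y) (y n)" .
      qed
      then show ?case
        unfolding m[of "Suc n"] eq P'.measure_cyl_Suc[OF y] Suc[symmetric] m[of n] .
    qed
  qed
qed

section \<open>Path measures of Markov decision processes\<close>

text \<open>What finite MDPs and their products have in common: in a product, states without enabled
  actions may occur.\<close>

definition wf_MDP :: "('s, 'a, 'l) mdp \<Rightarrow> bool" where
  "wf_MDP N \<longleftrightarrow> finite (mdp_states N) \<and> finite (mdp_acts N) \<and> mdp_init N \<in> mdp_states N \<and>
     (\<forall>s\<in>mdp_states N. \<forall>a\<in>mdp_acts N. \<forall>p. mdp_trans N s a = Some p \<longrightarrow> set_pmf p \<subseteq> mdp_states N)"

lemma finite_MDP_imp_wf: "finite_MDP \<Sigma> M \<Longrightarrow> wf_MDP M"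
  by (simp add: finite_MDP_def wf_MDP_def)

lemma finite_entries: "wf_MDP N \<Longrightarrow> finite (entries N)"
  by (simp add: wf_MDP_def entries_def)

lemma set_choose_pmf:
  assumes "\<pi> \<in> strategies N" "s \<in> mdp_states N" "e \<in> set_pmf (choose_pmf N \<pi> h s)"
  shows "(e = None \<and> enabled N s = {}) \<or> (\<exists>a\<in>enabled N s. e = Some (s, a))"
  using assms unfolding choose_pmf_def strategies_def by (auto split: if_splits)

lemma enabled_subset: "enabled N s \<subseteq> mdp_acts N"
  by (auto simp: enabled_def)

lemma set_step_pmf_subset:
  assumes "wf_MDP N" "\<pi> \<in> strategies N" "\<And>j. j < n \<Longrightarrow> z j \<in> entries N"
  shows "set_pmf (step_pmf N \<pi> n z) \<subseteq> entries N"
proof (cases n)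
  case 0
  then show ?thesis
    using set_choose_pmf[OF assms(2), of "mdp_init N"] assms(1) enabled_subset[of N]
    by (fastforce simp: wf_MDP_def entries_def)
next
  case (Suc k)
  show ?thesis
  proof
    fix e assume e: "e \<in> set_pmf (step_pmf N \<pi> n z)"
    show "e \<in> entries N"
    proof (cases "z k")
      case None
      then show ?thesis using e Suc by (simp add: entries_def)
    next
      case (Some sa)
      obtain s a where sa: "sa = (s, a)" by force
      have in_N: "s \<in> mdp_states N" "a \<in> mdp_acts N"
        using assms(3)[of k] Suc Some sa by (auto simp: entries_def)
      show ?thesis
      proof (cases "mdp_trans N s a")
        case None
        then show ?thesis using e Suc Some sa by (simp add: entries_def)
      next
        case (Some p)
        then obtain s' where s': "s' \<in> set_pmf p"
          "e \<in> set_pmf (choose_pmf N \<pi> (map (the \<circ> z) [0..<Suc k]) s')"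
          using e Suc \<open>z k = Some sa\<close> sa by auto
        then have "s' \<in> mdp_states N"
          using assms(1) in_N Some by (auto simp: wf_MDP_def)
        then show ?thesis
          using set_choose_pmf[OF assms(2) _ s'(2)] enabled_subset[of N]
          by (auto simp: entries_def)
      qed
    qed
  qed
qed

lemma step_pmf_cong:
  assumes "\<And>j. j < n \<Longrightarrow> z j = z' j"
  shows "step_pmf N \<pi> n z = step_pmf N \<pi> n z'"
proof (cases n)
  case (Suc k)
  have "map (the \<circ> z) [0..<Suc k] = map (the \<circ> z') [0..<Suc k]" "z k = z' k"
    using assms Suc by (auto simp del: upt_Suc)
  then show ?thesis by (simp only: Suc step_pmf.simps)
qed simp

text \<open>The kernels live on finite products of a finite set, where every set is measurable. The
  mass of a cylinder is the mass of one point under the \<open>n\<close>-step measure of the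
  Ionescu-Tulcea construction, and a further step multiplies it by the probability of the next
  entry.\<close>

lemma seq_process_path_measure:
  fixes N :: "('s, 'a, 'l) mdp"
  assumes wf: "wf_MDP N" and \<pi>: "\<pi> \<in> strategies N"
  shows "seq_process (entries N) (step_pmf N \<pi>) (path_measure N \<pi>)"
proof -
  let ?E = "entries N"
  let ?M = "\<lambda>_::nat. count_space ?E"
  have fin: "finite ?E" by (rule finite_entries[OF wf])
  have PiM_eq: "PiM {0..<i} ?M = count_space (PiE {0..<i} (\<lambda>_. ?E))" for i
    using fin by (intro count_space_PiM_finite) (auto intro: countable_finite)
  have supp: "set_pmf (step_pmf N \<pi> i x) \<subseteq> ?E" if "x \<in> PiE {0..<i} (\<lambda>_. ?E)" for i x
    by (rule set_step_pmf_subset[OF wf \<pi>]) (use that in auto)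
  \<comment> \<open>Restricting to \<open>entries N\<close> keeps the total mass, because the step
    distribution is supported there.\<close>
  have prob: "prob_space (step_measure N \<pi> i x)" if "x \<in> PiE {0..<i} (\<lambda>_. ?E)" for i x
  proof -
    have "AE e in measure_pmf (step_pmf N \<pi> i x). e \<in> ?E"
      using supp[OF that] by (auto simp: AE_measure_pmf_iff)
    then have "emeasure (measure_pmf (step_pmf N \<pi> i x)) ?E = 1"
      by (intro measure_pmf.emeasure_eq_1_AE) auto
    then show ?thesis
      unfolding step_measure_def by (intro prob_space_restrict_space) auto
  qed
  have sets_step: "sets (step_measure N \<pi> i x) = sets (count_space ?E)" for i x
    by (auto simp: step_measure_def sets_restrict_space)
  interpret IT: Ionescu_Tulcea "step_measure N \<pi>" ?M
  proof (rule Ionescu_Tulcea.intro, goal_cases)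
    case (1 i)
    show "step_measure N \<pi> i \<in> measurable (PiM {0..<i} ?M) (subprob_algebra (count_space ?E))"
      unfolding PiM_eq
      using prob sets_step by (auto simp: space_subprob_algebra prob_space_imp_subprob_space)
  next
    case (2 i x)
    then show ?case
      using prob unfolding PiM_eq by simp
  qed
  have path: "path_measure N \<pi> = IT.PF.lim"
    by (simp only: path_measure_def Let_def)
  let ?u = "\<lambda>_::nat. undefined :: ('s \<times> 'a) option"
  have u: "?u \<in> space (PiM {0..<0} ?M)"
    by (simp add: space_PiM)
  have seqs_PiE: "seqs ?E = PiE UNIV (\<lambda>_. ?E)"
    by (auto simp: seqs_def PiE_iff)
  have r_in: "restrict y {0..<n} \<in> PiE {0..<n} (\<lambda>_. ?E)" if "y \<in> seqs ?E" for y n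
    using that by (auto simp: seqs_def)
  have cyl: "emeasure (path_measure N \<pi>) (cyl ?E n y) = emeasure (IT.C 0 n ?u) {restrict y {0..<n}}"
    if y: "y \<in> seqs ?E" for n y
  proof -
    have X: "{restrict y {0..<n}} \<in> sets (PiM {0..<n} ?M)"
      unfolding PiM_eq using r_in[OF y] by simp
    have "restrict z {0..<n} = restrict y {0..<n} \<longleftrightarrow> (\<forall>j<n. z j = y j)" for z
      by (metis atLeastLessThan_iff le0 restrict_apply' restrict_ext)
    then have "cyl ?E n y = IT.PF.emb UNIV {0..<n} {restrict y {0..<n}}"
      unfolding cyl_def prod_emb_def seqs_PiE by auto
    then have "emeasure (path_measure N \<pi>) (cyl ?E n y) = emeasure (IT.CI {0..<n}) {restrict y {0..<n}}"
      using IT.lim[OF _ X] path by simp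
    also have "\<dots> = emeasure (IT.C 0 n ?u) (IT.PF.emb {0..<n} {0..<n} {restrict y {0..<n}})"
      by (rule IT.emeasure_CI[OF _ X]) simp
    also have "IT.PF.emb {0..<n} {0..<n} {restrict y {0..<n}} = {restrict y {0..<n}}"
      using X[THEN sets.sets_into_space] by (intro prod_emb_id) (simp add: space_PiM)
    finally show ?thesis .
  qed
  have step: "emeasure (path_measure N \<pi>) (cyl ?E (Suc n) y)
      = emeasure (path_measure N \<pi>) (cyl ?E n y) * pmf (step_pmf N \<pi> n y) (y n)"
    if y: "y \<in> seqs ?E" for n y
  proof -
    let ?r = "restrict y {0..<n}" and ?r' = "restrict y {0..<Suc n}"
    have X: "{?r'} \<in> sets (PiM {0..<Suc n} ?M)"
      unfolding PiM_eq using r_in[OF y, of "Suc n"] by simp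
    have spC: "space (IT.C 0 n ?u) = PiE {0..<n} (\<lambda>_. ?E)"
      using IT.space_C[OF u, of n] by (simp add: space_PiM)
    have setsC: "sets (IT.C 0 n ?u) = sets (PiM {0..<n} ?M)"
      using IT.sets_C[OF u, of n] by simp
    \<comment> \<open>Extending \<open>x\<close> by one entry gives the longer prefix only if
      \<open>x\<close> is the shorter one, so a single point contributes to the integral
      below.\<close>
    have eP: "emeasure (IT.eP n x) {?r'}
        = ennreal (pmf (step_pmf N \<pi> n y) (y n)) * indicator {?r} x"
      if x: "x \<in> PiE {0..<n} (\<lambda>_. ?E)" for x
    proof -
      have "emeasure (IT.eP n x) {?r'}
          = emeasure (step_measure N \<pi> n x) ((\<lambda>e. fun_upd x n e) -` {?r'} \<inter> ?E)"
        using IT.emeasure_eP[OF _ X, of x] x by (simp add: space_PiM)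
      also have "(\<lambda>e. fun_upd x n e) -` {?r'} \<inter> ?E = (if x = ?r then {y n} else {})"
      proof -
        have *: "fun_upd x n e = ?r' \<longleftrightarrow> x = ?r \<and> e = y n" for e
        proof
          assume l: "fun_upd x n e = ?r'"
          have "x j = ?r j" for j
            using fun_cong[OF l, of j] x by (cases "j < n") (auto simp: PiE_iff extensional_def)
          then show "x = ?r \<and> e = y n"
            using fun_cong[OF l, of n] by auto
        qed (auto simp: fun_eq_iff)
        have "y n \<in> ?E" using y by (simp add: seqs_def)
        have "(\<lambda>e. fun_upd x n e) -` {?r'} = {e. x = ?r \<and> e = y n}"
          unfolding vimage_def using * by (simp only: singleton_iff)
        with \<open>y n \<in> ?E\<close> show ?thesis by auto
      qed
      also have "emeasure (step_measure N \<pi> n x) (if x = ?r then {y n} else {})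
          = ennreal (pmf (step_pmf N \<pi> n y) (y n)) * indicator {?r} x"
      proof (cases "x = ?r")
        case True
        have "y n \<in> ?E" using y by (simp add: seqs_def)
        then have "emeasure (step_measure N \<pi> n ?r) {y n} = pmf (step_pmf N \<pi> n ?r) (y n)"
          unfolding step_measure_def by (subst emeasure_restrict_space) (auto simp: emeasure_pmf_single)
        also have "step_pmf N \<pi> n ?r = step_pmf N \<pi> n y"
          by (rule step_pmf_cong) simp
        finally have "emeasure (step_measure N \<pi> n ?r) {y n} = pmf (step_pmf N \<pi> n y) (y n)" .
        moreover have "indicator {?r} x = (1 :: ennreal)"
          using True by (simp del: restrict_apply)
        ultimately show ?thesis using True by (simp only: if_True simp_thms mult_1_right)
      qed simp
      finally show ?thesis .
    qed
    have "emeasure (IT.C 0 (Suc n) ?u) {?r'} = (\<integral>\<^sup>+x. emeasure (IT.eP n x) {?r'} \<partial>IT.C 0 n ?u)"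
    proof -
      have "IT.C 0 (Suc n) ?u = IT.C 0 n ?u \<bind> IT.eP n"
        by simp
      moreover have "space (IT.C 0 n ?u) \<noteq> {}"
        unfolding spC using r_in[OF y, of n] by blast
      moreover have "IT.eP n \<in> measurable (IT.C 0 n ?u) (subprob_algebra (PiM {0..<Suc n} ?M))"
        using IT.measurable_eP[of n] by (simp add: measurable_cong_sets[OF setsC refl])
      ultimately show ?thesis
        using emeasure_bind[OF _ _ X] by metis
    qed
    also have "\<dots> = (\<integral>\<^sup>+x. ennreal (pmf (step_pmf N \<pi> n y) (y n)) * indicator {?r} x \<partial>IT.C 0 n ?u)"
      by (rule nn_integral_cong) (use spC eP in auto)
    also have "\<dots> = ennreal (pmf (step_pmf N \<pi> n y) (y n)) * emeasure (IT.C 0 n ?u) {?r}"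
    proof (rule nn_integral_cmult_indicator)
      show "{?r} \<in> sets (IT.C 0 n ?u)"
        unfolding setsC PiM_eq using r_in[OF y] by simp
    qed
    finally show ?thesis
      unfolding cyl[OF y] by (simp add: mult.commute)
  qed
  have setsP: "sets (path_measure N \<pi>) = sets (seq_space ?E)"
    unfolding path seq_space_def by simp
  have prob_P: "prob_space (path_measure N \<pi>)"
  proof
    have "space (path_measure N \<pi>) = seqs ?E"
      using sets_eq_imp_space_eq[OF setsP] by simp
    \<comment> \<open>The whole space is the cylinder of length \<open>0\<close> around any
      sequence; the constantly dead path is one, as \<open>None\<close> is always an entry.\<close>
    moreover define y where "y = (\<lambda>_::nat. None :: ('s \<times> 'a) option)"
    then have y: "y \<in> seqs ?E"
      by (simp add: seqs_def entries_def)
    moreover have "emeasure (IT.C 0 0 ?u) {restrict y {0..<0}} = 1"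
    proof -
      have "restrict y {0..<0} = ?u" by auto
      then show ?thesis
        by (simp add: PiM_empty)
    qed
    ultimately show "emeasure (path_measure N \<pi>) (space (path_measure N \<pi>)) = 1"
      using cyl[OF y, of 0] by simp
  qed
  show ?thesis
  proof (rule seq_process.intro)
    show "finite ?E" by fact
    show "prob_space (path_measure N \<pi>)" by fact
    show "sets (path_measure N \<pi>) = sets (seq_space ?E)" by fact
    show "step_pmf N \<pi> n z = step_pmf N \<pi> n z'" if "\<And>j. j < n \<Longrightarrow> z j = z' j" for n z z'
      by (rule step_pmf_cong) (rule that)
    show "set_pmf (step_pmf N \<pi> n z) \<subseteq> ?E" if "z \<in> seqs ?E" for n z
      by (rule set_step_pmf_subset[OF wf \<pi>]) (use that in \<open>simp add: seqs_def\<close>)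
    interpret prob_space "path_measure N \<pi>" by fact
    show "measure (path_measure N \<pi>) (cyl ?E (Suc n) y)
      = measure (path_measure N \<pi>) (cyl ?E n y) * pmf (step_pmf N \<pi> n y) (y n)" if "y \<in> seqs ?E" for n y
      using step[OF that, of n]
      by (simp add: emeasure_eq_measure ennreal_mult[symmetric])
  qed
qed

section \<open>Almost sure properties of paths\<close>

lemma set_step_pmf_Some:
  assumes "wf_MDP N" "\<pi> \<in> strategies N" "z \<in> seqs (entries N)"
    "Some (s, a) \<in> set_pmf (step_pmf N \<pi> n z)"
  shows "s \<in> mdp_states N \<and> a \<in> enabled N s \<and> (n = 0 \<longrightarrow> s = mdp_init N) \<and>
    (\<forall>k. n = Suc k \<longrightarrow> (\<exists>s0 a0 p. z k = Some (s0, a0) \<and> mdp_trans N s0 a0 = Some p \<and> s \<in> set_pmf p))"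
proof (cases n)
  case 0
  then show ?thesis
    using set_choose_pmf[OF assms(2), of "mdp_init N"] assms(1,4) by (fastforce simp: wf_MDP_def)
next
  case (Suc k)
  then obtain s0 a0 where k: "z k = Some (s0, a0)"
    using assms(4) by (cases "z k") auto
  then obtain p where p: "mdp_trans N s0 a0 = Some p"
    using assms(4) Suc by (cases "mdp_trans N s0 a0") auto
  then obtain s' where s': "s' \<in> set_pmf p"
    "Some (s, a) \<in> set_pmf (choose_pmf N \<pi> (map (the \<circ> z) [0..<Suc k]) s')"
    using assms(4) Suc k by auto
  have "z k \<in> entries N" using assms(3) by (simp add: seqs_def)
  then have "s' \<in> mdp_states N"
    using assms(1) s' p k by (auto simp: wf_MDP_def entries_def)
  then show ?thesis
    using set_choose_pmf[OF assms(2) _ s'(2)] s'(1) k p Suc by auto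
qed

lemma set_step_pmf_None:
  assumes "wf_MDP N" "\<pi> \<in> strategies N" "z \<in> seqs (entries N)"
    "None \<in> set_pmf (step_pmf N \<pi> n z)" "\<And>s. s \<in> mdp_states N \<Longrightarrow> enabled N s \<noteq> {}"
  shows "\<exists>k. n = Suc k \<and> (\<forall>s a. z k = Some (s, a) \<longrightarrow> mdp_trans N s a = None)"
proof (cases n)
  case 0
  then show ?thesis
    using set_choose_pmf[OF assms(2), of "mdp_init N"] assms(1,4,5) by (fastforce simp: wf_MDP_def)
next
  case (Suc k)
  have False if k: "z k = Some (s, a)" and p: "mdp_trans N s a = Some p" for s a p
  proof -
    obtain s' where s': "s' \<in> set_pmf p"
      "None \<in> set_pmf (choose_pmf N \<pi> (map (the \<circ> z) [0..<Suc k]) s')"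
      using assms(4) Suc k p by auto
    have "z k \<in> entries N" using assms(3) by (simp add: seqs_def)
    then have "s' \<in> mdp_states N"
      using assms(1) s' p k by (auto simp: wf_MDP_def entries_def)
    then show False
      using set_choose_pmf[OF assms(2) _ s'(2)] assms(5) by auto
  qed
  then show ?thesis using Suc by fastforce
qed

text \<open>The space \<open>seqs (entries N)\<close> also contains sequences that ignore the
  transitions, so these conditions hold only almost surely. The last one implies that
  \<open>None\<close> is followed by \<open>None\<close>.\<close>

definition consistent :: "('s, 'a, 'l) mdp \<Rightarrow> (nat \<Rightarrow> ('s \<times> 'a) option) \<Rightarrow> bool" where
  "consistent N z \<longleftrightarrow> (\<forall>n s a. z n = Some (s, a) \<longrightarrow> s \<in> mdp_states N \<and> a \<in> enabled N s \<and>
     (n = 0 \<longrightarrow> s = mdp_init N) \<and>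
     (\<forall>k. n = Suc k \<longrightarrow> (\<exists>s0 a0 p. z k = Some (s0, a0) \<and> mdp_trans N s0 a0 = Some p \<and> s \<in> set_pmf p)))"

lemma AE_consistent:
  assumes "wf_MDP N" "\<pi> \<in> strategies N"
  shows "AE z in path_measure N \<pi>. consistent N z"
proof -
  interpret seq_process "entries N" "step_pmf N \<pi>" "path_measure N \<pi>"
    by (rule seq_process_path_measure[OF assms])
  define R where "R n z e \<longleftrightarrow> (\<forall>s a. e = Some (s, a) \<longrightarrow> s \<in> mdp_states N \<and> a \<in> enabled N s \<and>
     (n = 0 \<longrightarrow> s = mdp_init N) \<and>
     (\<forall>k. n = Suc k \<longrightarrow> (\<exists>s0 a0 p. z k = Some (s0, a0) \<and> mdp_trans N s0 a0 = Some p \<and> s \<in> set_pmf p)))"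
    for n z e
  have "AE z in path_measure N \<pi>. R n z (z n)" for n
  proof (rule AE_step)
    show "R n z e = R n z' e" if "\<And>j. j < n \<Longrightarrow> z j = z' j" for z z' e
    proof -
      have "z k = z' k" if "n = Suc k" for k
        using \<open>\<And>j. j < n \<Longrightarrow> z j = z' j\<close>[of k] that by simp
      then show ?thesis unfolding R_def by (cases n) auto
    qed
    show "R n z e" if "z \<in> seqs (entries N)" "e \<in> set_pmf (step_pmf N \<pi> n z)" for z e
      unfolding R_def using set_step_pmf_Some[OF assms that(1)] that(2) by blast
  qed
  then have "AE z in path_measure N \<pi>. \<forall>n. R n z (z n)"
    by (simp add: AE_all_countable)
  then show ?thesis
    by (rule AE_mp) (auto simp: R_def consistent_def intro!: AE_I2)
qed

text \<open>Actions on a consistent path are enabled, so without dead ends the next entry cannot be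
  \<open>None\<close>; induction on the position.\<close>

lemma AE_alive:
  assumes "finite_MDP \<Sigma> M" "\<pi> \<in> strategies M"
  shows "AE z in path_measure M \<pi>. \<forall>k. z k \<noteq> None"
proof -
  have wf: "wf_MDP M" by (rule finite_MDP_imp_wf[OF assms(1)])
  interpret seq_process "entries M" "step_pmf M \<pi>" "path_measure M \<pi>"
    by (rule seq_process_path_measure[OF wf assms(2)])
  define R where "R n z e \<longleftrightarrow> (e = None \<longrightarrow>
      (\<exists>k. n = Suc k \<and> (\<forall>s a. z k = Some (s, a) \<longrightarrow> mdp_trans M s a = None)))"
    for n and z :: "nat \<Rightarrow> ('b \<times> 'c) option" and e :: "('b \<times> 'c) option"
  have en: "\<And>s. s \<in> mdp_states M \<Longrightarrow> enabled M s \<noteq> {}"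
    using assms(1) by (simp add: finite_MDP_def)
  have "AE z in path_measure M \<pi>. R n z (z n)" for n
  proof (rule AE_step)
    show "R n z e = R n z' e" if "\<And>j. j < n \<Longrightarrow> z j = z' j" for z z' e
    proof -
      have "z k = z' k" if "n = Suc k" for k
        using \<open>\<And>j. j < n \<Longrightarrow> z j = z' j\<close>[of k] that by simp
      then show ?thesis unfolding R_def by (cases n) auto
    qed
    show "R n z e" if "z \<in> seqs (entries M)" "e \<in> set_pmf (step_pmf M \<pi> n z)" for z e
      unfolding R_def using set_step_pmf_None[OF wf assms(2) that(1) _ en] that(2) by blast
  qed
  then have 1: "AE z in path_measure M \<pi>. \<forall>n. R n z (z n)"
    by (simp add: AE_all_countable)
  show ?thesis
    using 1 AE_consistent[OF wf assms(2)]
  proof eventually_elim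
    case (elim z)
    have "z k \<noteq> None" for k
    proof (induction k)
      case 0
      show ?case using elim(1) unfolding R_def by (metis Zero_not_Suc)
    next
      case (Suc k)
      then obtain s a where k: "z k = Some (s, a)" by auto
      then have "a \<in> enabled M s" using elim(2) unfolding consistent_def by blast
      then have "mdp_trans M s a \<noteq> None" by (simp add: enabled_def)
      then show ?case
        using elim(1) k unfolding R_def by (metis nat.inject)
    qed
    then show ?case by blast
  qed
qed

lemma coordinatewise_measurable:
  assumes "\<And>e. e \<in> E \<Longrightarrow> g e \<in> E'"
  shows "(\<lambda>z k. g (z k)) \<in> measurable (seq_space E) (seq_space E')"
  unfolding seq_space_def
proof (rule measurable_PiM_single')
  fix i :: nat
  have "g \<in> measurable (count_space E) (count_space E')"
    using assms by simp
  from measurable_compose[OF component_measurable this]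
  show "(\<lambda>z. g (z i)) \<in> measurable (PiM UNIV (\<lambda>_. count_space E)) (count_space E')"
    unfolding seq_space_def .
qed (use assms in \<open>auto simp: space_PiM PiE_iff\<close>)

lemma sets_INFM:
  assumes "\<And>k::nat. {z \<in> space M. R k z} \<in> sets M"
  shows "{z \<in> space M. \<exists>\<^sub>\<infinity>k. R k z} \<in> sets M"
proof -
  have "{z \<in> space M. \<exists>\<^sub>\<infinity>k. R k z} = (\<Inter>n. \<Union>k\<in>{n..}. {z \<in> space M. R k z})"
    by (auto simp: INFM_nat_le)
  moreover have "(\<Union>k\<in>{n..}. {z \<in> space M. R k z}) \<in> sets M" for n
    using assms by (intro sets.countable_UN') auto
  ultimately show ?thesis by auto
qed

section \<open>The product of a finite MDP with an automaton\<close>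

locale mdp_product =
  fixes M :: "('s, 'a, 'l) mdp" and C :: "('q, 'l) aut" and q\<^sub>0 :: 'q
  assumes fin_M: "finite_MDP (alphabet C) M" and fin_C: "finite (states C)" and init_C: "q\<^sub>0 \<in> states C"
    and trans_C: "\<And>q \<sigma>. trans C q \<sigma> \<subseteq> states C"
begin

abbreviation "N \<equiv> product M C q\<^sub>0"

lemma wf_M: "wf_MDP M"
  by (rule finite_MDP_imp_wf[OF fin_M])

lemma enabled_M: "s \<in> mdp_states M \<Longrightarrow> enabled M s \<noteq> {}"
  using fin_M by (simp add: finite_MDP_def)

lemma wf_N: "wf_MDP N"
  using wf_M fin_C init_C unfolding wf_MDP_def
  by (auto simp: product_def split: if_splits) blast

lemma enabled_N: "enabled N (s, q) = enabled M s \<times> trans C q (mdp_label M s)"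
  using trans_C by (auto simp: enabled_def product_def split: if_splits)

lemma acc_event_sets: "acc_event M C q\<^sub>0 \<in> sets (seq_space (entries N))"
proof -
  let ?R = "\<lambda>k z. \<exists>s q a q'. z k = Some ((s, q), (a, q')) \<and> q' \<in> dist_trans C q (mdp_label M s)"
  have "{z \<in> seqs (entries N). ?R k z} \<in> sets (seq_space (entries N))" for k
  proof (rule determined_sets[OF finite_entries[OF wf_N]])
    show "determined (entries N) (Suc k) {z \<in> seqs (entries N). ?R k z}"
      by (rule determined_Collect) simp
  qed
  then have "{z \<in> space (seq_space (entries N)). \<exists>\<^sub>\<infinity>k. ?R k z} \<in> sets (seq_space (entries N))"
    by (intro sets_INFM) simp
  moreover have "acc_event M C q\<^sub>0 = {z \<in> space (seq_space (entries N)). \<exists>\<^sub>\<infinity>k. ?R k z}"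
    by (simp add: acc_event_def seqs_def)
  ultimately show ?thesis by metis
qed

end

section \<open>From resolvers to product strategies\<close>

text \<open>A resolver reads the word only, not the states or actions of an MDP. At a state without
  successor its value is unconstrained; there the product is stuck.\<close>

definition resolver :: "('q, 'l) aut \<Rightarrow> 'q \<Rightarrow> ('l list \<Rightarrow> 'q) \<Rightarrow> bool" where
  "resolver C q \<rho> \<longleftrightarrow> \<rho> [] = q \<and> (\<forall>x \<sigma>. trans C (\<rho> x) \<sigma> \<noteq> {} \<longrightarrow> \<rho> (x @ [\<sigma>]) \<in> trans C (\<rho> x) \<sigma>)"

definition resolver_acc :: "('q, 'l) aut \<Rightarrow> ('l list \<Rightarrow> 'q) \<Rightarrow> (nat \<Rightarrow> 'l) \<Rightarrow> bool" where
  "resolver_acc C \<rho> w \<longleftrightarrow>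
     (\<forall>k. \<rho> (map w [0..<Suc k]) \<in> trans C (\<rho> (map w [0..<k])) (w k)) \<and>
     (\<exists>\<^sub>\<infinity>k. \<rho> (map w [0..<Suc k]) \<in> dist_trans C (\<rho> (map w [0..<k])) (w k))"

definition path_label :: "('s, 'a, 'l) mdp \<Rightarrow> (nat \<Rightarrow> ('s \<times> 'a) option) \<Rightarrow> nat \<Rightarrow> 'l" where
  "path_label M z k = mdp_label M (fst (the (z k)))"

definition run_ok ::
  "('s, 'a, 'l) mdp \<Rightarrow> ('q, 'l) aut \<Rightarrow> ('l list \<Rightarrow> 'q) \<Rightarrow> (nat \<Rightarrow> ('s \<times> 'a) option) \<Rightarrow> nat \<Rightarrow> bool" where
  "run_ok M C \<rho> z j \<longleftrightarrow> z j \<noteq> None \<and>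
     \<rho> (map (path_label M z) [0..<Suc j]) \<in> trans C (\<rho> (map (path_label M z) [0..<j])) (path_label M z j)"

text \<open>The quantifier over all \<open>j \<le> k\<close> makes \<open>None\<close> absorbing, as
  it is almost surely in the product. An entry pairs the automaton state before the letter with the
  successor chosen for it.\<close>

definition lift_path ::
  "('s, 'a, 'l) mdp \<Rightarrow> ('q, 'l) aut \<Rightarrow> ('l list \<Rightarrow> 'q) \<Rightarrow> (nat \<Rightarrow> ('s \<times> 'a) option) \<Rightarrow>
   nat \<Rightarrow> (('s \<times> 'q) \<times> ('a \<times> 'q)) option" where
  "lift_path M C \<rho> z k =
     (if \<forall>j\<le>k. run_ok M C \<rho> z j
      then Some ((fst (the (z k)), \<rho> (map (path_label M z) [0..<k])),
                 (snd (the (z k)), \<rho> (map (path_label M z) [0..<Suc k])))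
      else None)"

text \<open>The labels in the history determine the word read so far, and hence the successor
  prescribed by \<open>\<rho>\<close>. Histories that disagree with \<open>\<rho>\<close> get an
  arbitrary enabled action, which makes this a strategy of the product.\<close>

definition lift_strategy ::
  "('s, 'a, 'l) mdp \<Rightarrow> ('q, 'l) aut \<Rightarrow> 'q \<Rightarrow> ('l list \<Rightarrow> 'q) \<Rightarrow> ('s, 'a) strategy \<Rightarrow>
   ('s \<times> 'q, 'a \<times> 'q) strategy" where
  "lift_strategy M C q\<^sub>0 \<rho> \<pi> h sq =
     (let x = map (\<lambda>e. mdp_label M (fst (fst e))) h; q' = \<rho> (x @ [mdp_label M (fst sq)])
      in if snd sq = \<rho> x \<and> q' \<in> trans C (snd sq) (mdp_label M (fst sq))
         then map_pmf (\<lambda>a. (a, q')) (\<pi> (map (\<lambda>e. (fst (fst e), fst (snd e))) h) (fst sq))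
         else return_pmf (SOME b. b \<in> enabled (product M C q\<^sub>0) sq))"

lemma lift_path_neq_None_iff:
  "lift_path M C \<rho> z k \<noteq> None \<longleftrightarrow> (\<forall>j\<le>k. run_ok M C \<rho> z j)"
  by (simp add: lift_path_def)

lemma lift_path_None_Suc:
  assumes "lift_path M C \<rho> z k = None"
  shows "lift_path M C \<rho> z (Suc k) = None"
proof (rule ccontr)
  assume "lift_path M C \<rho> z (Suc k) \<noteq> None"
  then have "lift_path M C \<rho> z k \<noteq> None"
    unfolding lift_path_neq_None_iff by simp
  then show False using assms by contradiction
qed

lemma path_label_cong:
  "(\<And>j. j < n \<Longrightarrow> z j = z' j) \<Longrightarrow>
    map (path_label M z) [0..<n] = map (path_label M z') [0..<n]"
  by (simp add: path_label_def)

context mdp_product begin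

lemma lift_strategy_in:
  assumes "\<pi> \<in> strategies M"
  shows "lift_strategy M C q\<^sub>0 \<rho> \<pi> \<in> strategies N"
  unfolding strategies_def
proof (intro CollectI allI ballI impI)
  fix h sq assume sq: "sq \<in> mdp_states N" "enabled N sq \<noteq> {}"
  obtain s q where [simp]: "sq = (s, q)" by force
  have s: "s \<in> mdp_states M" using sq(1) by (simp add: product_def)
  have "set_pmf (\<pi> h' s) \<subseteq> enabled M s" for h'
    using assms s enabled_M[OF s] by (simp add: strategies_def)
  moreover have "(SOME b. b \<in> enabled N sq) \<in> enabled N sq"
    using sq(2) by (simp add: some_in_eq)
  ultimately show "set_pmf (lift_strategy M C q\<^sub>0 \<rho> \<pi> h sq) \<subseteq> enabled N sq"
    by (auto simp: lift_strategy_def Let_def enabled_N)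
qed

lemma lift_path_cong:
  assumes "\<And>j. j \<le> n \<Longrightarrow> z j = z' j"
  shows "lift_path M C \<rho> z n = lift_path M C \<rho> z' n"
proof -
  have 1: "map (path_label M z) [0..<j] = map (path_label M z') [0..<j]" if "j \<le> Suc n" for j
    using assms that by (intro path_label_cong) auto
  have 2: "path_label M z j = path_label M z' j" "z j = z' j" if "j \<le> n" for j
    using assms[OF that] by (auto simp: path_label_def)
  have "run_ok M C \<rho> z j = run_ok M C \<rho> z' j" if "j \<le> n" for j
    unfolding run_ok_def 1[OF le_SucI[OF that]] 1[OF Suc_le_mono[THEN iffD2, OF that]] 2[OF that] ..
  then have "(\<forall>j\<le>n. run_ok M C \<rho> z j) = (\<forall>j\<le>n. run_ok M C \<rho> z' j)" by blast
  then show ?thesis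
    unfolding lift_path_def using 1[of n] 1[of "Suc n"] 2[of n] by (metis le_SucI order_refl)
qed

lemma lift_path_seqs:
  assumes "z \<in> seqs (entries M)" "\<rho> [] \<in> states C"
  shows "lift_path M C \<rho> z \<in> seqs (entries N)"
  unfolding seqs_def
proof (intro CollectI allI)
  fix k
  show "lift_path M C \<rho> z k \<in> entries N"
  proof (cases "lift_path M C \<rho> z k = None")
    case True
    then show ?thesis by (simp add: entries_def)
  next
    case False
    let ?x = "\<lambda>j. \<rho> (map (path_label M z) [0..<j])"
    have ok: "\<forall>j\<le>k. run_ok M C \<rho> z j"
      using False by (simp only: lift_path_neq_None_iff)
    then have *: "\<forall>j\<le>k. z j \<noteq> None \<and> ?x (Suc j) \<in> trans C (?x j) (path_label M z j)"
      unfolding run_ok_def .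
    have "?x j \<in> states C" if "j \<le> Suc k" for j
    proof (cases j)
      case 0
      then show ?thesis using assms(2) by simp
    next
      case (Suc i)
      then show ?thesis using * that trans_C by (metis Suc_le_mono subsetD)
    qed
    then have "?x k \<in> states C" "?x (Suc k) \<in> states C" by (simp_all del: upt_Suc)
    moreover have "z k \<noteq> None" "z k \<in> entries M"
      using * assms(1) by (simp_all add: seqs_def)
    then obtain s a where "z k = Some (s, a)" "s \<in> mdp_states M" "a \<in> mdp_acts M"
      by (auto simp: entries_def)
    ultimately show ?thesis
      using ok by (simp add: lift_path_def entries_def product_def del: upt_Suc)
  qed
qed

text \<open>\<open>f\<close> stands for appending an entry to a path and lifting the result; this
  form covers the first step and all later ones. If the automaton has no transition, both sides are
  dead. The value of \<open>f\<close> at \<open>None\<close> does not occur, since states of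
  \<open>M\<close> have enabled actions.\<close>

lemma map_choose_pmf_lift:
  assumes \<pi>: "\<pi> \<in> strategies M" and \<rho>: "resolver C q\<^sub>0 \<rho>" and s: "s \<in> mdp_states M"
    and f: "\<And>a. f (Some (s, a)) =
      (if \<rho> (map (\<lambda>e. mdp_label M (fst (fst e))) h @ [mdp_label M s])
          \<in> trans C (\<rho> (map (\<lambda>e. mdp_label M (fst (fst e))) h)) (mdp_label M s)
       then Some ((s, \<rho> (map (\<lambda>e. mdp_label M (fst (fst e))) h)),
         (a, \<rho> (map (\<lambda>e. mdp_label M (fst (fst e))) h @ [mdp_label M s]))) else None)"
  shows "map_pmf f (choose_pmf M \<pi> (map (\<lambda>e. (fst (fst e), fst (snd e))) h) s)
    = choose_pmf N (lift_strategy M C q\<^sub>0 \<rho> \<pi>) h (s, \<rho> (map (\<lambda>e. mdp_label M (fst (fst e))) h))"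
proof -
  let ?x = "map (\<lambda>e. mdp_label M (fst (fst e))) h"
  let ?h = "map (\<lambda>e. (fst (fst e), fst (snd e))) h"
  have M: "choose_pmf M \<pi> ?h s = map_pmf (\<lambda>a. Some (s, a)) (\<pi> ?h s)"
    using enabled_M[OF s] by (simp add: choose_pmf_def)
  show ?thesis
  proof (cases "trans C (\<rho> ?x) (mdp_label M s) = {}")
    case True
    then have "map_pmf f (choose_pmf M \<pi> ?h s) = map_pmf (\<lambda>_. None) (\<pi> ?h s)"
      unfolding M map_pmf_comp f by simp
    moreover have "choose_pmf N (lift_strategy M C q\<^sub>0 \<rho> \<pi>) h (s, \<rho> ?x) = return_pmf None"
      using True by (simp add: choose_pmf_def enabled_N)
    ultimately show ?thesis by (simp add: map_pmf_const)
  next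
    case False
    then have in_trans: "\<rho> (?x @ [mdp_label M s]) \<in> trans C (\<rho> ?x) (mdp_label M s)"
      using \<rho> unfolding resolver_def by blast
    then show ?thesis
      using enabled_M[OF s] False unfolding M map_pmf_comp f
      by (simp add: choose_pmf_def enabled_N lift_strategy_def map_pmf_comp)
  qed
qed

text \<open>This is the kernel equation that \<open>seq_process_pushforward\<close> asks for. A
  prefix that is already dead stays dead on both sides; on a live one the product moves like
  \<open>M\<close> while the automaton follows \<open>\<rho>\<close>.\<close>

lemma lift_path_step:
  assumes \<pi>: "\<pi> \<in> strategies M" and \<rho>: "resolver C q\<^sub>0 \<rho>" and z: "z \<in> seqs (entries M)"
  shows "map_pmf (\<lambda>e. lift_path M C \<rho> (fun_upd z n e) n) (step_pmf M \<pi> n z)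
    = step_pmf N (lift_strategy M C q\<^sub>0 \<rho> \<pi>) n (lift_path M C \<rho> z)"
    (is "_ = step_pmf N ?\<pi> n (?F z)")
proof (cases n)
  case 0
  have init: "mdp_init M \<in> mdp_states M" using wf_M by (simp add: wf_MDP_def)
  have "\<rho> [] = q\<^sub>0" using \<rho> by (simp add: resolver_def)
  then have "mdp_init N = (mdp_init M, \<rho> [])" by (simp add: product_def)
  moreover have "?F (fun_upd z 0 (Some (mdp_init M, a))) 0
      = (if \<rho> [mdp_label M (mdp_init M)] \<in> trans C (\<rho> []) (mdp_label M (mdp_init M))
         then Some ((mdp_init M, \<rho> []), (a, \<rho> [mdp_label M (mdp_init M)])) else None)" for a
    by (simp add: lift_path_def run_ok_def path_label_def)
  ultimately show ?thesis
    using map_choose_pmf_lift[OF \<pi> \<rho> init, of "\<lambda>e. ?F (fun_upd z 0 e) 0" "[]"] 0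
    by (simp only: list.map append_Nil step_pmf.simps)
next
  case (Suc k)
  let ?x = "\<lambda>j. map (path_label M z) [0..<j]"
  show ?thesis
  proof (cases "?F z k = None")
    case True
    have "?F (fun_upd z n e) n = None" for e
    proof -
      have "?F (fun_upd z n e) k = ?F z k"
        by (rule lift_path_cong) (simp add: Suc)
      then have "?F (fun_upd z n e) k = None"
        using True by simp
      then show ?thesis
        using lift_path_None_Suc Suc by simp
    qed
    then show ?thesis using True Suc by (simp add: map_pmf_const del: fun_upd_apply)
  next
    case False
    then have ok: "\<forall>j\<le>k. run_ok M C \<rho> z j"
      by (simp only: lift_path_neq_None_iff)
    then have good: "\<forall>j\<le>k. z j \<noteq> None \<and> \<rho> (?x (Suc j)) \<in> trans C (\<rho> (?x j)) (path_label M z j)"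
      unfolding run_ok_def .
    then obtain s a where k: "z k = Some (s, a)" by auto
    have sa: "s \<in> mdp_states M" "a \<in> mdp_acts M"
    proof -
      have "z k \<in> entries M" using z by (simp add: seqs_def)
      then show "s \<in> mdp_states M" "a \<in> mdp_acts M" using k by (auto simp: entries_def)
    qed
    have lift_k: "?F z k = Some ((s, \<rho> (?x k)), (a, \<rho> (?x (Suc k))))"
      unfolding lift_path_def using ok k by (simp del: upt_Suc)
    have tr: "\<rho> (?x (Suc k)) \<in> trans C (\<rho> (?x k)) (mdp_label M s)"
      using good k by (auto simp: path_label_def)
    show ?thesis
    proof (cases "mdp_trans M s a")
      case None
      then have "step_pmf M \<pi> n z = return_pmf None"
        using Suc k by simp
      moreover have "step_pmf N ?\<pi> n (?F z) = return_pmf None"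
        using Suc lift_k None by (simp add: product_def del: upt_Suc)
      moreover have "?F (fun_upd z n None) n = None"
        by (auto simp: lift_path_def run_ok_def)
      ultimately show ?thesis by (simp del: fun_upd_apply)
    next
      case (Some p)
      define h where "h = map (the \<circ> ?F z) [0..<Suc k]"
      have lift_j: "?F z j
          = Some ((fst (the (z j)), \<rho> (?x j)), (snd (the (z j)), \<rho> (?x (Suc j))))" if "j \<le> k" for j
        unfolding lift_path_def using ok that by auto
      \<comment> \<open>From the lifted history, \<open>lift_strategy\<close> recovers the word read
        and the history seen by \<open>\<pi>\<close>.\<close>
      have h1: "map (\<lambda>e. mdp_label M (fst (fst e))) h = ?x (Suc k)"
        unfolding h_def using lift_j by (auto simp: path_label_def simp del: upt_Suc)
      have h2: "map (\<lambda>e. (fst (fst e), fst (snd e))) h = map (the \<circ> z) [0..<Suc k]"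
        unfolding h_def using lift_j by (auto simp del: upt_Suc)
      have "step_pmf N ?\<pi> n (?F z)
          = bind_pmf (map_pmf (\<lambda>s'. (s', \<rho> (?x (Suc k)))) p) (choose_pmf N ?\<pi> h)"
        using Suc lift_k Some tr by (simp add: product_def h_def del: upt_Suc)
      also have "\<dots> = bind_pmf p (\<lambda>s'. choose_pmf N ?\<pi> h (s', \<rho> (?x (Suc k))))"
        by (simp add: bind_map_pmf del: upt_Suc)
      also have "\<dots> = bind_pmf p (\<lambda>s'. map_pmf (\<lambda>e. ?F (fun_upd z n e) n)
          (choose_pmf M \<pi> (map (the \<circ> z) [0..<Suc k]) s'))"
      proof (rule bind_pmf_cong[OF refl])
        fix s' assume "s' \<in> set_pmf p"
        then have s': "s' \<in> mdp_states M"
          using wf_M sa Some by (auto simp: wf_MDP_def)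
        have "?F (fun_upd z n (Some (s', a'))) n =
          (if \<rho> (?x (Suc k) @ [mdp_label M s']) \<in> trans C (\<rho> (?x (Suc k))) (mdp_label M s')
           then Some ((s', \<rho> (?x (Suc k))), (a', \<rho> (?x (Suc k) @ [mdp_label M s']))) else None)" for a'
        proof -
          let ?z = "fun_upd z n (Some (s', a'))"
          have x: "map (path_label M ?z) [0..<j] = ?x j" if "j \<le> n" for j
            using that by (intro path_label_cong) auto
          have l: "path_label M ?z j = path_label M z j" if "j < n" for j
            using that by (simp add: path_label_def)
          have l': "path_label M ?z n = mdp_label M s'"
            by (simp add: path_label_def)
          have x': "map (path_label M ?z) [0..<Suc n] = ?x (Suc k) @ [mdp_label M s']"
            using x[of n] l' Suc by simp
          have "(\<forall>j\<le>n. run_ok M C \<rho> ?z j) \<longleftrightarrow> \<rho> (?x (Suc k) @ [mdp_label M s']) \<in> trans C (\<rho> (?x (Suc k))) (mdp_label M s')"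
            (is "(\<forall>j\<le>n. ?G j) \<longleftrightarrow> ?B")
          proof -
            have "?G j" if "j \<le> k" for j
            proof -
              have j: "j \<le> n" "Suc j \<le> n" "j < n" "?z j = z j" using that Suc by simp_all
              show ?thesis
                unfolding run_ok_def x[OF j(1)] x[OF j(2)] l[OF j(3)] j(4) using good that by blast
            qed
            moreover have "?G n \<longleftrightarrow> ?B"
              unfolding run_ok_def x' l' x[OF order_refl] by (simp add: Suc del: upt_Suc)
            ultimately show ?thesis
              unfolding Suc by (metis le_Suc_eq order_refl)
          qed
          then show ?thesis
            unfolding lift_path_def x' x[OF order_refl] by (simp add: Suc del: upt_Suc)
        qed
        from map_choose_pmf_lift[OF \<pi> \<rho> s', of "\<lambda>e. ?F (fun_upd z n e) n" h,
            unfolded h1 h2, OF this]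
        show "choose_pmf N ?\<pi> h (s', \<rho> (?x (Suc k)))
          = map_pmf (\<lambda>e. ?F (fun_upd z n e) n) (choose_pmf M \<pi> (map (the \<circ> z) [0..<Suc k]) s')"
          by (rule sym)
      qed
      also have "\<dots> = map_pmf (\<lambda>e. ?F (fun_upd z n e) n) (step_pmf M \<pi> n z)"
        using Suc k Some by (simp add: map_bind_pmf del: upt_Suc)
      finally show ?thesis by (rule sym)
    qed
  qed
qed

text \<open>The image of the path measure of \<open>\<pi>\<close> under \<open>lift_path\<close> is
  the path measure of the lifted strategy. Almost all paths of \<open>M\<close> are alive forever
  and on \<open>X\<close> the resolver never blocks, so almost every path in \<open>X\<close> has an
  accepting image.\<close>

lemma lift_resolver:
  assumes \<pi>: "\<pi> \<in> strategies M" and \<rho>: "resolver C q\<^sub>0 \<rho>"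
    and X: "X \<in> sets (path_measure M \<pi>)" "\<And>z. z \<in> X \<Longrightarrow> resolver_acc C \<rho> (path_label M z)"
  shows "emeasure (path_measure M \<pi>) X
    \<le> emeasure (path_measure N (lift_strategy M C q\<^sub>0 \<rho> \<pi>)) (acc_event M C q\<^sub>0)"
proof -
  let ?\<pi> = "lift_strategy M C q\<^sub>0 \<rho> \<pi>" and ?F = "lift_path M C \<rho>"
  interpret P: seq_process "entries M" "step_pmf M \<pi>" "path_measure M \<pi>"
    by (rule seq_process_path_measure[OF wf_M \<pi>])
  interpret P': seq_process "entries N" "step_pmf N ?\<pi>" "path_measure N ?\<pi>"
    by (rule seq_process_path_measure[OF wf_N lift_strategy_in[OF \<pi>]])
  have F_seqs: "?F z \<in> seqs (entries N)" if "z \<in> seqs (entries M)" for z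
    using lift_path_seqs[OF that] \<rho> init_C by (simp add: resolver_def)
  have F: "?F \<in> measurable (path_measure M \<pi>) (seq_space (entries N))"
    "distr (path_measure M \<pi>) (seq_space (entries N)) ?F = path_measure N ?\<pi>"
    by (rule seq_process_pushforward[OF P.seq_process_axioms P'.seq_process_axioms F_seqs lift_path_cong
        lift_path_step[OF \<pi> \<rho>]]; assumption)+
  have "emeasure (path_measure N ?\<pi>) (acc_event M C q\<^sub>0)
      = emeasure (path_measure M \<pi>) (?F -` acc_event M C q\<^sub>0 \<inter> space (path_measure M \<pi>))"
    using emeasure_distr[OF F(1) acc_event_sets] F(2) by simp
  moreover have "emeasure (path_measure M \<pi>) X
      \<le> emeasure (path_measure M \<pi>) (?F -` acc_event M C q\<^sub>0 \<inter> space (path_measure M \<pi>))"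
  proof (rule emeasure_mono_AE)
    show "?F -` acc_event M C q\<^sub>0 \<inter> space (path_measure M \<pi>) \<in> sets (path_measure M \<pi>)"
      by (rule measurable_sets[OF F(1) acc_event_sets])
    show "AE z in path_measure M \<pi>. z \<in> X \<longrightarrow> z \<in> ?F -` acc_event M C q\<^sub>0 \<inter> space (path_measure M \<pi>)"
      using AE_alive[OF fin_M \<pi>] AE_space
    proof eventually_elim
      case (elim z)
      show ?case
      proof
        assume "z \<in> X"
        then have acc: "resolver_acc C \<rho> (path_label M z)" by (rule X)
        have "?F z k = Some ((fst (the (z k)), \<rho> (map (path_label M z) [0..<k])),
                 (snd (the (z k)), \<rho> (map (path_label M z) [0..<Suc k])))" for k
          unfolding lift_path_def run_ok_def using elim acc unfolding resolver_acc_def by auto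
        moreover have "\<exists>\<^sub>\<infinity>k. \<rho> (map (path_label M z) [0..<Suc k])
            \<in> dist_trans C (\<rho> (map (path_label M z) [0..<k])) (mdp_label M (fst (the (z k))))"
          using acc by (simp add: resolver_acc_def path_label_def[abs_def])
        ultimately have "?F z \<in> acc_event M C q\<^sub>0"
          using F_seqs[of z] elim by (simp add: acc_event_def P.space_P seqs_def del: upt_Suc)
        then show "z \<in> ?F -` acc_event M C q\<^sub>0 \<inter> space (path_measure M \<pi>)"
          using elim by simp
      qed
    qed
  qed
  ultimately show ?thesis by simp
qed

end

section \<open>From product strategies to strategies of the MDP\<close>

text \<open>Only the outcome \<open>s\<close> can lead into \<open>D\<close>, and it contributes at
  most its own weight.\<close>

lemma emeasure_bind_pmf_le:
  assumes "\<And>x. x \<noteq> s \<Longrightarrow> x \<in> set_pmf p \<Longrightarrow> emeasure (measure_pmf (f x)) D = 0"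
  shows "measure (measure_pmf (bind_pmf p f)) D \<le> pmf p s"
proof -
  have "emeasure (measure_pmf (bind_pmf p f)) D = (\<integral>\<^sup>+x. emeasure (measure_pmf (f x)) D \<partial>measure_pmf p)"
    by (rule emeasure_bind_pmf)
  also have "\<dots> \<le> (\<integral>\<^sup>+x. indicator {s} x \<partial>measure_pmf p)"
    by (intro nn_integral_mono_AE AE_pmfI) (auto simp: assms measure_pmf.emeasure_le_1 split: split_indicator)
  also have "\<dots> = ennreal (pmf p s)"
    by (simp add: emeasure_pmf_single)
  finally show ?thesis
    by (simp add: measure_pmf.emeasure_eq_measure)
qed

lemma consistent_Suc:
  assumes "consistent N z" "z (Suc k) = Some (s, a)"
  shows "\<exists>s0 a0 p. z k = Some (s0, a0) \<and> mdp_trans N s0 a0 = Some p \<and> s \<in> set_pmf p"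
proof -
  have "\<forall>k'. Suc k = Suc k' \<longrightarrow>
    (\<exists>s0 a0 p. z k' = Some (s0, a0) \<and> mdp_trans N s0 a0 = Some p \<and> s \<in> set_pmf p)"
    using assms unfolding consistent_def by metis
  then show ?thesis by simp
qed

definition proj_entry :: "(('s \<times> 'q) \<times> ('a \<times> 'q)) option \<Rightarrow> ('s \<times> 'a) option" where
  "proj_entry = map_option (\<lambda>e. (fst (fst e), fst (snd e)))"

text \<open>The factor of a path probability that belongs to the MDP and not to the
  strategy.\<close>

definition next_prob :: "('s, 'a, 'l) mdp \<Rightarrow> ('s \<times> 'a) list \<Rightarrow> 's \<Rightarrow> real" where
  "next_prob M h s = (if h = [] then of_bool (s = mdp_init M)
     else case mdp_trans M (fst (last h)) (snd (last h)) of None \<Rightarrow> 0 | Some p \<Rightarrow> pmf p s)"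

lemma next_prob_nonneg: "next_prob M h s \<ge> 0"
  by (simp add: next_prob_def split: option.split)

section \<open>Conditioning a product strategy on the projected history\<close>

context mdp_product begin

definition proj_prefix :: "('s \<times> 'a) list \<Rightarrow> (nat \<Rightarrow> (('s \<times> 'q) \<times> ('a \<times> 'q)) option) set" where
  "proj_prefix h = {z \<in> seqs (entries N). \<forall>j<length h. proj_entry (z j) = Some (h ! j)}"

definition prefix_prob :: "('s \<times> 'q, 'a \<times> 'q) strategy \<Rightarrow> ('s \<times> 'a) list \<Rightarrow> real" where
  "prefix_prob \<pi> h = measure (path_measure N \<pi>) (proj_prefix h)"

text \<open>Summing over the next action leaves out the paths on which the product is stuck in
  \<open>s\<close>. This is the normalisation that makes the quotients in
  \<open>proj_strategy\<close> a distribution.\<close>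

definition state_prob :: "('s \<times> 'q, 'a \<times> 'q) strategy \<Rightarrow> ('s \<times> 'a) list \<Rightarrow> 's \<Rightarrow> real" where
  "state_prob \<pi> h s = (\<Sum>a\<in>mdp_acts M. prefix_prob \<pi> (h @ [(s, a)]))"

text \<open>The conditional distribution of the next action given the projected history, conditioned
  also on the product not getting stuck.\<close>

definition proj_strategy :: "('s \<times> 'q, 'a \<times> 'q) strategy \<Rightarrow> ('s, 'a) strategy" where
  "proj_strategy \<pi> h s =
     (if state_prob \<pi> h s > 0
      then embed_pmf (\<lambda>a. if a \<in> mdp_acts M then prefix_prob \<pi> (h @ [(s, a)]) / state_prob \<pi> h s else 0)
      else return_pmf (SOME a. a \<in> enabled M s))"

lemma prefix_prob_nonneg: "prefix_prob \<pi> h \<ge> 0"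
  by (simp add: prefix_prob_def)

lemma finite_acts_M: "finite (mdp_acts M)"
  using wf_M by (simp add: wf_MDP_def)

lemma prefix_prob_le_state_prob:
  "a \<in> mdp_acts M \<Longrightarrow> prefix_prob \<pi> (h @ [(s, a)]) \<le> state_prob \<pi> h s"
  unfolding state_prob_def
  by (rule member_le_sum) (auto simp: prefix_prob_nonneg finite_acts_M)

lemma pmf_proj_strategy:
  assumes "state_prob \<pi> h s > 0"
  shows "pmf (proj_strategy \<pi> h s) a =
    (if a \<in> mdp_acts M then prefix_prob \<pi> (h @ [(s, a)]) / state_prob \<pi> h s else 0)"
proof -
  let ?f = "\<lambda>a. if a \<in> mdp_acts M then prefix_prob \<pi> (h @ [(s, a)]) / state_prob \<pi> h s else 0"
  have nonneg: "?f x \<ge> 0" for x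
    using assms by (simp add: prefix_prob_nonneg)
  have "(\<integral>\<^sup>+ x. ennreal (?f x) \<partial>count_space UNIV) = (\<Sum>x\<in>mdp_acts M. ennreal (?f x))"
    by (rule nn_integral_count_space') (auto simp: finite_acts_M)
  also have "\<dots> = ennreal (\<Sum>x\<in>mdp_acts M. ?f x)"
    by (rule sum_ennreal) (rule nonneg)
  also have "(\<Sum>x\<in>mdp_acts M. ?f x) = (\<Sum>x\<in>mdp_acts M. prefix_prob \<pi> (h @ [(s, x)])) / state_prob \<pi> h s"
    by (simp add: sum_divide_distrib)
  also have "\<dots> = 1"
    using assms by (simp add: state_prob_def)
  finally show ?thesis
    using assms nonneg by (simp add: proj_strategy_def pmf_embed_pmf)
qed

lemma determined_proj_prefix: "determined (entries N) (length h) (proj_prefix h)"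
  unfolding proj_prefix_def by (rule determined_Collect) simp

lemma proj_prefix_snoc:
  "proj_prefix (h @ [e]) = {z \<in> proj_prefix h. proj_entry (z (length h)) = Some e}"
  by (auto simp: proj_prefix_def nth_append less_Suc_eq)

context
  fixes \<pi> :: "('s \<times> 'q, 'a \<times> 'q) strategy"
  assumes \<pi>: "\<pi> \<in> strategies N"
begin

interpretation P: seq_process "entries N" "step_pmf N \<pi>" "path_measure N \<pi>"
  by (rule seq_process_path_measure[OF wf_N \<pi>])

text \<open>Consistent paths take enabled actions only, and the first component of an enabled
  product action is enabled in \<open>M\<close>.\<close>

lemma prefix_prob_enabled:
  assumes "prefix_prob \<pi> (h @ [(s, a)]) > 0"
  shows "a \<in> enabled M s"
proof (rule ccontr)
  assume a: "a \<notin> enabled M s"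
  have "AE z in path_measure N \<pi>. z \<notin> proj_prefix (h @ [(s, a)])"
    using AE_consistent[OF wf_N \<pi>]
  proof eventually_elim
    case (elim z)
    show ?case
    proof
      assume "z \<in> proj_prefix (h @ [(s, a)])"
      then have "proj_entry (z (length h)) = Some (s, a)"
        by (simp add: proj_prefix_snoc)
      then obtain q q' where "z (length h) = Some ((s, q), (a, q'))"
        by (auto simp: proj_entry_def)
      then have "(a, q') \<in> enabled N (s, q)"
        using elim unfolding consistent_def by blast
      then show False using a by (simp add: enabled_N)
    qed
  qed
  then have "prefix_prob \<pi> (h @ [(s, a)]) = 0"
    unfolding prefix_prob_def
    using determined_sets[OF P.finite_E determined_proj_prefix] P.sets_P
    by (subst P.prob_eq_0) auto
  then show False using assms by simp
qed

lemma proj_strategy_in: "proj_strategy \<pi> \<in> strategies M"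
  unfolding strategies_def
proof (intro CollectI allI ballI impI)
  fix h s assume s: "s \<in> mdp_states M" "enabled M s \<noteq> {}"
  show "set_pmf (proj_strategy \<pi> h s) \<subseteq> enabled M s"
  proof (cases "state_prob \<pi> h s > 0")
    case True
    show ?thesis
    proof
      fix a assume "a \<in> set_pmf (proj_strategy \<pi> h s)"
      then have "prefix_prob \<pi> (h @ [(s, a)]) \<noteq> 0"
        using pmf_proj_strategy[OF True, of a] by (auto simp: set_pmf_iff split: if_splits)
      then show "a \<in> enabled M s"
        using prefix_prob_enabled[of h s a] prefix_prob_nonneg[of \<pi> "h @ [(s, a)]"] by simp
    qed
  next
    case False
    then show ?thesis
      using s(2) by (simp add: proj_strategy_def some_in_eq)
  qed
qed

text \<open>The first component of the product moves with the probabilities of \<open>M\<close>.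
  Equality may fail because the product can be stuck on reaching \<open>s\<close>.\<close>

lemma state_prob_le: "state_prob \<pi> h s \<le> prefix_prob \<pi> h * next_prob M h s"
proof -
  let ?n = "length h"
  define R where "R z e \<longleftrightarrow> (\<exists>a\<in>mdp_acts M. proj_entry e = Some (s, a))"
    for z :: "nat \<Rightarrow> (('s \<times> 'q) \<times> ('a \<times> 'q)) option"
      and e :: "(('s \<times> 'q) \<times> ('a \<times> 'q)) option"
  have un: "{z \<in> proj_prefix h. R z (z ?n)} = (\<Union>a\<in>mdp_acts M. proj_prefix (h @ [(s, a)]))"
    by (auto simp: proj_prefix_snoc R_def)
  have sets: "proj_prefix h' \<in> sets (path_measure N \<pi>)" for h'
    using determined_sets[OF P.finite_E determined_proj_prefix] P.sets_P by simp
  have "state_prob \<pi> h s = measure (path_measure N \<pi>) (\<Union>a\<in>mdp_acts M. proj_prefix (h @ [(s, a)]))"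
    unfolding state_prob_def prefix_prob_def
  proof (rule P.finite_measure_finite_Union[symmetric])
    show "(\<lambda>a. proj_prefix (h @ [(s, a)])) ` mdp_acts M \<subseteq> sets (path_measure N \<pi>)"
      using sets by blast
    show "disjoint_family_on (\<lambda>a. proj_prefix (h @ [(s, a)])) (mdp_acts M)"
      by (auto simp: disjoint_family_on_def proj_prefix_snoc)
  qed (rule finite_acts_M)
  also have "\<dots> = measure (path_measure N \<pi>) {z \<in> proj_prefix h. R z (z ?n)}"
    by (simp only: un)
  also have "\<dots> \<le> measure (path_measure N \<pi>) (proj_prefix h) * next_prob M h s"
  proof (rule P.measure_step_le[where R=R and n="?n"])
    show "determined (entries N) ?n (proj_prefix h)"
      by (rule determined_proj_prefix)
    show "{z \<in> proj_prefix h. R z (z ?n)} \<in> sets (path_measure N \<pi>)"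
      unfolding un using sets finite_acts_M by blast
    show "R z e = R z' e" for z z' e by (simp add: R_def)
    fix z assume z: "z \<in> proj_prefix h"
    \<comment> \<open>An entry chosen in \<open>(s', q')\<close> records the state
      \<open>s'\<close>, so only \<open>s' = s\<close> can satisfy \<open>R\<close>.\<close>
    have choose: "emeasure (measure_pmf (choose_pmf N \<pi> h' (s', q'))) {e. R z e} = 0"
      if "s' \<noteq> s" for h' s' q'
    proof -
      have "set_pmf (choose_pmf N \<pi> h' (s', q')) \<inter> {e. R z e} = {}"
        using that by (auto simp: choose_pmf_def R_def proj_entry_def split: if_splits)
      then show ?thesis
        by (simp add: measure_pmf.emeasure_eq_measure measure_pmf_zero_iff)
    qed
    show "measure (measure_pmf (step_pmf N \<pi> ?n z)) {e. R z e} \<le> next_prob M h s"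
    proof (cases h rule: rev_cases)
      case Nil
      show ?thesis
      proof (cases "s = mdp_init M")
        case True
        then show ?thesis by (simp add: next_prob_def Nil)
      next
        case False
        then have "measure (measure_pmf (choose_pmf N \<pi> [] (mdp_init M, q\<^sub>0))) {e. R z e} = 0"
          using choose[of "mdp_init M" "[]" "q\<^sub>0"] by (simp add: measure_pmf.emeasure_eq_measure)
        moreover have "mdp_init N = (mdp_init M, q\<^sub>0)" by (simp add: product_def)
        ultimately show ?thesis by (simp add: Nil next_prob_def)
      qed
    next
      case (snoc h0 e0)
      obtain s0 a0 where e0: "e0 = (s0, a0)" by force
      have "proj_entry (z (length h0)) = Some (s0, a0)"
        using z unfolding snoc e0 by (simp add: proj_prefix_snoc)
      then obtain q q' where k: "z (length h0) = Some ((s0, q), (a0, q'))"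
        by (auto simp: proj_entry_def)
      have None0: "measure (measure_pmf (return_pmf None)) {e. R z e} = 0"
        by (simp add: R_def proj_entry_def)
      show ?thesis
      proof (cases "mdp_trans N (s0, q) (a0, q')")
        case None
        then have "step_pmf N \<pi> ?n z = return_pmf None"
          using k snoc by simp
        then show ?thesis
          using None0 next_prob_nonneg by simp
      next
        case (Some p')
        then obtain p where p: "mdp_trans M s0 a0 = Some p" "p' = map_pmf (\<lambda>s'. (s', q')) p"
          by (auto simp: product_def split: if_splits)
        have "step_pmf N \<pi> ?n z = bind_pmf p (\<lambda>s'. choose_pmf N \<pi> (map (the \<circ> z) [0..<Suc (length h0)]) (s', q'))"
          using k snoc Some p by (simp add: bind_map_pmf del: upt_Suc)
        then have "measure (measure_pmf (step_pmf N \<pi> ?n z)) {e. R z e} \<le> pmf p s"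
          using emeasure_bind_pmf_le[of s p _ "{e. R z e}"] choose by simp
        then show ?thesis
          by (simp add: next_prob_def snoc e0 p)
      qed
    qed
  qed
  finally show ?thesis by (simp add: prefix_prob_def)
qed

lemma pmf_step_pmf_Some:
  assumes \<tau>: "\<tau> \<in> strategies M" and y: "y \<in> seqs (entries M)" "\<And>j. j < n \<Longrightarrow> y j \<noteq> None"
  shows "pmf (step_pmf M \<tau> n y) (Some (s, a))
    = next_prob M (map (the \<circ> y) [0..<n]) s * pmf (\<tau> (map (the \<circ> y) [0..<n]) s) a"
proof -
  have choose: "pmf (choose_pmf M \<tau> h s') (Some (s, a)) = of_bool (s' = s) * pmf (\<tau> h s) a"
    if "s' \<in> mdp_states M" for h s'
  proof -
    have eq: "choose_pmf M \<tau> h s' = map_pmf (\<lambda>a. Some (s', a)) (\<tau> h s')"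
      using enabled_M[OF that] by (simp add: choose_pmf_def)
    show ?thesis
    proof (cases "s' = s")
      case True
      have "pmf (map_pmf (\<lambda>a. Some (s, a)) (\<tau> h s)) (Some (s, a)) = pmf (\<tau> h s) a"
        by (rule pmf_map_inj') (auto simp: inj_def)
      then show ?thesis using True eq by simp
    next
      case False
      then have "Some (s, a) \<notin> set_pmf (choose_pmf M \<tau> h s')"
        unfolding eq by auto
      then show ?thesis using False by (simp add: set_pmf_iff)
    qed
  qed
  show ?thesis
  proof (cases n)
    case 0
    have "mdp_init M \<in> mdp_states M" using wf_M by (simp add: wf_MDP_def)
    then show ?thesis using choose 0 by (auto simp: next_prob_def)
  next
    case (Suc k)
    then obtain s0 a0 where k: "y k = Some (s0, a0)" using y(2)[of k] by auto
    have "y k \<in> entries M" using y(1) by (simp add: seqs_def)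
    then have sa: "s0 \<in> mdp_states M" "a0 \<in> mdp_acts M" using k by (auto simp: entries_def)
    have last: "last (map (the \<circ> y) [0..<n]) = (s0, a0)" "map (the \<circ> y) [0..<n] \<noteq> []"
      using Suc k by auto
    show ?thesis
    proof (cases "mdp_trans M s0 a0")
      case None
      then show ?thesis using Suc k last by (simp add: next_prob_def del: upt_Suc)
    next
      case (Some p)
      let ?h = "map (the \<circ> y) [0..<n]"
      have "pmf (step_pmf M \<tau> n y) (Some (s, a)) = pmf (bind_pmf p (choose_pmf M \<tau> ?h)) (Some (s, a))"
        using Suc k Some by (simp del: upt_Suc)
      also have "\<dots> = measure_pmf.expectation p (\<lambda>s'. pmf (choose_pmf M \<tau> ?h s') (Some (s, a)))"
        by (rule pmf_bind)
      also have "\<dots> = measure_pmf.expectation p (\<lambda>s'. indicator {s} s' * pmf (\<tau> ?h s) a)"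
      proof (intro integral_cong_AE AE_pmfI)
        fix s' assume "s' \<in> set_pmf p"
        then have "s' \<in> mdp_states M"
          using wf_M sa Some unfolding wf_MDP_def by blast
        from choose[OF this, of ?h]
        show "pmf (choose_pmf M \<tau> ?h s') (Some (s, a)) = indicator {s} s' * pmf (\<tau> ?h s) a"
          by (simp add: indicator_def)
      qed simp_all
      also have "\<dots> = pmf p s * pmf (\<tau> ?h s) a"
        by (simp add: measure_pmf_single)
      finally show ?thesis
        using last Some by (simp add: next_prob_def)
    qed
  qed
qed

lemma proj_in: "e \<in> entries N \<Longrightarrow> proj_entry e \<in> entries M"
  by (auto simp: entries_def proj_entry_def product_def)

lemma proj_measurable:
  "(\<lambda>z k. proj_entry (z k)) \<in> measurable (path_measure N \<pi>) (seq_space (entries M))"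
  using coordinatewise_measurable[of "entries N" proj_entry "entries M", OF proj_in]
  unfolding measurable_cong_sets[OF P.sets_P refl] by simp

text \<open>By induction, each prefix is at least as likely under the projected strategy as in the
  product: \<open>state_prob_le\<close> handles the move, and the conditional probability cancels
  the normalisation. Prefixes with \<open>None\<close> are excluded, since the product can die with
  positive probability while \<open>M\<close> does not; hence the requirement on
  \<open>X\<close>.\<close>

lemma measure_proj_le:
  assumes X: "X \<in> sets (seq_space (entries M))" "\<And>z k. z \<in> X \<Longrightarrow> z k \<noteq> None"
  shows "measure (path_measure N \<pi>) {z \<in> seqs (entries N). (\<lambda>k. proj_entry (z k)) \<in> X}
    \<le> measure (path_measure M (proj_strategy \<pi>)) X"
proof -
  let ?P = "path_measure M (proj_strategy \<pi>)"
  let ?g = "\<lambda>z k. proj_entry (z k)"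
  let ?Q = "distr (path_measure N \<pi>) (seq_space (entries M)) ?g"
  interpret M: seq_process "entries M" "step_pmf M (proj_strategy \<pi>)" ?P
    by (rule seq_process_path_measure[OF wf_M proj_strategy_in])
  interpret Q: prob_space ?Q
    by (rule P.prob_space_distr[OF proj_measurable])
  have Q: "measure ?Q Y = measure (path_measure N \<pi>) {z \<in> seqs (entries N). ?g z \<in> Y}"
    if "Y \<in> sets (seq_space (entries M))" for Y
  proof -
    have "?g -` Y \<inter> space (path_measure N \<pi>) = {z \<in> seqs (entries N). ?g z \<in> Y}"
      by (auto simp: P.space_P)
    then show ?thesis
      using measure_distr[OF proj_measurable that] by simp
  qed
  have le: "prefix_prob \<pi> (map (the \<circ> y) [0..<n]) \<le> measure ?P (cyl (entries M) n y)"
    if y: "y \<in> seqs (entries M)" and alive: "\<And>j. j < n \<Longrightarrow> y j \<noteq> None" for n y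
    using alive
  proof (induction n)
    case 0
    then show ?case
      using M.prob_space by (simp add: prefix_prob_def M.space_P)
  next
    case (Suc n)
    let ?h = "map (the \<circ> y) [0..<n]"
    obtain s a where n: "y n = Some (s, a)" using Suc.prems[of n] by auto
    have "y n \<in> entries M" using y by (simp add: seqs_def)
    then have a: "a \<in> mdp_acts M" using n by (auto simp: entries_def)
    have h: "map (the \<circ> y) [0..<Suc n] = ?h @ [(s, a)]" using n by simp
    have IH: "prefix_prob \<pi> ?h \<le> measure ?P (cyl (entries M) n y)"
      by (rule Suc.IH) (rule Suc.prems, simp)
    have c: "measure ?P (cyl (entries M) (Suc n) y)
        = measure ?P (cyl (entries M) n y) * (next_prob M ?h s * pmf (proj_strategy \<pi> ?h s) a)"
      using M.measure_cyl_Suc[OF y, of n] pmf_step_pmf_Some[OF proj_strategy_in y, of n s a] Suc.prems n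
      by simp
    show ?case
    proof (cases "state_prob \<pi> ?h s > 0")
      case False
      then have "prefix_prob \<pi> (?h @ [(s, a)]) \<le> 0"
        using prefix_prob_le_state_prob[OF a, of \<pi> ?h s] by simp
      then show ?thesis
        unfolding h using measure_nonneg[of ?P "cyl (entries M) (Suc n) y"] by linarith
    next
      case True
      have "state_prob \<pi> ?h s \<le> measure ?P (cyl (entries M) n y) * next_prob M ?h s"
        using state_prob_le[of ?h s] mult_right_mono[OF IH next_prob_nonneg[of M ?h s]] by linarith
      then have "state_prob \<pi> ?h s * pmf (proj_strategy \<pi> ?h s) a
          \<le> measure ?P (cyl (entries M) n y) * next_prob M ?h s * pmf (proj_strategy \<pi> ?h s) a"
        by (rule mult_right_mono) simp
      moreover have "state_prob \<pi> ?h s * pmf (proj_strategy \<pi> ?h s) a = prefix_prob \<pi> (?h @ [(s, a)])"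
        using True a by (simp add: pmf_proj_strategy)
      ultimately show ?thesis
        unfolding h c by (simp only: mult.assoc)
    qed
  qed
  have "measure ?Q X \<le> measure ?P X"
  proof (rule measure_le_if_cyl_le[OF M.finite_P M.sets_P _ _ M.finite_E X(1)])
    show "finite_measure ?Q" by unfold_locales
    show "sets ?Q = sets (seq_space (entries M))" by simp
    show "X \<subseteq> seqs (- {None})"
      using X(2) by (auto simp: seqs_def)
    fix n y assume y: "y \<in> seqs (entries M)" "\<And>j. j < n \<Longrightarrow> y j \<in> - {None}"
    have "{z \<in> seqs (entries N). ?g z \<in> cyl (entries M) n y} = proj_prefix (map (the \<circ> y) [0..<n])"
    proof -
      have "?g z \<in> cyl (entries M) n y \<longleftrightarrow> (\<forall>j<n. proj_entry (z j) = Some (the (y j)))"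
        if "z \<in> seqs (entries N)" for z
      proof -
        have "?g z \<in> seqs (entries M)" using that proj_in by (simp add: seqs_def)
        moreover have "Some (the (y j)) = y j" if "j < n" for j
          using y(2)[OF that] by auto
        ultimately show ?thesis by (simp add: cyl_def)
      qed
      then show ?thesis unfolding proj_prefix_def by auto
    qed
    then have "measure ?Q (cyl (entries M) n y) = prefix_prob \<pi> (map (the \<circ> y) [0..<n])"
      using Q[OF cyl_sets] by (simp add: prefix_prob_def)
    also have "\<dots> \<le> measure ?P (cyl (entries M) n y)"
      using y by (intro le) auto
    finally show "measure ?Q (cyl (entries M) n y) \<le> measure ?P (cyl (entries M) n y)" .
  qed
  then show ?thesis using Q[OF X(1)] by simp
qed

text \<open>Infinitely many accepting transitions rule out dying, and consistency makes the
  automaton components a run on the label word.\<close>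

lemma acc_event_le_lang_event:
  assumes init: "q\<^sub>0 \<in> initial C" and L: "lang_event M (NBA_lang C) \<in> sets (seq_space (entries M))"
  shows "emeasure (path_measure N \<pi>) (acc_event M C q\<^sub>0)
    \<le> emeasure (path_measure M (proj_strategy \<pi>)) (lang_event M (NBA_lang C))"
proof -
  let ?L = "lang_event M (NBA_lang C)"
  let ?g = "\<lambda>z k. proj_entry (z k)"
  interpret M: seq_process "entries M" "step_pmf M (proj_strategy \<pi>)" "path_measure M (proj_strategy \<pi>)"
    by (rule seq_process_path_measure[OF wf_M proj_strategy_in])
  have "measure (path_measure N \<pi>) (acc_event M C q\<^sub>0)
      \<le> measure (path_measure N \<pi>) {z \<in> seqs (entries N). ?g z \<in> ?L}"
  proof (rule P.finite_measure_mono_AE)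
    have "?g -` ?L \<inter> space (path_measure N \<pi>) = {z \<in> seqs (entries N). ?g z \<in> ?L}"
      by (auto simp: P.space_P)
    then show "{z \<in> seqs (entries N). ?g z \<in> ?L} \<in> sets (path_measure N \<pi>)"
      using measurable_sets[OF proj_measurable L] by simp
    show "AE z in path_measure N \<pi>. z \<in> acc_event M C q\<^sub>0 \<longrightarrow> z \<in> {z \<in> seqs (entries N). ?g z \<in> ?L}"
      using AE_consistent[OF wf_N \<pi>] AE_space
    proof eventually_elim
      case (elim z)
      show ?case
      proof
        assume acc: "z \<in> acc_event M C q\<^sub>0"
        have z: "z \<in> seqs (entries N)" using elim by (simp add: P.space_P)
        have None_Suc: "z (Suc k) = None" if "z k = None" for k
        proof (rule ccontr)
          assume "z (Suc k) \<noteq> None"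
          then obtain s a where "z (Suc k) = Some (s, a)" by auto
          from consistent_Suc[OF elim(1) this] show False using that by simp
        qed
        have None_ge: "z j = None" if "z k = None" "k \<le> j" for j k
          using that(2,1) by (induction rule: dec_induct) (auto simp: None_Suc)
        have alive: "z k \<noteq> None" for k
        proof
          assume k: "z k = None"
          obtain j where "k \<le> j" "z j \<noteq> None"
            using acc unfolding acc_event_def INFM_nat_le by fastforce
          then show False using None_ge[OF k] by simp
        qed
        define s q a q' where "s k = fst (fst (the (z k)))" and "q k = snd (fst (the (z k)))"
          and "a k = fst (snd (the (z k)))" and "q' k = snd (snd (the (z k)))" for k
        have e: "z k = Some ((s k, q k), (a k, q' k))" for k
          using alive[of k] by (auto simp: s_def q_def a_def q'_def)
        have st: "s k \<in> mdp_states M" for k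
          using elim(1) e[of k] unfolding consistent_def by (auto simp: product_def)
        have en: "(a k, q' k) \<in> enabled N (s k, q k)" for k
          using elim(1) e[of k] unfolding consistent_def by blast
        have q0: "q 0 = q\<^sub>0"
          using elim(1) e[of 0] unfolding consistent_def by (auto simp: product_def)
        have qS: "q (Suc k) = q' k" for k
        proof -
          obtain p where "mdp_trans N (s k, q k) (a k, q' k) = Some p" "(s (Suc k), q (Suc k)) \<in> set_pmf p"
            using consistent_Suc[OF elim(1) e[of "Suc k"]] e[of k] by auto
          then show ?thesis by (auto simp: product_def split: if_splits)
        qed
        have run: "is_run C (\<lambda>k. mdp_label M (s k)) q"
          using init q0 qS en by (auto simp: is_run_def enabled_N)
        have "\<exists>\<^sub>\<infinity>k. q' k \<in> dist_trans C (q k) (mdp_label M (s k))"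
          using acc by (simp add: acc_event_def e)
        then have inf: "inf_dist C (\<lambda>k. mdp_label M (s k)) q"
          by (simp add: inf_dist_def qS)
        have "(\<lambda>k. mdp_label M (s k)) \<in> words (alphabet C)"
          using st fin_M by (simp add: words_def finite_MDP_def)
        then have "(\<lambda>k. mdp_label M (s k)) \<in> NBA_lang C"
          using run inf by (auto simp: NBA_lang_def)
        moreover have "?g z k \<in> entries M" for k
          using z proj_in by (simp add: seqs_def)
        moreover have "?g z k = Some (s k, a k)" for k
          by (simp add: proj_entry_def e)
        ultimately have "?g z \<in> ?L"
          by (simp add: lang_event_def)
        then show "z \<in> {z \<in> seqs (entries N). ?g z \<in> ?L}"
          using z by blast
      qed
    qed
  qed
  also have "\<dots> \<le> measure (path_measure M (proj_strategy \<pi>)) ?L"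
    by (rule measure_proj_le[OF L]) (simp add: lang_event_def)
  finally show ?thesis
    by (simp add: P.emeasure_eq_measure M.emeasure_eq_measure)
qed

end

end

section \<open>Sequences and infinite paths\<close>

text \<open>If each \<open>y\<close> failed at some depth, then by monotonicity all would fail at
  the maximum of these finitely many depths.\<close>

lemma finite_uniform_witness:
  assumes "finite Y" "\<And>d. \<exists>y\<in>Y. R y d" "\<And>y d. R y (Suc d) \<Longrightarrow> R y d"
  shows "\<exists>y\<in>Y. \<forall>d::nat. R y d"
proof (rule ccontr)
  assume "\<not> ?thesis"
  then obtain D where D: "\<And>y. y \<in> Y \<Longrightarrow> \<not> R y (D y)" by metis
  have mono: "R y d' \<Longrightarrow> d \<le> d' \<Longrightarrow> R y d" for y d d'
    by (rule inc_induct[of d d' "R y"]) (auto intro: assms(3))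
  obtain y where y: "y \<in> Y" "R y (Max (D ` Y))" using assms(2) by blast
  have "D y \<le> Max (D ` Y)" using assms(1) y(1) by simp
  then show False using D[OF y(1)] mono[OF y(2)] by blast
qed

text \<open>Koenig's lemma for a graph with finite levels. Nonempty levels and predecessors give
  paths of every length from every level; finiteness gives vertices that extend to all lengths, and
  these are chained.\<close>

lemma konig_path:
  assumes fin: "\<And>k. finite (X k)" and ne: "\<And>k. X k \<noteq> {}"
    and pred: "\<And>k y. y \<in> X (Suc k) \<Longrightarrow> \<exists>x\<in>X k. E k x y"
  shows "\<exists>r. \<forall>k::nat. r k \<in> X k \<and> E k (r k) (r (Suc k))"
proof -
  define ext where "ext = rec_nat (\<lambda>k x. x \<in> X k) (\<lambda>d R k x. x \<in> X k \<and> (\<exists>y. E k x y \<and> R (Suc k) y))"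
  have ext_0: "ext 0 k x \<longleftrightarrow> x \<in> X k" for k x by (simp add: ext_def)
  have ext_Suc: "ext (Suc d) k x \<longleftrightarrow> x \<in> X k \<and> (\<exists>y. E k x y \<and> ext d (Suc k) y)" for d k x
    by (simp add: ext_def)
  have ext_X: "ext d k x \<Longrightarrow> x \<in> X k" for d k x
    by (cases d) (auto simp: ext_0 ext_Suc)
  have mono: "ext (Suc d) k x \<Longrightarrow> ext d k x" for d k x
  proof (induction d arbitrary: k x)
    case 0 then show ?case by (simp add: ext_0 ext_Suc)
  next
    case (Suc d) then show ?case using ext_Suc[of d k x] ext_Suc[of "Suc d" k x] by blast
  qed
  \<comment> \<open>Paths grow at the front: a predecessor of a vertex with \<open>d\<close> further
    steps has \<open>d + 1\<close> of them.\<close>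
  have ex: "\<exists>x\<in>X k. ext d k x" for d k
  proof (induction d arbitrary: k)
    case 0 then show ?case using ne[of k] by (auto simp: ext_0)
  next
    case (Suc d)
    then obtain y where "y \<in> X (Suc k)" "ext d (Suc k) y" by blast
    then show ?case using pred[of y k] by (auto simp: ext_Suc)
  qed
  have "\<exists>r. \<forall>k. (\<forall>d. ext d k (r k)) \<and> E k (r k) (r (Suc k))"
  proof (rule dependent_nat_choice)
    show "\<exists>x. \<forall>d. ext d 0 x"
      using finite_uniform_witness[OF fin[of 0], of "\<lambda>x d. ext d 0 x"] ex mono by blast
    fix x k assume x: "\<forall>d. ext d k x"
    have "\<exists>y\<in>{y \<in> X (Suc k). E k x y}. \<forall>d. ext d (Suc k) y"
    proof (rule finite_uniform_witness)
      show "finite {y \<in> X (Suc k). E k x y}" using fin by simp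
      show "\<exists>y\<in>{y \<in> X (Suc k). E k x y}. ext d (Suc k) y" for d
        using x[rule_format, of "Suc d"] ext_X by (auto simp: ext_Suc)
    qed (rule mono)
    then show "\<exists>y. (\<forall>d. ext d (Suc k) y) \<and> E k x y" by blast
  qed
  then show ?thesis using ext_X by blast
qed

lemma eventually_constant:
  fixes g :: "nat \<Rightarrow> nat"
  assumes "\<And>k. k \<ge> k0 \<Longrightarrow> g (Suc k) \<le> g k"
  obtains k1 where "k1 \<ge> k0" "\<forall>k\<ge>k1. g k = g k1"
proof -
  obtain k1 where k1: "k1 \<ge> k0" "\<And>k. k \<ge> k0 \<Longrightarrow> g k1 \<le> g k"
    using ex_has_least_nat[of "\<lambda>k. k \<ge> k0" k0 g] by auto
  have "g k \<le> g k1" if "k \<ge> k1" for k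
    using that
  proof (induction rule: dec_induct)
    case (step n)
    then show ?case using assms[of n] k1(1) by linarith
  qed simp
  then have "g k = g k1" if "k \<ge> k1" for k
    using k1 that by (meson antisym order_trans)
  then have "\<forall>k\<ge>k1. g k = g k1" by (intro allI impI)
  with k1(1) show thesis by (rule that)
qed

text \<open>Between breaks the counter rests, so successive breaks advance it by 2 modulo
  \<open>m\<close>; \<open>n = 0\<close> belongs to the first break from \<open>k1\<close>
  on.\<close>

lemma counter_after_breaks:
  fixes i :: "nat \<Rightarrow> nat"
  assumes upd: "\<And>k. k \<ge> k1 \<Longrightarrow> i (Suc k) = (if B k then (i k + 2) mod m else i k)"
    and inf: "\<exists>\<^sub>\<infinity>k. B k"
  shows "\<exists>k\<ge>k1. B k \<and> i (Suc k) = (i k1 + 2 * Suc n) mod m"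
proof -
  have first: "\<exists>k\<ge>l. B k \<and> i k = i l" if "l \<ge> k1" for l
  proof -
    define k where "k = (LEAST k. k \<ge> l \<and> B k)"
    have "\<exists>k. k \<ge> l \<and> B k" using inf by (auto simp: INFM_nat_le)
    then have k: "k \<ge> l" "B k" unfolding k_def by (metis (mono_tags, lifting) LeastI_ex)+
    have nB: "\<not> B j" if "l \<le> j" "j < k" for j
      using that not_less_Least[of j "\<lambda>k. k \<ge> l \<and> B k"] by (auto simp: k_def)
    have "j \<le> k \<longrightarrow> i j = i l" if "l \<le> j" for j
      using that
    proof (induction rule: dec_induct)
      case (step j)
      then show ?case using upd[of j] nB[of j] \<open>l \<ge> k1\<close> by auto
    qed simp
    then show ?thesis using k by blast
  qed
  show ?thesis
  proof (induction n)
    case 0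
    obtain k where "k \<ge> k1" "B k" "i k = i k1" using first[of k1] by blast
    then show ?case using upd[of k] by auto
  next
    case (Suc n)
    then obtain k where k: "k \<ge> k1" "B k" "i (Suc k) = (i k1 + 2 * Suc n) mod m" by blast
    obtain k' where k': "k' \<ge> Suc k" "B k'" "i k' = i (Suc k)" using first[of "Suc k"] k(1) by auto
    then have "i (Suc k') = ((i k1 + 2 * Suc n) mod m + 2) mod m"
      using upd[of k'] k by simp
    also have "\<dots> = (i k1 + 2 * Suc (Suc n)) mod m"
      by (simp add: mod_simps)
    finally show ?case using k' k by (intro exI[of _ k']) auto
  qed
qed

section \<open>Ranks along a word\<close>

definition subsets :: "('q, 'l) aut \<Rightarrow> (nat \<Rightarrow> 'l) \<Rightarrow> nat \<Rightarrow> 'q set" where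
  "subsets A w k = foldl (post A) (initial A) (map w [0..<k])"

lemma subsets_0 [simp]: "subsets A w 0 = initial A"
  by (simp add: subsets_def)

lemma subsets_Suc [simp]: "subsets A w (Suc k) = post A (subsets A w k) (w k)"
  by (simp add: subsets_def)

primrec ranks :: "('q, 'l) aut \<Rightarrow> (nat \<Rightarrow> 'l) \<Rightarrow> nat \<Rightarrow> ('q \<Rightarrow> nat) \<Rightarrow> nat \<Rightarrow> 'q \<Rightarrow> nat" where
  "ranks A w t f 0 = f"
| "ranks A w t f (Suc k) = succ_fun A (subsets A w (t + k)) (ranks A w t f k) (w (t + k))"

text \<open>The ranked successor with the tightness test left out, so that \<open>det_run\<close> is
  total. Tightness is tracked by \<open>always_tight\<close> instead.\<close>

fun rb_next :: "('q, 'l) aut \<Rightarrow> 'q rb_state \<Rightarrow> 'l \<Rightarrow> 'q rb_state" where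
  "rb_next A (Ranked S O' f i) \<sigma> =
     (let S' = post A S \<sigma>; f' = succ_fun A S f \<sigma>; O'' = keep_set A S O' f i \<sigma>;
          i' = (i + 2) mod (rank S' f' + 1)
      in if O'' \<noteq> {} then Ranked S' O'' f' i else Ranked S' (level S' f' i') f' i')"
| "rb_next A (Subset S) \<sigma> = Subset (post A S \<sigma>)"

primrec det_run :: "('q, 'l) aut \<Rightarrow> (nat \<Rightarrow> 'l) \<Rightarrow> nat \<Rightarrow> ('q \<Rightarrow> nat) \<Rightarrow> nat \<Rightarrow> 'q rb_state" where
  "det_run A w t f 0 = Ranked (subsets A w t) {} f 0"
| "det_run A w t f (Suc k) = rb_next A (det_run A w t f k) (w (t + k))"

definition always_tight :: "('q, 'l) aut \<Rightarrow> (nat \<Rightarrow> 'l) \<Rightarrow> nat \<Rightarrow> ('q \<Rightarrow> nat) \<Rightarrow> bool" where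
  "always_tight A w t f \<longleftrightarrow> (\<forall>k. ranks A w t f k \<in> tight_funs (subsets A w (t + k)))"

definition rb_break :: "('q, 'l) aut \<Rightarrow> 'q rb_state \<Rightarrow> 'l \<Rightarrow> bool" where
  "rb_break A s \<sigma> \<longleftrightarrow> (\<exists>S O' f i. s = Ranked S O' f i \<and> keep_set A S O' f i \<sigma> = {})"

definition accepting_jump :: "('q, 'l) aut \<Rightarrow> (nat \<Rightarrow> 'l) \<Rightarrow> nat \<Rightarrow> ('q \<Rightarrow> nat) \<Rightarrow> bool" where
  "accepting_jump A w t f \<longleftrightarrow> always_tight A w t f \<and> (\<exists>\<^sub>\<infinity>k. rb_break A (det_run A w t f k) (w (t + k)))"

text \<open>Such a path blocks the breakpoint construction: after a late break that sets the index
  to \<open>j\<close>, it stays in the obligation set forever.\<close>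

definition stuck :: "('q, 'l) aut \<Rightarrow> (nat \<Rightarrow> 'l) \<Rightarrow> nat \<Rightarrow> ('q \<Rightarrow> nat) \<Rightarrow> bool" where
  "stuck A w t f \<longleftrightarrow> (\<exists>r k0 j. even j \<and> (\<forall>k\<ge>k0. r k \<in> subsets A w (t + k) \<and>
      r (Suc k) \<in> trans A (r k) (w (t + k)) \<and> ranks A w t f k (r k) = j))"

lemma ranks_add: "ranks A w (t + d) (ranks A w t f d) k = ranks A w t f (d + k)"
  by (induction k) (simp_all add: ac_simps)

text \<open>On a nonempty domain the bound \<open>m\<close> is positive, so the odd value
  \<open>2 * m - 1\<close> is attained and is the maximum.\<close>

lemma tight_funs_rank_odd:
  assumes "f \<in> tight_funs S" "S \<noteq> {}" "finite S"
  shows "odd (rank S f)" "rank S f < 2 * card S" "\<And>q. q \<in> S \<Longrightarrow> f q \<le> rank S f"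
proof -
  obtain m where m: "m \<le> card S" "f \<in> S \<rightarrow>\<^sub>E {..<2 * m}" "{j. odd j \<and> j < 2 * m} \<subseteq> f ` S"
    using assms(1) by (auto simp: tight_funs_def)
  obtain q where "q \<in> S" using assms(2) by blast
  then have "f q < 2 * m" using m(2) by auto
  then have pos: "m > 0" by simp
  then have "2 * m - 1 \<in> f ` S" using m(3) by auto
  moreover have "x \<le> 2 * m - 1" if "x \<in> insert 0 (f ` S)" for x
  proof (cases "x = 0")
    case False
    then have "x \<in> f ` S" using that by simp
    then have "x < 2 * m" using m(2) by auto
    then show ?thesis by simp
  qed simp
  ultimately have r: "rank S f = 2 * m - 1"
    unfolding rank_def using assms(3) by (intro Max_eqI) auto
  show "odd (rank S f)" using r pos by simp
  show "rank S f < 2 * card S" using r pos m(1) by linarith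
  show "\<And>q. q \<in> S \<Longrightarrow> f q \<le> rank S f"
    unfolding rank_def using assms(3) by (intro Max_ge) auto
qed

lemma rank_empty [simp]: "rank {} f = 0"
  by (simp add: rank_def)

lemma finite_tight_funs: "finite S \<Longrightarrow> finite (tight_funs S)"
proof -
  assume S: "finite S"
  have "tight_funs S \<subseteq> (\<Union>m\<le>card S. S \<rightarrow>\<^sub>E {..<2 * m})"
    by (auto simp: tight_funs_def)
  moreover have "finite (\<Union>m\<le>card S. S \<rightarrow>\<^sub>E {..<2 * m})"
    using S by (auto intro!: finite_PiE)
  ultimately show ?thesis by (rule finite_subset)
qed

section \<open>Ranks along a fixed word\<close>

locale word_run =
  fixes A :: "('q, 'l) aut" and w :: "nat \<Rightarrow> 'l"
  assumes aut: "automaton A" and word: "w \<in> words (alphabet A)"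
begin

abbreviation "S \<equiv> subsets A w"

lemma w_in: "w k \<in> alphabet A"
  using word by (simp add: words_def)

lemma S_states: "S k \<subseteq> states A"
proof (induction k)
  case 0
  then show ?case using aut by (simp add: automaton_def)
next
  case (Suc k)
  then show ?case using aut w_in[of k] unfolding automaton_def subsets_Suc post_def by blast
qed

lemma finite_S: "finite (S k)"
  using finite_subset[OF S_states] aut by (simp add: automaton_def)

lemma dist_subset: "q \<in> S k \<Longrightarrow> dist_trans A q (w k) \<subseteq> trans A q (w k)"
  using aut S_states[of k] w_in[of k] unfolding automaton_def by blast

lemma S_step: "q \<in> S k \<Longrightarrow> q' \<in> trans A q (w k) \<Longrightarrow> q' \<in> S (Suc k)"
  by (auto simp: post_def)

lemma S_pred: "q' \<in> S (Suc k) \<Longrightarrow> \<exists>q\<in>S k. q' \<in> trans A q (w k)"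
  by (auto simp: post_def)

lemma finite_succ_ranks: "finite (succ_ranks A (S k) f (w k) q)"
proof -
  have "succ_ranks A (S k) f (w k) q \<subseteq> f ` S k \<union> (\<lambda>j. 2 * (j div 2)) ` f ` S k"
    by (auto simp: succ_ranks_def post_def dist_post_def level_def)
  then show ?thesis
    using finite_S[of k] by (meson finite_UnI finite_imageI finite_subset)
qed

lemma succ_fun_le:
  assumes "q \<in> S k" "q' \<in> trans A q (w k)"
  shows "succ_fun A (S k) f (w k) q' \<le> f q"
proof -
  have "f q \<in> succ_ranks A (S k) f (w k) q'" "q' \<in> post A (S k) (w k)"
    using assms by (auto simp: succ_ranks_def post_def level_def)
  then show ?thesis
    using finite_succ_ranks by (simp add: succ_fun_def)
qed

lemma succ_fun_dist_le:
  assumes "q \<in> S k" "q' \<in> dist_trans A q (w k)"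
  shows "succ_fun A (S k) f (w k) q' \<le> 2 * (f q div 2)"
proof -
  have "2 * (f q div 2) \<in> succ_ranks A (S k) f (w k) q'" "q' \<in> post A (S k) (w k)"
    using assms dist_subset by (auto simp: succ_ranks_def post_def dist_post_def level_def)
  then show ?thesis
    using finite_succ_ranks by (simp add: succ_fun_def)
qed

lemma succ_fun_attained:
  assumes "q' \<in> S (Suc k)"
  shows "\<exists>q\<in>S k. q' \<in> trans A q (w k) \<and> (succ_fun A (S k) f (w k) q' = f q \<or>
    q' \<in> dist_trans A q (w k) \<and> succ_fun A (S k) f (w k) q' = 2 * (f q div 2))"
proof -
  have q': "q' \<in> post A (S k) (w k)" using assms by simp
  then have "succ_ranks A (S k) f (w k) q' \<noteq> {}"
    by (auto simp: succ_ranks_def post_def level_def)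
  then have "Min (succ_ranks A (S k) f (w k) q') \<in> succ_ranks A (S k) f (w k) q'"
    by (intro Min_in finite_succ_ranks)
  then have "succ_fun A (S k) f (w k) q' \<in> succ_ranks A (S k) f (w k) q'"
    using q' by (simp add: succ_fun_def)
  then show ?thesis
    using dist_subset by (fastforce simp: succ_ranks_def post_def dist_post_def level_def)
qed

section \<open>Breakpoints after a fixed jump\<close>

context
  fixes t :: nat and f :: "'q \<Rightarrow> nat"
begin

abbreviation "f\<^sub>k \<equiv> ranks A w t f"

lemma ranks_step_le: "q \<in> S (t + k) \<Longrightarrow> q' \<in> trans A q (w (t + k)) \<Longrightarrow> f\<^sub>k (Suc k) q' \<le> f\<^sub>k k q"
  using succ_fun_le[of q "t + k" q'] by simp

lemma ranks_dist_le:
  "q \<in> S (t + k) \<Longrightarrow> q' \<in> dist_trans A q (w (t + k)) \<Longrightarrow> f\<^sub>k (Suc k) q' \<le> 2 * (f\<^sub>k k q div 2)"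
  using succ_fun_dist_le[of q "t + k" q'] by simp

lemma det_run_Ranked:
  "\<exists>O' i. det_run A w t f k = Ranked (S (t + k)) O' (f\<^sub>k k) i \<and> O' \<subseteq> level (S (t + k)) (f\<^sub>k k) i"
proof (induction k)
  case (Suc k)
  then obtain O' i where "det_run A w t f k = Ranked (S (t + k)) O' (f\<^sub>k k) i" by blast
  then show ?case by (auto simp: Let_def keep_set_def)
qed simp

definition obl :: "nat \<Rightarrow> 'q set" where
  "obl k = (case det_run A w t f k of Ranked S' O' f' i \<Rightarrow> O')"

definition idx :: "nat \<Rightarrow> nat" where
  "idx k = (case det_run A w t f k of Ranked S' O' f' i \<Rightarrow> i)"

abbreviation "brk k \<equiv> rb_break A (det_run A w t f k) (w (t + k))"

lemma det_run_eq: "det_run A w t f k = Ranked (S (t + k)) (obl k) (f\<^sub>k k) (idx k)"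
  using det_run_Ranked[of k] by (auto simp: obl_def idx_def)

lemma obl_level: "obl k \<subseteq> level (S (t + k)) (f\<^sub>k k) (idx k)"
  using det_run_Ranked[of k] by (auto simp: obl_def idx_def)

lemma brk_iff: "brk k \<longleftrightarrow> post A (obl k) (w (t + k)) \<inter> level (S (t + Suc k)) (f\<^sub>k (Suc k)) (idx k) = {}"
  unfolding det_run_eq by (auto simp: rb_break_def keep_set_def)

lemma det_run_Suc:
  "idx (Suc k) = (if brk k then (idx k + 2) mod (rank (S (t + Suc k)) (f\<^sub>k (Suc k)) + 1) else idx k)" (is ?I)
  "obl (Suc k) = (if brk k then level (S (t + Suc k)) (f\<^sub>k (Suc k)) (idx (Suc k))
     else post A (obl k) (w (t + k)) \<inter> level (S (t + Suc k)) (f\<^sub>k (Suc k)) (idx k))" (is ?O)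
proof -
  have *: "Ranked (S (t + Suc k)) (obl (Suc k)) (f\<^sub>k (Suc k)) (idx (Suc k))
      = rb_next A (Ranked (S (t + k)) (obl k) (f\<^sub>k k) (idx k)) (w (t + k))"
    using det_run_eq[of k] det_run_eq[of "Suc k"] by simp
  show ?I ?O
    using * unfolding brk_iff by (auto simp: Let_def keep_set_def split: if_splits)
qed

lemma idx_0: "idx 0 = 0"
  by (simp add: idx_def)

text \<open>The rank is odd, so the index is reduced modulo an even number. For the empty set the
  modulus is \<open>1\<close> and a break resets the index to \<open>0\<close>.\<close>

lemma idx_even:
  assumes "always_tight A w t f"
  shows "even (idx k)"
proof (induction k)
  case (Suc k)
  let ?S = "S (t + Suc k)" and ?f = "f\<^sub>k (Suc k)"
  have tight: "?f \<in> tight_funs ?S" using assms unfolding always_tight_def by blast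
  show ?case
  proof (cases "?S = {}")
    case True
    then show ?thesis using det_run_Suc(1)[of k] Suc by simp
  next
    case False
    have "even (rank ?S ?f + 1)" using tight_funs_rank_odd(1)[OF tight False finite_S] by simp
    then have "even ((idx k + 2) mod (rank ?S ?f + 1))"
      using Suc by (simp add: dvd_mod)
    then show ?thesis using det_run_Suc(1)[of k] Suc by (simp del: ranks.simps subsets_Suc add_Suc_right)
  qed
qed (simp add: idx_0)

text \<open>The maximal rank never increases, so from some time on the index runs modulo a fixed
  even number and takes each smaller even value at some break. When it takes the value
  \<open>j\<close>, the path enters the obligation set for good, and no further break
  occurs.\<close>

lemma accepting_jump_imp_not_stuck:
  assumes acc: "accepting_jump A w t f"
  shows "\<not> stuck A w t f"
proof
  assume "stuck A w t f"
  then obtain r k0 j where j: "even j" and r: "\<And>k. k \<ge> k0 \<Longrightarrow> r k \<in> S (t + k)"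
    "\<And>k. k \<ge> k0 \<Longrightarrow> r (Suc k) \<in> trans A (r k) (w (t + k))" "\<And>k. k \<ge> k0 \<Longrightarrow> f\<^sub>k k (r k) = j"
    unfolding stuck_def by blast
  have tight: "f\<^sub>k k \<in> tight_funs (S (t + k))" for k
    using acc unfolding accepting_jump_def always_tight_def by blast
  have inf: "\<exists>\<^sub>\<infinity>k. brk k" using acc unfolding accepting_jump_def by blast
  define R where "R k = rank (S (t + k)) (f\<^sub>k k)" for k
  have R_dec: "R (Suc k) \<le> R k" for k
    unfolding R_def rank_def
  proof (rule Max.boundedI)
    show "finite (insert 0 (f\<^sub>k (Suc k) ` S (t + Suc k)))" by (simp add: finite_S del: subsets_Suc add_Suc_right)
    fix x assume "x \<in> insert 0 (f\<^sub>k (Suc k) ` S (t + Suc k))"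
    then consider "x = 0" | q' where "q' \<in> S (Suc (t + k))" "x = f\<^sub>k (Suc k) q'" by auto
    then show "x \<le> Max (insert 0 (f\<^sub>k k ` S (t + k)))"
    proof cases
      case 2
      obtain q where q: "q \<in> S (t + k)" "q' \<in> trans A q (w (t + k))" using S_pred[OF 2(1)] by blast
      have "f\<^sub>k (Suc k) q' \<le> f\<^sub>k k q" by (rule ranks_step_le[OF q])
      also have "\<dots> \<le> Max (insert 0 (f\<^sub>k k ` S (t + k)))"
        using q(1) finite_S by (intro Max_ge) auto
      finally show ?thesis using 2 by simp
    qed simp
  qed simp
  obtain k1 where k1: "k1 \<ge> k0" "\<forall>k\<ge>k1. R k = R k1"
    by (rule eventually_constant[of k0 R, OF R_dec])
  define m where "m = R k1 + 1"
  have ne: "S (t + k1) \<noteq> {}" using r(1)[OF k1(1)] by blast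
  have "even m"
    using tight_funs_rank_odd(1)[OF tight ne finite_S] by (simp add: m_def R_def)
  moreover have "j < m"
    using tight_funs_rank_odd(3)[OF tight ne finite_S r(1)[OF k1(1)]] r(3)[OF k1(1)]
    by (simp add: m_def R_def)
  ultimately have m: "even m" "j < m" .
  have upd: "idx (Suc k) = (if brk k then (idx k + 2) mod m else idx k)" if "k \<ge> k1" for k
  proof -
    have "R (Suc k) = R k1" by (rule k1(2)[rule_format]) (use that in simp)
    then show ?thesis
      using det_run_Suc(1)[of k] unfolding m_def R_def by (simp only:)
  qed
  \<comment> \<open>An index from before the modulus settled may exceed \<open>m\<close>; one break
    brings it below.\<close>
  obtain k2 where k2: "k2 \<ge> k1" "brk k2"
    using inf unfolding INFM_nat_le by blast
  have i2: "idx (Suc k2) < m" using upd[OF k2(1)] k2(2) by (simp add: m_def)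
  have e2: "even (idx (Suc k2))"
    using idx_even acc unfolding accepting_jump_def by blast
  \<comment> \<open>The target is \<open>m + j\<close> rather than \<open>j\<close>, so that a
    positive number of steps of size 2 reaches it even if the index is already at or beyond
    \<open>j\<close>.\<close>
  obtain n where n: "idx (Suc k2) + 2 * Suc n = m + j"
  proof -
    have "even (m + j - idx (Suc k2))" using m(1) j e2 i2 by simp
    then obtain n where "m + j - idx (Suc k2) = 2 * n" by (elim evenE)
    moreover have "n > 0" using calculation i2 by (cases n) auto
    ultimately have "idx (Suc k2) + 2 * Suc (n - 1) = m + j" using i2 by simp
    then show ?thesis using that by blast
  qed
  obtain k3 where k3: "k3 \<ge> Suc k2" "brk k3" "idx (Suc k3) = (idx (Suc k2) + 2 * Suc n) mod m"
    using counter_after_breaks[of "Suc k2" idx "\<lambda>k. brk k" m n] upd k2(1) inf by auto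
  have i3: "idx (Suc k3) = j" using k3(3) n m(2) by simp
  have stay: "\<not> brk k \<and> idx (Suc k) = j \<and> r (Suc k) \<in> obl (Suc k)"
    if k: "k \<ge> k0" and hit: "idx k = j \<and> r k \<in> obl k" for k
  proof -
    have "r (Suc k) \<in> post A (obl k) (w (t + k))"
      using hit r(2)[OF k] by (auto simp: post_def)
    moreover have "r (Suc k) \<in> level (S (t + Suc k)) (f\<^sub>k (Suc k)) (idx k)"
      using r(1,3)[of "Suc k"] k hit by (simp add: level_def)
    ultimately have in_keep: "r (Suc k) \<in> post A (obl k) (w (t + k)) \<inter> level (S (t + Suc k)) (f\<^sub>k (Suc k)) (idx k)"
      by blast
    then have "\<not> brk k" unfolding brk_iff by blast
    then show ?thesis using det_run_Suc[of k] in_keep hit by simp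
  qed
  have ge: "k \<ge> k0" if "k \<ge> Suc k3" for k using that k3(1) k2(1) k1(1) by simp
  have hit: "idx k = j \<and> r k \<in> obl k" if "k \<ge> Suc k3" for k
    using that
  proof (induction rule: dec_induct)
    case base
    have "r (Suc k3) \<in> level (S (t + Suc k3)) (f\<^sub>k (Suc k3)) j"
      using r(1,3)[of "Suc k3"] ge[of "Suc k3"] by (simp add: level_def)
    then show ?case using det_run_Suc(2)[of k3] k3(2) i3 by simp
  next
    case (step k)
    then show ?case using stay[OF ge] by blast
  qed
  have "\<not> brk k" if "k \<ge> Suc k3" for k
    using stay[OF ge[OF that] hit[OF that]] by blast
  then show False using inf by (auto simp: INFM_nat_le)
qed

lemma not_stuck_imp_accepting_jump:
  assumes tight: "always_tight A w t f" and not_stuck: "\<not> stuck A w t f"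
  shows "accepting_jump A w t f"
proof (rule ccontr)
  assume "\<not> accepting_jump A w t f"
  then have "\<not> (\<exists>\<^sub>\<infinity>k. brk k)" using tight by (simp add: accepting_jump_def)
  then obtain k1 where k1: "\<And>k. k \<ge> k1 \<Longrightarrow> \<not> brk k" by (auto simp: INFM_nat_le)
  have idx: "idx k = idx k1" if "k \<ge> k1" for k
    using that
  proof (induction rule: dec_induct)
    case (step k)
    then show ?case using det_run_Suc(1)[of k] k1[of k] by simp
  qed simp
  have obl: "obl (Suc k) = post A (obl k) (w (t + k)) \<inter> level (S (t + Suc k)) (f\<^sub>k (Suc k)) (idx k1)"
    "obl (Suc k) \<noteq> {}" if "k \<ge> k1" for k
    using det_run_Suc(2)[of k] k1[OF that] idx[OF that] unfolding brk_iff by simp_all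
  let ?X = "\<lambda>n. obl (Suc k1 + n)"
  have "\<exists>r. \<forall>n. r n \<in> ?X n \<and> r (Suc n) \<in> trans A (r n) (w (t + (Suc k1 + n)))"
  proof (rule konig_path)
    show "finite (?X n)" for n
    proof (rule finite_subset[OF _ finite_S])
      show "?X n \<subseteq> S (t + (Suc k1 + n))"
        using obl_level[of "Suc k1 + n"] unfolding level_def by blast
    qed
    show "?X n \<noteq> {}" for n
      using obl(2)[of "k1 + n"] by simp
    show "\<exists>x\<in>?X n. y \<in> trans A x (w (t + (Suc k1 + n)))" if "y \<in> ?X (Suc n)" for y n
    proof -
      have "y \<in> post A (obl (Suc k1 + n)) (w (t + (Suc k1 + n)))"
        using that obl(1)[of "Suc k1 + n"] by simp
      then show ?thesis unfolding post_def by blast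
    qed
  qed
  then obtain r where r: "\<And>n. r n \<in> ?X n" "\<And>n. r (Suc n) \<in> trans A (r n) (w (t + (Suc k1 + n)))" by blast
  have "r n \<in> level (S (t + (Suc k1 + n))) (f\<^sub>k (Suc k1 + n)) (idx k1)" for n
    using r(1)[of n] obl_level[of "Suc k1 + n"] idx[of "Suc k1 + n"] by auto
  then have lev: "r n \<in> S (t + (Suc k1 + n))" "f\<^sub>k (Suc k1 + n) (r n) = idx k1" for n
    unfolding level_def by blast+
  have "stuck A w t f"
    unfolding stuck_def
  proof (intro exI conjI allI impI)
    show "even (idx k1)" by (rule idx_even[OF tight])
    fix k assume "k \<ge> Suc k1"
    then obtain n where k: "k = Suc k1 + n" by (metis le_iff_add)
    show "r (k - Suc k1) \<in> S (t + k)" "f\<^sub>k k (r (k - Suc k1)) = idx k1"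
      using lev[of n] k by simp_all
    show "r (Suc k - Suc k1) \<in> trans A (r (k - Suc k1)) (w (t + k))"
      using r(2)[of n] k by simp
  qed
  then show False using not_stuck by contradiction
qed

end

lemma accepting_jump_iff: "accepting_jump A w t f \<longleftrightarrow> always_tight A w t f \<and> \<not> stuck A w t f"
  using accepting_jump_imp_not_stuck not_stuck_imp_accepting_jump accepting_jump_def by blast

text \<open>The run of the later jump need not be the tail of the earlier run, but its ranks are the
  tail of the earlier ranks, and \<open>accepting_jump_iff\<close> concerns these only.\<close>

lemma accepting_jump_shift:
  assumes "accepting_jump A w t f"
  shows "accepting_jump A w (t + d) (ranks A w t f d)"
  unfolding accepting_jump_iff
proof
  show "always_tight A w (t + d) (ranks A w t f d)"
    using assms unfolding accepting_jump_iff always_tight_def ranks_add by (simp add: add.assoc)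
  show "\<not> stuck A w (t + d) (ranks A w t f d)"
  proof
    assume "stuck A w (t + d) (ranks A w t f d)"
    then obtain r k0 j where j: "even j" and r: "\<And>k. k \<ge> k0 \<Longrightarrow> r k \<in> S (t + (d + k)) \<and>
      r (Suc k) \<in> trans A (r k) (w (t + (d + k))) \<and> ranks A w t f (d + k) (r k) = j"
      unfolding stuck_def ranks_add by (metis add.assoc)
    have "stuck A w t f"
      unfolding stuck_def
    proof (intro exI conjI)
      show "even j" by fact
      show "\<forall>k\<ge>d + k0. r (k - d) \<in> S (t + k) \<and> r (Suc k - d) \<in> trans A (r (k - d)) (w (t + k)) \<and>
        ranks A w t f k (r (k - d)) = j"
      proof (intro allI impI)
        fix k assume "k \<ge> d + k0"
        then show "r (k - d) \<in> S (t + k) \<and> r (Suc k - d) \<in> trans A (r (k - d)) (w (t + k)) \<and>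
        ranks A w t f k (r (k - d)) = j"
          using r[of "k - d"] by (simp add: Suc_diff_le)
      qed
    qed
    then show False using assms unfolding accepting_jump_iff by blast
  qed
qed

text \<open>Along a run of \<open>A\<close> the ranks settle at some value. A distinguished
  transition after that forces the value to be even, so a run with infinitely many of them would
  witness \<open>stuck\<close>.\<close>

lemma not_stuck_imp_UCA:
  assumes "accepting_jump A w t f"
  shows "w \<in> UCA_lang A"
proof -
  have False if run: "is_run A w r" and inf: "inf_dist A w r" for r
  proof -
    have rS: "r k \<in> S k" for k
    proof (induction k)
      case 0 then show ?case using run by (simp add: is_run_def)
    next
      case (Suc k) then show ?case using run S_step unfolding is_run_def by blast
    qed
    have step: "r (Suc (t + k)) \<in> trans A (r (t + k)) (w (t + k))" for k
      using run by (simp add: is_run_def)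
    define g where "g k = ranks A w t f k (r (t + k))" for k
    have g_dec: "g (Suc k) \<le> g k" for k
      using ranks_step_le[OF rS step] by (simp add: g_def)
    obtain k1 where k1: "0 \<le> k1" "\<forall>k\<ge>k1. g k = g k1"
      by (rule eventually_constant[of 0 g, OF g_dec])
    have "even (g k1)"
    proof -
      obtain n where n: "n \<ge> t + k1" "r (Suc n) \<in> dist_trans A (r n) (w n)"
        using inf by (auto simp: inf_dist_def INFM_nat_le)
      obtain k where k: "n = t + k" using n(1) by (metis add_leD1 le_iff_add)
      then have "g (Suc k) \<le> 2 * (g k div 2)"
        using ranks_dist_le[OF rS] n(2) by (simp add: g_def)
      moreover have "g (Suc k) = g k1" "g k = g k1"
        by (rule k1(2)[rule_format], use n(1) k in simp)+
      ultimately show ?thesis by presburger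
    qed
    then have "stuck A w t f"
      unfolding stuck_def
    proof (intro exI conjI allI impI)
      show "even (g k1)" by fact
      fix k assume "k1 \<le> k"
      show "r (t + k) \<in> S (t + k)" by (rule rS)
      show "r (t + Suc k) \<in> trans A (r (t + k)) (w (t + k))" using step[of k] by simp
      show "ranks A w t f k (r (t + k)) = g k1"
        using k1(2)[rule_format, OF \<open>k1 \<le> k\<close>] by (simp add: g_def)
    qed
    then show False using assms accepting_jump_iff by blast
  qed
  then show ?thesis using word by (auto simp: UCA_lang_def)
qed

end

section \<open>Ranking the runs on an accepted word\<close>

context word_run begin

section \<open>The run DAG of a word, with pairs of time and state as vertices\<close>

lemma S_path:
  assumes "q \<in> S k"
  shows "\<exists>p. p 0 \<in> initial A \<and> p k = q \<and> (\<forall>i<k. p (Suc i) \<in> trans A (p i) (w i))"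
  using assms
proof (induction k arbitrary: q)
  case 0
  then show ?case by (intro exI[of _ "\<lambda>_. q"]) simp
next
  case (Suc k)
  obtain q0 where q0: "q0 \<in> S k" "q \<in> trans A q0 (w k)" using S_pred[OF Suc.prems] by blast
  obtain p where p: "p 0 \<in> initial A" "p k = q0" "\<forall>i<k. p (Suc i) \<in> trans A (p i) (w i)"
    using Suc.IH[OF q0(1)] by blast
  define p' where "p' = p(Suc k := q)"
  have "p' (Suc i) \<in> trans A (p' i) (w i)" if "i < Suc k" for i
    using p q0(2) that by (cases "i = k") (auto simp: p'_def)
  moreover have "p' 0 \<in> initial A" "p' (Suc k) = q" using p(1) by (simp_all add: p'_def)
  ultimately show ?case by blast
qed

definition edge :: "nat \<times> 'q \<Rightarrow> nat \<times> 'q \<Rightarrow> bool" where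
  "edge v v' \<longleftrightarrow> snd v \<in> S (fst v) \<and> fst v' = Suc (fst v) \<and> snd v' \<in> trans A (snd v) (w (fst v))"

definition dedge :: "nat \<times> 'q \<Rightarrow> nat \<times> 'q \<Rightarrow> bool" where
  "dedge v v' \<longleftrightarrow> snd v \<in> S (fst v) \<and> fst v' = Suc (fst v) \<and> snd v' \<in> dist_trans A (snd v) (w (fst v))"

definition via_dist :: "nat \<times> 'q \<Rightarrow> nat \<times> 'q \<Rightarrow> bool" where
  "via_dist v u \<longleftrightarrow> (\<exists>a b. edge\<^sup>*\<^sup>* v a \<and> dedge a b \<and> edge\<^sup>*\<^sup>* b u)"

definition verts :: "(nat \<times> 'q) set" where
  "verts = {v. snd v \<in> S (fst v)}"

lemma dedge_edge: "dedge v v' \<Longrightarrow> edge v v'"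
  using dist_subset unfolding dedge_def edge_def by blast

lemma edge_verts: "edge v v' \<Longrightarrow> v \<in> verts \<and> v' \<in> verts"
  using S_step unfolding edge_def verts_def by (metis mem_Collect_eq)

lemma edge_path_fst: "(\<And>n. edge (p n) (p (Suc n))) \<Longrightarrow> fst (p n) = fst (p 0) + n"
  by (induction n) (auto simp: edge_def)

text \<open>Otherwise one could follow \<open>via_dist\<close> inside \<open>G\<close> forever, which yields a run with infinitely
  many distinguished transitions.\<close>

lemma via_dist_minimal:
  assumes UCA: "w \<in> UCA_lang A" and G: "G \<noteq> {}" "G \<subseteq> verts"
  shows "\<exists>v\<in>G. \<forall>u\<in>G. \<not> via_dist v u"
proof (rule ccontr)
  assume "\<not> ?thesis"
  then have ex: "\<And>v. v \<in> G \<Longrightarrow> \<exists>u\<in>G. via_dist v u" by blast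
  \<comment> \<open>From vertices in \<open>B\<close> the set \<open>G\<close> can be reached.
    \<open>D n v\<close> says that \<open>n\<close> edges after \<open>v\<close> comes a
    distinguished edge that ends in \<open>B\<close>.\<close>
  define B where "B = {v. \<exists>u\<in>G. edge\<^sup>*\<^sup>* v u}"
  define D where "D n v \<longleftrightarrow> (\<exists>a b. (edge ^^ n) v a \<and> dedge a b \<and> b \<in> B)" for n v
  have D_ex: "\<exists>n. D n v" if vB: "v \<in> B" for v
  proof -
    obtain u where u: "u \<in> G" "edge\<^sup>*\<^sup>* v u" using vB unfolding B_def by blast
    obtain u' a b where "u' \<in> G" "edge\<^sup>*\<^sup>* u a" "dedge a b" "edge\<^sup>*\<^sup>* b u'"
      using ex[OF u(1)] unfolding via_dist_def by blast
    then have "edge\<^sup>*\<^sup>* v a" "dedge a b" "b \<in> B" using u by (auto simp: B_def)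
    then show ?thesis unfolding D_def using rtranclp_imp_relpowp by fast
  qed
  define d where "d v = (LEAST n. D n v)" for v
  have D_d: "D (d v) v" if "v \<in> B" for v
    unfolding d_def using D_ex[OF that] by (rule LeastI_ex)
  \<comment> \<open>Each step stays in \<open>B\<close> and either takes a distinguished edge or
    comes closer to one. The distance cannot decrease forever, so distinguished edges recur.\<close>
  have step: "\<exists>v'. v' \<in> B \<and> edge v v' \<and> (dedge v v' \<or> d v' < d v)" if v: "v \<in> B" for v
  proof -
    obtain a b where ab: "(edge ^^ d v) v a" "dedge a b" "b \<in> B"
      using D_d[OF v] unfolding D_def by blast
    show ?thesis
    proof (cases "d v")
      case 0
      then have "a = v" using ab(1) by simp
      then show ?thesis using ab dedge_edge by blast
    next
      case (Suc n)
      then obtain v' where v': "edge v v'" "(edge ^^ n) v' a"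
        using ab(1) by (metis relpowp_Suc_D2)
      obtain u where u: "u \<in> G" "edge\<^sup>*\<^sup>* b u" using ab(3) unfolding B_def by blast
      have "edge\<^sup>*\<^sup>* v' b"
        using relpowp_imp_rtranclp[OF v'(2)] dedge_edge[OF ab(2)] by (rule rtranclp.rtrancl_into_rtrancl)
      then have "v' \<in> B" using u rtranclp_trans[of edge v' b u] unfolding B_def by blast
      moreover have "D n v'"
        unfolding D_def using v'(2) ab(2,3) by blast
      then have "d v' \<le> n"
        unfolding d_def by (rule Least_le)
      then have "d v' < d v" using Suc by simp
      ultimately show ?thesis using v'(1) by blast
    qed
  qed
  obtain v0 where v0: "v0 \<in> G" using G(1) by blast
  have v0B: "v0 \<in> B" using v0 unfolding B_def by blast
  have "\<exists>c. \<forall>n. (c n \<in> B \<and> (n = 0 \<longrightarrow> c n = v0)) \<and>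
      (edge (c n) (c (Suc n)) \<and> (dedge (c n) (c (Suc n)) \<or> d (c (Suc n)) < d (c n)))"
  proof (rule dependent_nat_choice)
    show "\<exists>v. v \<in> B \<and> ((0::nat) = 0 \<longrightarrow> v = v0)" using v0B by blast
    fix v and n :: nat assume "v \<in> B \<and> (n = 0 \<longrightarrow> v = v0)"
    then show "\<exists>v'. (v' \<in> B \<and> (Suc n = 0 \<longrightarrow> v' = v0)) \<and> edge v v' \<and> (dedge v v' \<or> d v' < d v)"
      using step by blast
  qed
  then obtain c where c: "c 0 = v0" "\<And>n. edge (c n) (c (Suc n))"
    "\<And>n. dedge (c n) (c (Suc n)) \<or> d (c (Suc n)) < d (c n)" by metis
  have inf: "\<exists>n\<ge>n0. dedge (c n) (c (Suc n))" for n0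
  proof (rule ccontr)
    assume no: "\<not> ?thesis"
    have "d (c (n0 + n)) + n \<le> d (c n0)" for n
    proof (induction n)
      case (Suc n)
      have "d (c (Suc (n0 + n))) < d (c (n0 + n))" using c(3)[of "n0 + n"] no by auto
      then show ?case using Suc by simp
    qed simp
    from this[of "Suc (d (c n0))"] show False by simp
  qed
  obtain k0 where k0: "fst v0 = k0" by simp
  have fst_c: "fst (c n) = k0 + n" for n
    using edge_path_fst[of c n] c k0 by simp
  have "snd v0 \<in> S k0" using G(2) v0 k0 by (auto simp: verts_def)
  then obtain p where p: "p 0 \<in> initial A" "p k0 = snd v0" "\<forall>i<k0. p (Suc i) \<in> trans A (p i) (w i)"
    using S_path by blast
  define r where "r k = (if k < k0 then p k else snd (c (k - k0)))" for k
  have r0: "r k = p k" if "k \<le> k0" for k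
    using that p(2) c(1) by (auto simp: r_def)
  have r1: "r (k0 + n) = snd (c n)" for n by (simp add: r_def)
  have "is_run A w r"
    unfolding is_run_def
  proof (intro conjI allI)
    show "r 0 \<in> initial A" using p(1) r0[of 0] by simp
    fix k
    show "r (Suc k) \<in> trans A (r k) (w k)"
    proof (cases "k < k0")
      case True
      then show ?thesis using p(3) r0[of k] r0[of "Suc k"] by simp
    next
      case False
      then obtain n where n: "k = k0 + n" by (metis le_iff_add not_less)
      then show ?thesis
        using c(2)[of n] fst_c[of n] r1[of n] r1[of "Suc n"] by (simp add: edge_def)
    qed
  qed
  moreover have "inf_dist A w r"
    unfolding inf_dist_def INFM_nat_le
  proof
    fix m
    obtain n where n: "n \<ge> m" "dedge (c n) (c (Suc n))" using inf by blast
    then have "r (Suc (k0 + n)) \<in> dist_trans A (r (k0 + n)) (w (k0 + n))"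
      using fst_c[of n] r1[of n] r1[of "Suc n"] by (simp add: dedge_def)
    then show "\<exists>n\<ge>m. r (Suc n) \<in> dist_trans A (r n) (w n)"
      using n(1) by (intro exI[of _ "k0 + n"]) simp
  qed
  ultimately show False using UCA by (auto simp: UCA_lang_def)
qed

text \<open>The layers of Kupferman and Vardi: even steps remove the vertices without an infinite path
  inside the layer, odd steps those that cannot reach a distinguished edge inside the layer.\<close>

primrec layer :: "nat \<Rightarrow> (nat \<times> 'q) set" where
  "layer 0 = verts"
| "layer (Suc i) =
     (if even i then {v \<in> layer i. \<exists>p. p 0 = v \<and> (\<forall>n. edge (p n) (p (Suc n)) \<and> p n \<in> layer i)}
      else {v \<in> layer i. \<exists>u\<in>layer i. via_dist v u})"

declare layer.simps(2) [simp del]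

lemma layer_Suc_subset: "layer (Suc i) \<subseteq> layer i"
  by (auto simp: layer.simps(2) split: if_splits)

lemma layer_antimono: "i \<le> j \<Longrightarrow> layer j \<subseteq> layer i"
  by (rule lift_Suc_antimono_le[of layer]) (rule layer_Suc_subset)

lemma layer_verts: "layer i \<subseteq> verts"
  using layer_antimono[of 0 i] by simp

lemma layer_S: "(k, q) \<in> layer i \<Longrightarrow> q \<in> S k"
  using layer_verts[of i] by (auto simp: verts_def)

lemma via_dist_edge: "edge v v' \<Longrightarrow> via_dist v' u \<Longrightarrow> via_dist v u"
  unfolding via_dist_def by (meson converse_rtranclp_into_rtranclp)

text \<open>An infinite path, or a path through a distinguished edge, is prolonged at the front by
  the edge from \<open>v\<close>.\<close>

lemma layer_pred: "edge v v' \<Longrightarrow> v' \<in> layer i \<Longrightarrow> v \<in> layer i"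
proof (induction i)
  case 0
  then show ?case using edge_verts by simp
next
  case (Suc i)
  then have v: "v \<in> layer i" using layer_Suc_subset by blast
  show ?case
  proof (cases "even i")
    case True
    then obtain p where p: "p 0 = v'" "\<And>n. edge (p n) (p (Suc n))" "\<And>n. p n \<in> layer i"
      using Suc.prems(2) unfolding layer.simps(2) by auto
    define p' where "p' n = (case n of 0 \<Rightarrow> v | Suc n \<Rightarrow> p n)" for n
    have "edge (p' n) (p' (Suc n))" "p' n \<in> layer i" for n
      using p v Suc.prems(1) by (auto simp: p'_def split: nat.split)
    moreover have "p' 0 = v" by (simp add: p'_def)
    ultimately show ?thesis using v True unfolding layer.simps(2) by auto
  next
    case False
    then show ?thesis
      using v Suc.prems via_dist_edge[OF Suc.prems(1)] unfolding layer.simps(2) if_not_P[OF False] by blast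
  qed
qed

lemma layer_pred_path:
  assumes "\<And>n. edge (p n) (p (Suc n))" "p n \<in> layer i"
  shows "p 0 \<in> layer i"
  using assms(2) by (induction n) (use assms(1) layer_pred in blast)+

lemma layer_path:
  assumes p: "\<And>n. edge (p n) (p (Suc n))" "\<And>n. p n \<in> layer i" and "even i"
  shows "p n \<in> layer (Suc i)"
proof -
  have "\<exists>p'. p' 0 = p n \<and> (\<forall>m. edge (p' m) (p' (Suc m)) \<and> p' m \<in> layer i)"
    using p by (intro exI[of _ "\<lambda>m. p (n + m)"]) simp
  then show ?thesis using p(2) \<open>even i\<close> unfolding layer.simps(2) by simp
qed

text \<open>A vertex of the odd layer without \<open>via_dist\<close> successor in it is removed
  next. Its infinite path in the preceding even layer lies in the odd layer, and it cannot meet the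
  next layer, which is closed under predecessors.\<close>

lemma odd_layer_path:
  assumes UCA: "w \<in> UCA_lang A" and ne: "layer (Suc (2 * i)) \<noteq> {}"
  shows "\<exists>p. \<forall>n. edge (p n) (p (Suc n)) \<and> p n \<in> layer (Suc (2 * i)) \<and> p n \<notin> layer (Suc (Suc (2 * i)))"
proof -
  obtain v where v: "v \<in> layer (Suc (2 * i))" "\<forall>u\<in>layer (Suc (2 * i)). \<not> via_dist v u"
    using via_dist_minimal[OF UCA ne layer_verts] by blast
  then have v2: "v \<notin> layer (Suc (Suc (2 * i)))"
    unfolding layer.simps(2)[of "Suc (2 * i)"] by simp
  obtain p where p: "p 0 = v" "\<And>n. edge (p n) (p (Suc n))" "\<And>n. p n \<in> layer (2 * i)"
    using v(1) unfolding layer.simps(2) by auto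
  have "p n \<in> layer (Suc (2 * i))" for n
    by (rule layer_path[of p, OF p(2,3)]) simp
  moreover have "p n \<notin> layer (Suc (Suc (2 * i)))" for n
    using layer_pred_path[of p n, OF p(2)] p(1) v2 by metis
  ultimately show ?thesis using p(2) by blast
qed

text \<open>Otherwise each odd layer up to this one, one more than there are states, has an infinite
  path that the next step removes. At a common late time these paths occupy pairwise different
  states.\<close>

lemma layer_empty:
  assumes UCA: "w \<in> UCA_lang A"
  shows "layer (Suc (2 * card (states A))) = {}"
proof (rule ccontr)
  let ?n = "card (states A)"
  assume ne: "layer (Suc (2 * ?n)) \<noteq> {}"
  have "layer (Suc (2 * i)) \<noteq> {}" if "i \<le> ?n" for i
    using ne layer_antimono[of "Suc (2 * i)" "Suc (2 * ?n)"] that by auto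
  then have "\<exists>p. \<forall>n. edge (p n) (p (Suc n)) \<and> p n \<in> layer (Suc (2 * i)) \<and> p n \<notin> layer (Suc (Suc (2 * i)))"
    if "i \<le> ?n" for i using odd_layer_path[OF UCA] that by blast
  then obtain p where p: "\<And>i n. i \<le> ?n \<Longrightarrow> edge (p i n) (p i (Suc n))"
    "\<And>i n. i \<le> ?n \<Longrightarrow> p i n \<in> layer (Suc (2 * i)) \<and> p i n \<notin> layer (Suc (Suc (2 * i)))" by metis
  define T where "T = Max ((\<lambda>i. fst (p i 0)) ` {..?n})"
  have T: "fst (p i 0) \<le> T" if "i \<le> ?n" for i
    unfolding T_def using that by (intro Max_ge) auto
  define x where "x i = p i (T - fst (p i 0))" for i
  have fst_x: "fst (x i) = T" if "i \<le> ?n" for i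
    using edge_path_fst[of "p i" "T - fst (p i 0)", OF p(1)[OF that]] T[OF that] by (simp add: x_def)
  have x: "x i \<in> layer (Suc (2 * i))" "x i \<notin> layer (Suc (Suc (2 * i)))" if "i \<le> ?n" for i
    using p(2)[OF that] by (simp_all add: x_def)
  have less: "x i \<noteq> x j" if "i < j" "j \<le> ?n" for i j
    using x(2)[of i] x(1)[of j] layer_antimono[of "Suc (Suc (2 * i))" "Suc (2 * j)"] that by auto
  have "inj_on (\<lambda>i. snd (x i)) {..?n}"
  proof (rule inj_onI)
    fix i j assume ij: "i \<in> {..?n}" "j \<in> {..?n}" "snd (x i) = snd (x j)"
    then have "x i = x j" using fst_x by (simp add: prod_eq_iff)
    then show "i = j" using less[of i j] less[of j i] ij by (metis atMost_iff nat_neq_iff)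
  qed
  moreover have "(\<lambda>i. snd (x i)) ` {..?n} \<subseteq> states A"
    using x(1) layer_verts S_states by (fastforce simp: verts_def)
  ultimately have "card {..?n} \<le> ?n"
    using aut card_inj_on_le[of _ "{..?n}" "states A"] by (auto simp: automaton_def)
  then show False by simp
qed

text \<open>The rank of Kupferman and Vardi: as the layers decrease, it is the index of the last
  layer that contains the vertex.\<close>

definition vrank :: "nat \<times> 'q \<Rightarrow> nat" where
  "vrank v = (LEAST i. v \<notin> layer (Suc i))"

lemma layer_iff_vrank:
  assumes UCA: "w \<in> UCA_lang A" and v: "v \<in> verts"
  shows "v \<in> layer i \<longleftrightarrow> i \<le> vrank v"
proof -
  have "\<exists>i. v \<notin> layer (Suc i)" using layer_empty[OF UCA] by blast
  then have 1: "v \<notin> layer (Suc (vrank v))" unfolding vrank_def by (rule LeastI_ex)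
  have 2: "v \<in> layer (Suc j)" if "j < vrank v" for j
    using that not_less_Least unfolding vrank_def by blast
  show ?thesis
  proof
    show "v \<in> layer i \<Longrightarrow> i \<le> vrank v"
      using 1 layer_antimono[of "Suc (vrank v)" i] by (meson not_less_eq_eq subsetD)
    show "i \<le> vrank v \<Longrightarrow> v \<in> layer i"
      using 2[of "i - 1"] v by (cases i) auto
  qed
qed

lemma vrank_edge:
  assumes UCA: "w \<in> UCA_lang A" and e: "edge v v'"
  shows "vrank v' \<le> vrank v"
  using layer_pred[OF e, of "vrank v'"] layer_iff_vrank[OF UCA] edge_verts[OF e] by blast

text \<open>If both ends of the edge had the same odd rank, the edge would lie inside that layer and
  \<open>v\<close> would survive the next removal.\<close>

lemma vrank_dedge:
  assumes UCA: "w \<in> UCA_lang A" and e: "dedge v v'"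
  shows "vrank v' \<le> 2 * (vrank v div 2)"
proof (cases "even (vrank v)")
  case True
  then show ?thesis using vrank_edge[OF UCA dedge_edge[OF e]] by simp
next
  case False
  have vv': "v \<in> verts" "v' \<in> verts" using edge_verts[OF dedge_edge[OF e]] by auto
  have "vrank v' \<noteq> vrank v"
  proof
    assume eq: "vrank v' = vrank v"
    have "v \<in> layer (vrank v)" "v' \<in> layer (vrank v)"
      using layer_iff_vrank[OF UCA] vv' eq by auto
    moreover have "via_dist v v'" unfolding via_dist_def using e by blast
    ultimately have "v \<in> layer (Suc (vrank v))"
      using False unfolding layer.simps(2) by auto
    then show False using layer_iff_vrank[OF UCA vv'(1)] by simp
  qed
  then show ?thesis using vrank_edge[OF UCA dedge_edge[OF e]] False by presburger
qed

text \<open>For even \<open>c\<close> the path would be an infinite path inside layer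
  \<open>c\<close>, so its vertices would belong to layer \<open>Suc c\<close>.\<close>

lemma constant_vrank_odd:
  assumes UCA: "w \<in> UCA_lang A" and p: "\<And>n. edge (p n) (p (Suc n))" "\<And>n. vrank (p n) = c"
  shows "odd c"
proof
  assume "even c"
  have v: "p n \<in> verts" for n using edge_verts[OF p(1)] by blast
  have "p n \<in> layer c" for n using layer_iff_vrank[OF UCA v] p(2) by simp
  then have "p 0 \<in> layer (Suc c)" using layer_path[of p c 0, OF p(1) _ \<open>even c\<close>] by blast
  then show False using layer_iff_vrank[OF UCA v[of 0]] p(2)[of 0] by simp
qed

text \<open>\<open>reach_low c t d\<close> contains the states reached after \<open>d\<close> steps from vertices of rank at most
  \<open>c\<close> at time \<open>t\<close>. Starting later can only enlarge the set of states at a given time, so from some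
  time on starting later makes no difference in the long run.\<close>

primrec reach_low :: "nat \<Rightarrow> nat \<Rightarrow> nat \<Rightarrow> 'q set" where
  "reach_low c t 0 = {q \<in> S t. vrank (t, q) \<le> c}"
| "reach_low c t (Suc d) = post A (reach_low c t d) (w (t + d))"

lemma reach_low_subset:
  assumes UCA: "w \<in> UCA_lang A"
  shows "reach_low c t d \<subseteq> {q \<in> S (t + d). vrank (t + d, q) \<le> c}"
proof (induction d)
  case (Suc d)
  show ?case
  proof
    fix q' assume "q' \<in> reach_low c t (Suc d)"
    then obtain q where q: "q \<in> reach_low c t d" "q' \<in> trans A q (w (t + d))" by (auto simp: post_def)
    then have "edge (t + d, q) (Suc (t + d), q')" using Suc by (auto simp: edge_def)
    from vrank_edge[OF UCA this] edge_verts[OF this]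
    show "q' \<in> {q \<in> S (t + Suc d). vrank (t + Suc d, q) \<le> c}"
      using Suc q by (auto simp: verts_def)
  qed
qed simp

lemma reach_low_later:
  assumes UCA: "w \<in> UCA_lang A"
  shows "reach_low c t (a + d) \<subseteq> reach_low c (t + a) d"
proof (induction d)
  case 0
  then show ?case using reach_low_subset[OF UCA, of c t a] by simp
next
  case (Suc d)
  then show ?case by (auto simp: post_def add.assoc)
qed

text \<open>A single \<open>d\<close> is asked for because both sides evolve by the same
  \<open>post\<close>: sets that have become equal remain equal.\<close>

definition stable :: "nat \<Rightarrow> nat \<Rightarrow> bool" where
  "stable c t0 \<longleftrightarrow> (\<forall>t\<ge>t0. \<forall>a. \<exists>d. reach_low c t (a + d) = reach_low c (t + a) d)"

lemma finite_reach_low: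
  assumes UCA: "w \<in> UCA_lang A"
  shows "finite (reach_low c t d)" "card (reach_low c t d) \<le> card (states A)"
proof -
  have sub: "reach_low c t d \<subseteq> S (t + d)" using reach_low_subset[OF UCA, of c t d] by blast
  show "finite (reach_low c t d)" using finite_subset[OF sub finite_S] .
  show "card (reach_low c t d) \<le> card (states A)"
    using aut sub S_states[of "t + d"] by (intro card_mono) (auto simp: automaton_def)
qed

text \<open>A failure of stability raises the lower bound \<open>n\<close> on the eventual size of
  the sets to \<open>Suc n\<close>, at a later starting time. Sizes are bounded by the number of
  states, so this stops.\<close>

lemma ex_stable:
  assumes UCA: "w \<in> UCA_lang A"
  shows "\<exists>t0. stable c t0"
proof -
  have "\<exists>t0. stable c t0" if "\<forall>d\<ge>d0. card (reach_low c t d) \<ge> n" for n t d0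
    using that
  proof (induction "Suc (card (states A)) - n" arbitrary: n t d0 rule: less_induct)
    case less
    show ?case
    proof (cases "stable c t")
      case True
      then show ?thesis by blast
    next
      case False
      then obtain t1 a where t1: "t1 \<ge> t" "\<And>d. reach_low c t1 (a + d) \<noteq> reach_low c (t1 + a) d"
        unfolding stable_def by blast
      obtain b where b: "t1 = t + b" using t1(1) le_iff_add by blast
      have "card (reach_low c (t1 + a) d) \<ge> Suc n" if "d \<ge> d0" for d
      proof -
        have "n \<le> card (reach_low c t (b + (a + d)))" using less(2) that by simp
        also have "\<dots> \<le> card (reach_low c t1 (a + d))"
          unfolding b by (intro card_mono finite_reach_low reach_low_later UCA)
        also have "\<dots> < card (reach_low c (t1 + a) d)"
          using t1(2)[of d] reach_low_later[OF UCA, of c t1 a d]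
          by (intro psubset_card_mono finite_reach_low UCA) blast
        finally show ?thesis by simp
      qed
      then have *: "\<forall>d\<ge>d0. card (reach_low c (t1 + a) d) \<ge> Suc n" by blast
      then have "Suc n \<le> card (states A)"
        using finite_reach_low(2)[OF UCA, of c "t1 + a" d0] by (meson order_refl order_trans)
      then show ?thesis using less(1)[OF _ *] by simp
    qed
  qed
  from this[of 0 0 0] show ?thesis by simp
qed

lemma stable_mono: "stable c t0 \<Longrightarrow> t0 \<le> t1 \<Longrightarrow> stable c t1"
  unfolding stable_def by (meson order_trans)

text \<open>The jump takes the values of \<open>vrank\<close> at a late time \<open>t\<close>.
  Afterwards the construction updates ranks by itself, and they may exceed \<open>vrank\<close>.
  Tightness only needs the odd ranks on their witnessing paths; a constant even rank above an odd
  \<open>vrank\<close> is excluded by \<open>stable\<close>.\<close>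

lemma UCA_imp_accepting_jump:
  assumes UCA: "w \<in> UCA_lang A"
  shows "(\<exists>k. S k = {}) \<or> (\<exists>t>0. \<exists>f. accepting_jump A w t f)"
proof -
  \<comment> \<open>The odd ranks that occur are \<open>1, 3, ..., 2 * m - 1\<close>.\<close>
  define m where "m = (LEAST i. layer (Suc (2 * i)) = {})"
  have m: "layer (Suc (2 * m)) = {}"
    unfolding m_def using layer_empty[OF UCA] by (rule LeastI)
  have m_less: "layer (Suc (2 * i)) \<noteq> {}" if "i < m" for i
    using that not_less_Least unfolding m_def by blast
  \<comment> \<open>Otherwise Koenig's lemma would give an infinite path inside the even layer
    \<open>2 * m\<close>, although the next layer is empty.\<close>
  have "\<exists>T. \<forall>q. (T, q) \<notin> layer (2 * m)"
  proof (rule ccontr)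
    assume "\<not> ?thesis"
    then have ne: "{q. (k, q) \<in> layer (2 * m)} \<noteq> {}" for k by blast
    have "\<exists>r. \<forall>k. r k \<in> {q. (k, q) \<in> layer (2 * m)} \<and> edge (k, r k) (Suc k, r (Suc k))"
    proof (rule konig_path)
      show "finite {q. (k, q) \<in> layer (2 * m)}" for k
        using layer_verts[of "2 * m"] by (intro finite_subset[OF _ finite_S[of k]]) (auto simp: verts_def)
      show "{q. (k, q) \<in> layer (2 * m)} \<noteq> {}" for k by (rule ne)
      fix k y assume y: "y \<in> {q. (Suc k, q) \<in> layer (2 * m)}"
      then have "y \<in> S (Suc k)" using layer_S by blast
      then obtain x where x: "x \<in> S k" "y \<in> trans A x (w k)" using S_pred by blast
      then have e: "edge (k, x) (Suc k, y)" by (simp add: edge_def)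
      then have "(k, x) \<in> layer (2 * m)" using layer_pred y by blast
      then show "\<exists>x\<in>{q. (k, q) \<in> layer (2 * m)}. edge (k, x) (Suc k, y)" using e by blast
    qed
    then obtain r where "\<And>k. (k, r k) \<in> layer (2 * m)" "\<And>k. edge (k, r k) (Suc k, r (Suc k))" by auto
    then have "(0, r 0) \<in> layer (Suc (2 * m))"
      using layer_path[of "\<lambda>k. (k, r k)" "2 * m" 0] by simp
    then show False using m by blast
  qed
  then obtain T where T: "\<And>q. (T, q) \<notin> layer (2 * m)" by blast
  have T_ge: "(k, q) \<notin> layer (2 * m)" if "k \<ge> T" for k q
    using that
  proof (induction arbitrary: q rule: dec_induct)
    case base
    then show ?case by (rule T)
  next
    case (step k)
    show ?case
    proof
      assume y: "(Suc k, q) \<in> layer (2 * m)"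
      then have "q \<in> S (Suc k)" by (rule layer_S)
      then obtain x where x: "x \<in> S k" "q \<in> trans A x (w k)" using S_pred by blast
      then have "edge (k, x) (Suc k, q)" by (simp add: edge_def)
      then show False using layer_pred y step by blast
    qed
  qed
  show ?thesis
  proof (cases "m = 0")
    case True
    then have "S T = {}" using T by (auto simp: verts_def)
    then show ?thesis by blast
  next
    case False
    have vrank_less: "vrank (k, q) < 2 * m" if "k \<ge> T" "q \<in> S k" for k q
      using layer_iff_vrank[OF UCA, of "(k, q)" "2 * m"] T_ge that by (auto simp: verts_def)
    have "\<exists>p. \<forall>n. edge (p n) (p (Suc n)) \<and> vrank (p n) = Suc (2 * i)" if i: "i < m" for i
    proof -
      obtain p where p: "\<And>n. edge (p n) (p (Suc n))" "\<And>n. p n \<in> layer (Suc (2 * i))"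
        "\<And>n. p n \<notin> layer (Suc (Suc (2 * i)))" using odd_layer_path[OF UCA m_less[OF i]] by blast
      have "vrank (p n) = Suc (2 * i)" for n
        using layer_iff_vrank[OF UCA, of "p n"] p(2,3)[of n] edge_verts[OF p(1)[of n]]
        by (meson antisym not_less_eq_eq)
      then show ?thesis using p(1) by blast
    qed
    then obtain p where p: "\<And>i n. i < m \<Longrightarrow> edge (p i n) (p i (Suc n))"
      "\<And>i n. i < m \<Longrightarrow> vrank (p i n) = Suc (2 * i)" by metis
    obtain t0 where t0: "\<And>c. stable c (t0 c)" using ex_stable[OF UCA] by metis
    \<comment> \<open>\<open>t\<close> is positive, since no jump lands at time \<open>0\<close>; it
      lies beyond neither less than \<open>T\<close>, nor the starts of the paths for the odd ranks,
      nor the stability times of all \<open>c < 2 * m\<close>: it is at least each of them.\<close>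
    define t where "t = Max (insert 1 (insert T ((\<lambda>i. fst (p i 0)) ` {..<m} \<union> t0 ` {..<2 * m})))"
    have t_ge: "x \<le> t" if "x \<in> insert 1 (insert T ((\<lambda>i. fst (p i 0)) ` {..<m} \<union> t0 ` {..<2 * m}))" for x
      unfolding t_def using that by (intro Max_ge) auto
    have "t \<ge> 1" "t \<ge> T" by (rule t_ge, simp)+
    moreover have "fst (p i 0) \<le> t" if "i < m" for i
      by (rule t_ge) (use that in simp)
    moreover have "stable c t" if "c < 2 * m" for c
      by (rule stable_mono[OF t0], rule t_ge) (use that in simp)
    ultimately have t: "t > 0" "t \<ge> T" "\<And>i. i < m \<Longrightarrow> fst (p i 0) \<le> t" "\<And>c. c < 2 * m \<Longrightarrow> stable c t"
      by simp_all
    define f where "f = restrict (\<lambda>q. vrank (t, q)) (S t)"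
    let ?f = "ranks A w t f"
    \<comment> \<open>The ranks are the pointwise largest continuation of \<open>f\<close> that
      obeys the inequalities along edges, and \<open>vrank\<close> obeys them.\<close>
    have ge: "vrank (t + k, q) \<le> ?f k q" if "q \<in> S (t + k)" for k q
      using that
    proof (induction k arbitrary: q)
      case 0
      then show ?case by (simp add: f_def)
    next
      case (Suc k)
      then have q: "q \<in> S (Suc (t + k))" by simp
      obtain q0 where q0: "q0 \<in> S (t + k)" "q \<in> trans A q0 (w (t + k))"
        "?f (Suc k) q = ?f k q0 \<or> q \<in> dist_trans A q0 (w (t + k)) \<and> ?f (Suc k) q = 2 * (?f k q0 div 2)"
        using succ_fun_attained[OF q, of "?f k"] by auto
      have e: "edge (t + k, q0) (Suc (t + k), q)" using q0 by (simp add: edge_def)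
      from q0(3) show ?case
      proof
        assume "?f (Suc k) q = ?f k q0"
        then show ?thesis using Suc.IH[OF q0(1)] vrank_edge[OF UCA e] by (simp del: ranks.simps)
      next
        assume *: "q \<in> dist_trans A q0 (w (t + k)) \<and> ?f (Suc k) q = 2 * (?f k q0 div 2)"
        then have "dedge (t + k, q0) (Suc (t + k), q)" using q0 by (simp add: dedge_def)
        from vrank_dedge[OF UCA this] have "vrank (Suc (t + k), q) \<le> 2 * (vrank (t + k, q0) div 2)" .
        also have "\<dots> \<le> 2 * (?f k q0 div 2)" using Suc.IH[OF q0(1)] by (simp add: div_le_mono)
        finally show ?thesis using * by (simp del: ranks.simps)
      qed
    qed
    have less: "?f k q < 2 * m" if "q \<in> S (t + k)" for k q
      using that
    proof (induction k arbitrary: q)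
      case 0
      then show ?case using vrank_less t(2) by (simp add: f_def)
    next
      case (Suc k)
      then have "q \<in> S (Suc (t + k))" by simp
      then obtain q0 where q0: "q0 \<in> S (t + k)" "q \<in> trans A q0 (w (t + k))" using S_pred by blast
      then show ?case using Suc.IH[OF q0(1)] ranks_step_le[OF q0, of f] by (simp del: ranks.simps)
    qed
    have low: "?f k q \<le> c" if "q \<in> reach_low c t k" for k q c
      using that
    proof (induction k arbitrary: q)
      case 0
      then show ?case by (simp add: f_def)
    next
      case (Suc k)
      then obtain q0 where q0: "q0 \<in> reach_low c t k" "q \<in> trans A q0 (w (t + k))" by (auto simp: post_def)
      then have "q0 \<in> S (t + k)" using reach_low_subset[OF UCA] by blast
      then show ?case using Suc.IH[OF q0(1)] ranks_step_le[OF _ q0(2), of f] by (simp del: ranks.simps)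
    qed
    \<comment> \<open>The path of constant \<open>vrank\<close> has this rank at time
      \<open>t\<close>. Along it the ranks cannot grow, and they cannot fall below
      \<open>vrank\<close>.\<close>
    have odd_hit: "\<exists>q\<in>S (t + k). ?f k q = Suc (2 * i)" if i: "i < m" for i k
    proof -
      define r where "r k = snd (p i (t - fst (p i 0) + k))" for k
      have fst_r: "p i (t - fst (p i 0) + k) = (t + k, r k)" for k
        using edge_path_fst[of "p i" "t - fst (p i 0) + k", OF p(1)[OF i]] t(3)[OF i]
        by (simp add: r_def prod_eq_iff)
      have e: "edge (t + k, r k) (Suc (t + k), r (Suc k))" for k
        using p(1)[OF i, of "t - fst (p i 0) + k"] fst_r[of k] fst_r[of "Suc k"] by simp
      then have rS: "r k \<in> S (t + k)" "r (Suc k) \<in> trans A (r k) (w (t + k))" for k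
        by (auto simp: edge_def)
      have vr: "vrank (t + k, r k) = Suc (2 * i)" for k
        using p(2)[OF i, of "t - fst (p i 0) + k"] fst_r[of k] by simp
      have "?f k (r k) \<le> Suc (2 * i)" for k
      proof (induction k)
        case 0
        then show ?case using rS(1)[of 0] vr[of 0] by (simp add: f_def)
      next
        case (Suc k)
        then show ?case using ranks_step_le[OF rS, of f k] by (simp del: ranks.simps)
      qed
      then have "?f k (r k) = Suc (2 * i)" using ge[OF rS(1)] vr by (metis antisym)
      then show ?thesis using rS(1) by blast
    qed
    have tight: "?f k \<in> tight_funs (S (t + k))" for k
      unfolding tight_funs_def
    proof (intro CollectI exI conjI)
      have odds: "{j. odd j \<and> j < 2 * m} = (\<lambda>i. Suc (2 * i)) ` {..<m}"
        by (auto simp: image_iff elim!: oddE)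
      show sub: "{j. odd j \<and> j < 2 * m} \<subseteq> ?f k ` S (t + k)"
        unfolding odds using odd_hit by force
      have "m = card {j. odd j \<and> j < 2 * m}"
        unfolding odds by (subst card_image) (auto simp: inj_on_def)
      also have "\<dots> \<le> card (?f k ` S (t + k))" using sub finite_S by (intro card_mono) auto
      also have "\<dots> \<le> card (S (t + k))" using finite_S by (rule card_image_le)
      finally show "m \<le> card (S (t + k))" .
      have "?f k \<in> extensional (S (t + k))"
        by (cases k) (auto simp: f_def succ_fun_def)
      then show "?f k \<in> S (t + k) \<rightarrow>\<^sub>E {..<2 * m}"
        using less by (auto simp: PiE_def)
    qed
    \<comment> \<open>A path of constant even rank \<open>j\<close> settles at an odd
      \<open>vrank\<close> \<open>c\<close>. By \<open>stable\<close>, one of its later states is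
      also reached from a state of rank at most \<open>c\<close> at time \<open>t\<close>, which
      squeezes \<open>j\<close> to \<open>c\<close>.\<close>
    have "\<not> stuck A w t f"
    proof
      assume "stuck A w t f"
      then obtain r k0 j where j: "even j" and r: "\<And>k. k \<ge> k0 \<Longrightarrow> r k \<in> S (t + k)"
        "\<And>k. k \<ge> k0 \<Longrightarrow> r (Suc k) \<in> trans A (r k) (w (t + k))" "\<And>k. k \<ge> k0 \<Longrightarrow> ?f k (r k) = j"
        unfolding stuck_def by blast
      define g where "g k = vrank (t + k, r k)" for k
      have e: "edge (t + k, r k) (Suc (t + k), r (Suc k))" if "k \<ge> k0" for k
        using r(1,2)[OF that] by (simp add: edge_def)
      have g_dec: "g (Suc k) \<le> g k" if "k \<ge> k0" for k
        using vrank_edge[OF UCA e[OF that]] by (simp add: g_def)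
      obtain k1 where k1: "k1 \<ge> k0" "\<forall>k\<ge>k1. g k = g k1"
        by (rule eventually_constant[of k0 g, OF g_dec])
      define c where "c = g k1"
      have gc: "g k = c" if "k \<ge> k1" for k using k1(2)[rule_format, OF that] by (simp add: c_def)
      have "odd c"
      proof (rule constant_vrank_odd[OF UCA, of "\<lambda>n. (t + (k1 + n), r (k1 + n))"])
        show "edge (t + (k1 + n), r (k1 + n)) (t + (k1 + Suc n), r (k1 + Suc n))" for n
          using e[of "k1 + n"] k1(1) by simp
        show "vrank (t + (k1 + n), r (k1 + n)) = c" for n
          using gc[of "k1 + n"] by (simp add: g_def)
      qed
      have "c < 2 * m"
        using vrank_less[of "t + k1" "r k1"] r(1)[OF k1(1)] t(2) by (simp add: c_def g_def)
      then obtain d where d: "reach_low c t (k1 + d) = reach_low c (t + k1) d"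
        using t(4) unfolding stable_def by blast
      have "r (k1 + n) \<in> reach_low c (t + k1) n" for n
      proof (induction n)
        case 0
        then show ?case using r(1)[OF k1(1)] gc[of k1] by (simp add: g_def)
      next
        case (Suc n)
        then show ?case using r(2)[of "k1 + n"] k1(1) by (auto simp: post_def add.assoc)
      qed
      then have "r (k1 + d) \<in> reach_low c t (k1 + d)" using d by simp
      then have "?f (k1 + d) (r (k1 + d)) \<le> c" by (rule low)
      moreover have "c \<le> ?f (k1 + d) (r (k1 + d))"
        using ge[of "r (k1 + d)" "k1 + d"] r(1)[of "k1 + d"] k1(1) gc[of "k1 + d"] by (simp add: g_def)
      ultimately have "j = c" using r(3)[of "k1 + d"] k1(1) by simp
      then show False using j \<open>odd c\<close> by simp
    qed
    then have "accepting_jump A w t f"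
      unfolding accepting_jump_iff always_tight_def using tight by blast
    then show ?thesis using t(1) by blast
  qed
qed

end

section \<open>Runs of the rank-based construction\<close>

text \<open>After a break the index is at most the rank, which for a tight function is below twice
  the number of states. For an empty successor set it is \<open>0\<close>, and the bound on
  \<open>i\<close> gives \<open>0 < 2 * card (states A)\<close>.\<close>

lemma rb_next_in_states:
  assumes A: "automaton A" and \<sigma>: "\<sigma> \<in> alphabet A" and s: "Ranked S O' f i \<in> rb_states A"
    and tight: "succ_fun A S f \<sigma> \<in> tight_funs (post A S \<sigma>)"
  shows "rb_next A (Ranked S O' f i) \<sigma> \<in> rb_states A"
proof -
  let ?S = "post A S \<sigma>" and ?f = "succ_fun A S f \<sigma>"
  have S: "S \<subseteq> states A" "even i" "i < 2 * card (states A)" using s by (auto simp: rb_states_def)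
  have S': "?S \<subseteq> states A"
    using A S(1) \<sigma> unfolding automaton_def post_def by blast
  have fin: "finite (states A)" using A by (simp add: automaton_def)
  have finS: "finite ?S" using finite_subset[OF S' fin] .
  let ?i = "(i + 2) mod (rank ?S ?f + 1)"
  have "even ?i \<and> ?i < 2 * card (states A)"
  proof (cases "?S = {}")
    case True
    then show ?thesis using S(3) by simp
  next
    case False
    note r = tight_funs_rank_odd[OF tight False finS]
    have "?i < rank ?S ?f + 1" by simp
    also have "\<dots> \<le> 2 * card ?S" using r(2) by simp
    also have "\<dots> \<le> 2 * card (states A)" using card_mono[OF fin S'] by simp
    finally show ?thesis using r(1) S(2) by (simp add: dvd_mod)
  qed
  then show ?thesis
    using S S' tight by (auto simp: rb_states_def Let_def keep_set_def)
qed

text \<open>The two kinds of ranked transitions exclude each other and together cover all cases with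
  tight successor ranks.\<close>

lemma rb_trans_Ranked:
  assumes "automaton A" "\<sigma> \<in> alphabet A" "Ranked S O' f i \<in> rb_states A"
  shows "rb_trans A (Ranked S O' f i) \<sigma> =
    (if succ_fun A S f \<sigma> \<in> tight_funs (post A S \<sigma>) then {rb_next A (Ranked S O' f i) \<sigma>} else {})"
proof (cases "succ_fun A S f \<sigma> \<in> tight_funs (post A S \<sigma>)")
  case True
  then have "delta3_keep A S O' f i \<sigma> \<union> delta3_break A S O' f i \<sigma> = {rb_next A (Ranked S O' f i) \<sigma>}"
    by (auto simp: delta3_keep_def delta3_break_def Let_def)
  then show ?thesis using rb_next_in_states[OF assms True] True by simp
next
  case False
  then show ?thesis by (auto simp: delta3_keep_def delta3_break_def Let_def)
qed

lemma rb_acc_Ranked: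
  assumes "automaton A" "\<sigma> \<in> alphabet A" "Ranked S O' f i \<in> rb_states A"
  shows "rb_acc A (Ranked S O' f i) \<sigma> =
    (if succ_fun A S f \<sigma> \<in> tight_funs (post A S \<sigma>) \<and> keep_set A S O' f i \<sigma> = {}
     then {rb_next A (Ranked S O' f i) \<sigma>} else {})"
proof (cases "succ_fun A S f \<sigma> \<in> tight_funs (post A S \<sigma>) \<and> keep_set A S O' f i \<sigma> = {}")
  case True
  then have "delta3_break A S O' f i \<sigma> = {rb_next A (Ranked S O' f i) \<sigma>}"
    by (auto simp: delta3_break_def Let_def)
  then show ?thesis using rb_next_in_states[OF assms] True by simp
next
  case False
  then have "delta3_break A S O' f i \<sigma> = {}"
    by (auto simp: delta3_break_def Let_def)
  then show ?thesis using False by auto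
qed

lemma rb_trans_in_states: "rb_trans A q \<sigma> \<subseteq> rb_states A"
  by (cases q) auto

lemma finite_rb_states:
  assumes "automaton A"
  shows "finite (rb_states A)"
proof -
  let ?Q = "states A"
  have fin: "finite ?Q" using assms by (simp add: automaton_def)
  let ?T = "\<Union>S\<in>Pow ?Q. tight_funs S"
  have finT: "finite ?T"
    using fin finite_tight_funs finite_subset by auto
  have "rb_states A \<subseteq> Subset ` Pow ?Q \<union>
      (\<lambda>(S, O', f, i). Ranked S O' f i) ` (Pow ?Q \<times> Pow ?Q \<times> ?T \<times> {..<2 * card ?Q})"
  proof
    fix x assume x: "x \<in> rb_states A"
    show "x \<in> Subset ` Pow ?Q \<union>
      (\<lambda>(S, O', f, i). Ranked S O' f i) ` (Pow ?Q \<times> Pow ?Q \<times> ?T \<times> {..<2 * card ?Q})"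
    proof (cases x)
      case (Subset S)
      then show ?thesis using x by (auto simp: rb_states_def)
    next
      case (Ranked S O' f i)
      then have "S \<subseteq> ?Q" "f \<in> tight_funs S" "i < 2 * card ?Q" "O' \<subseteq> level S f i"
        using x by (auto simp: rb_states_def)
      then have "(S, O', f, i) \<in> Pow ?Q \<times> Pow ?Q \<times> ?T \<times> {..<2 * card ?Q}"
        by (auto simp: level_def)
      then show ?thesis unfolding Ranked by (intro UnI2 image_eqI[of _ _ "(S, O', f, i)"]) simp_all
    qed
  qed
  moreover have "finite (Subset ` Pow ?Q \<union>
      (\<lambda>(S, O', f, i). Ranked S O' f i) ` (Pow ?Q \<times> Pow ?Q \<times> ?T \<times> {..<2 * card ?Q}))"
    using fin finT by (intro finite_UnI finite_imageI finite_cartesian_product) auto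
  ultimately show ?thesis by (rule finite_subset)
qed

text \<open>\<open>sel\<close> sees exactly the first \<open>s\<close> letters, and
  \<open>None\<close> means staying among the subsets forever. The jump consumes the last of these
  letters, so at length \<open>s\<close> the state is already ranked.\<close>

definition jump_resolver ::
  "('q, 'l) aut \<Rightarrow> nat \<Rightarrow> ('l list \<Rightarrow> ('q \<Rightarrow> nat) option) \<Rightarrow> 'l list \<Rightarrow> 'q rb_state" where
  "jump_resolver A s sel x =
     (if length x < s then Subset (foldl (post A) (initial A) x)
      else case sel (take s x) of
        None \<Rightarrow> Subset (foldl (post A) (initial A) x)
      | Some f \<Rightarrow> foldl (rb_next A) (Ranked (foldl (post A) (initial A) (take s x)) {} f 0) (drop s x))"

lemma foldl_rb_next_det_run:
  "foldl (rb_next A) (Ranked (subsets A w t) {} f 0) (map (\<lambda>j. w (t + j)) [0..<k]) = det_run A w t f k"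
  by (induction k) simp_all

lemma jump_resolver_word:
  "jump_resolver A s sel (map w [0..<k]) =
     (if k < s then Subset (subsets A w k)
      else case sel (map w [0..<s]) of
        None \<Rightarrow> Subset (subsets A w k)
      | Some f \<Rightarrow> det_run A w s f (k - s))"
proof (cases "k < s")
  case False
  have "take s (map w [0..<k]) = map w [0..<s]"
    using False by (simp add: take_map)
  moreover have "drop s (map w [0..<k]) = map (\<lambda>j. w (s + j)) [0..<k - s]"
    using False by (simp add: list_eq_iff_nth_eq)
  ultimately show ?thesis
    using False foldl_rb_next_det_run[of A w s _ "k - s"]
    by (simp add: jump_resolver_def subsets_def split: option.split)
qed (simp add: jump_resolver_def subsets_def)

section \<open>Accepting jumps and accepting runs of the construction\<close>

context word_run begin

abbreviation "C \<equiv> rank_construction A"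

text \<open>The index \<open>0\<close> of the first ranked state must be below
  \<open>2 * card (states A)\<close>, hence the nonempty state set.\<close>

lemma det_run_in_states:
  assumes tight: "always_tight A w t f" and ne: "states A \<noteq> {}"
  shows "det_run A w t f k \<in> rb_states A"
proof (induction k)
  case 0
  have "f \<in> tight_funs (S t)" using tight unfolding always_tight_def by (metis add_0_right ranks.simps(1))
  moreover have "card (states A) > 0" using ne aut by (simp add: automaton_def card_gt_0_iff)
  ultimately show ?case using S_states[of t] by (simp add: rb_states_def)
next
  case (Suc k)
  have "ranks A w t f (Suc k) \<in> tight_funs (S (t + Suc k))" using tight unfolding always_tight_def by blast
  then show ?case
    using rb_next_in_states[OF aut w_in, of "S (t + k)"] Suc det_run_eq[of t f k] by simp
qed

lemma Subset_trans: "Subset (S (Suc k)) \<in> rb_trans A (Subset (S k)) (w k)"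
  using S_states[of "Suc k"] by (simp add: delta1_def rb_states_def)

lemma jump_trans:
  assumes "always_tight A w (Suc k) f" "states A \<noteq> {}"
  shows "det_run A w (Suc k) f 0 \<in> rb_trans A (Subset (S k)) (w k)"
proof -
  have "f \<in> tight_funs (S (Suc k))"
    using assms(1) unfolding always_tight_def by (metis add_0_right ranks.simps(1))
  then show ?thesis using det_run_in_states[OF assms, of 0] by (simp add: delta2_def)
qed

lemma det_run_trans:
  assumes tight: "always_tight A w t f" and ne: "states A \<noteq> {}"
  shows "det_run A w t f (Suc k) \<in> rb_trans A (det_run A w t f k) (w (t + k))"
    "det_run A w t f (Suc k) \<in> rb_acc A (det_run A w t f k) (w (t + k)) \<longleftrightarrow>
      rb_break A (det_run A w t f k) (w (t + k))"
proof -
  have st: "Ranked (S (t + k)) (obl t f k) (ranks A w t f k) (idx t f k) \<in> rb_states A"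
    using det_run_in_states[OF assms, of k] det_run_eq[of t f k] by simp
  have "ranks A w t f (Suc k) \<in> tight_funs (S (t + Suc k))" using tight unfolding always_tight_def by blast
  then have t': "succ_fun A (S (t + k)) (ranks A w t f k) (w (t + k)) \<in> tight_funs (post A (S (t + k)) (w (t + k)))"
    by simp
  show "det_run A w t f (Suc k) \<in> rb_trans A (det_run A w t f k) (w (t + k))"
    using rb_trans_Ranked[OF aut w_in st, of "t + k"] t' det_run_eq[of t f k]
    by (simp del: rb_next.simps rb_trans.simps)
  show "det_run A w t f (Suc k) \<in> rb_acc A (det_run A w t f k) (w (t + k)) \<longleftrightarrow>
      rb_break A (det_run A w t f k) (w (t + k))"
    using rb_acc_Ranked[OF aut w_in st, of "t + k"] t' det_run_eq[of t f k]
    by (simp add: rb_break_def del: rb_next.simps rb_acc.simps)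
qed

lemma jump_resolver_acc:
  assumes s: "s > 0" and ne: "states A \<noteq> {}" and sel: "sel (map w [0..<s]) = Some f"
    and acc: "accepting_jump A w s f"
  shows "resolver_acc C (jump_resolver A s sel) w"
  unfolding resolver_acc_def
proof
  let ?r = "\<lambda>k. jump_resolver A s sel (map w [0..<k])"
  have tight: "always_tight A w s f" using acc by (simp add: accepting_jump_def)
  have R: "?r k =
      (if k < s then Subset (S k) else det_run A w s f (k - s))" for k
    by (simp add: jump_resolver_word sel)
  show "\<forall>k. ?r (Suc k) \<in> trans C (?r k) (w k)"
  proof
    fix k
    consider "Suc k < s" | "Suc k = s" | n where "k = s + n"
      by (metis le_iff_add not_less_eq not_less_iff_gr_or_eq order_le_less)
    then show "?r (Suc k) \<in> trans C (?r k) (w k)"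
    proof cases
      case 1
      then show ?thesis unfolding R using Subset_trans[of k] by (simp add: rank_construction_def del: rb_trans.simps subsets_Suc)
    next
      case 2
      then show ?thesis unfolding R using jump_trans[of k f] tight ne by (auto simp: rank_construction_def simp del: rb_trans.simps subsets_Suc det_run.simps)
    next
      case 3
      then show ?thesis unfolding R using det_run_trans(1)[OF tight ne, of n]
        by (simp add: rank_construction_def Suc_diff_le del: rb_trans.simps subsets_Suc det_run.simps)
    qed
  qed
  show "\<exists>\<^sub>\<infinity>k. ?r (Suc k) \<in> dist_trans C (?r k) (w k)"
    unfolding INFM_nat_le
  proof
    fix m
    obtain n where n: "n \<ge> m" "rb_break A (det_run A w s f n) (w (s + n))"
      using acc unfolding accepting_jump_def INFM_nat_le by blast
    have "?r (Suc (s + n)) \<in> dist_trans C (?r (s + n)) (w (s + n))"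
      unfolding R using det_run_trans(2)[OF tight ne, of n] n(2)
      by (simp add: rank_construction_def Suc_diff_le del: rb_acc.simps det_run.simps)
    then show "\<exists>k\<ge>m. ?r (Suc k) \<in> dist_trans C (?r k) (w k)"
      using n(1) by (intro exI[of _ "s + n"]) simp
  qed
qed

lemma S_empty_ge: "S k = {} \<Longrightarrow> k \<le> j \<Longrightarrow> S j = {}"
  by (rule dec_induct[of k j "\<lambda>j. S j = {}"]) (auto simp: post_def)

text \<open>A set that has become empty stays empty, and transitions from the empty subset are
  accepting.\<close>

lemma jump_resolver_acc_None:
  assumes sel: "sel (map w [0..<s]) = None" and e: "S k0 = {}"
  shows "resolver_acc C (jump_resolver A s sel) w"
  unfolding resolver_acc_def
proof
  let ?r = "\<lambda>k. jump_resolver A s sel (map w [0..<k])"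
  have R: "?r k = Subset (S k)" for k
    by (simp add: jump_resolver_word sel)
  show "\<forall>k. ?r (Suc k) \<in> trans C (?r k) (w k)"
    unfolding R using Subset_trans by (simp add: rank_construction_def del: rb_trans.simps subsets_Suc)
  show "\<exists>\<^sub>\<infinity>k. ?r (Suc k) \<in> dist_trans C (?r k) (w k)"
    unfolding INFM_nat_le R
  proof
    fix m
    have "S (k0 + m) = {}" using S_empty_ge[OF e] by simp
    then have "Subset (S (Suc (k0 + m))) \<in> dist_trans C (Subset (S (k0 + m))) (w (k0 + m))"
      using Subset_trans[of "k0 + m"] by (simp add: rank_construction_def del: rb_trans.simps subsets_Suc)
    then show "\<exists>k\<ge>m. Subset (S (Suc k)) \<in> dist_trans C (Subset (S k)) (w k)"
      by (intro exI[of _ "k0 + m"]) simp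
  qed
qed

lemma resolver_acc_imp_NBA:
  assumes "resolver_acc C \<rho> w" "\<rho> [] = Subset (initial A)"
  shows "w \<in> NBA_lang C"
proof -
  have "is_run C w (\<lambda>k. \<rho> (map w [0..<k]))" "inf_dist C w (\<lambda>k. \<rho> (map w [0..<k]))"
    using assms by (simp_all add: resolver_acc_def is_run_def inf_dist_def rank_construction_def)
  then show ?thesis using word unfolding NBA_lang_def by (auto simp: rank_construction_def)
qed

text \<open>A run that never leaves the subset states accepts only through the empty set. Any other
  run leaves them at a first time \<open>t\<close>, and determinism makes it coincide with
  \<open>det_run\<close> from there.\<close>

lemma NBA_imp_accepting_jump:
  assumes "w \<in> NBA_lang C"
  shows "(\<exists>k. S k = {}) \<or> (\<exists>t>0. \<exists>f. accepting_jump A w t f)"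
proof -
  obtain r where r: "is_run C w r" "inf_dist C w r" using assms by (auto simp: NBA_lang_def)
  have r0: "r 0 = Subset (initial A)" and rS: "\<And>k. r (Suc k) \<in> rb_trans A (r k) (w k)"
    and inf: "\<exists>\<^sub>\<infinity>k. r (Suc k) \<in> rb_acc A (r k) (w k)"
    using r by (auto simp: is_run_def inf_dist_def rank_construction_def)
  show ?thesis
  proof (cases "\<forall>k. r k = Subset (S k)")
    case True
    obtain k where "r (Suc k) \<in> rb_acc A (r k) (w k)" using inf by (auto simp: INFM_nat_le)
    then have "S k = {}" using True[rule_format, of k] by (auto split: if_splits)
    then show ?thesis by blast
  next
    case False
    define t where "t = (LEAST k. r k \<noteq> Subset (S k))"
    have t: "r t \<noteq> Subset (S t)" using False LeastI_ex[of "\<lambda>k. r k \<noteq> Subset (S k)"] unfolding t_def by blast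
    have "t \<noteq> 0" using t r0 by (metis subsets_0)
    then obtain t' where t': "t = Suc t'" by (cases t) auto
    have rt': "r t' = Subset (S t')" using not_less_Least[of t' "\<lambda>k. r k \<noteq> Subset (S k)"] t' unfolding t_def by auto
    obtain f where f: "r t = Ranked (S t) {} f 0" "f \<in> tight_funs (S t)"
      using rS[of t'] t unfolding t' rt' by (auto simp: delta1_def delta2_def)
    have in_states: "r (t + k) \<in> rb_states A" for k
      using subsetD[OF rb_trans_in_states rS[of "t' + k"]] unfolding t' by simp
    have det: "r (t + k) = det_run A w t f k \<and> ranks A w t f k \<in> tight_funs (S (t + k))" for k
    proof (induction k)
      case 0
      then show ?case using f by simp
    next
      case (Suc k)
      have e: "r (t + k) = Ranked (S (t + k)) (obl t f k) (ranks A w t f k) (idx t f k)"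
        using Suc det_run_eq[of t f k] by simp
      have tr: "r (Suc (t + k)) \<in> (if succ_fun A (S (t + k)) (ranks A w t f k) (w (t + k)) \<in> tight_funs (post A (S (t + k)) (w (t + k)))
          then {rb_next A (r (t + k)) (w (t + k))} else {})"
        using rS[of "t + k"] rb_trans_Ranked[OF aut w_in[of "t + k"] in_states[of k, unfolded e]]
        unfolding e by (simp del: rb_next.simps rb_trans.simps)
      then have tight: "succ_fun A (S (t + k)) (ranks A w t f k) (w (t + k)) \<in> tight_funs (post A (S (t + k)) (w (t + k)))"
        by (meson empty_iff)
      then have "r (Suc (t + k)) = rb_next A (r (t + k)) (w (t + k))" using tr by simp
      then show ?case using Suc tight by simp
    qed
    have tight: "always_tight A w t f" unfolding always_tight_def using det by blast
    have "\<exists>\<^sub>\<infinity>k. rb_break A (det_run A w t f k) (w (t + k))"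
      unfolding INFM_nat_le
    proof
      fix m
      obtain n where n: "n \<ge> t + m" "r (Suc n) \<in> rb_acc A (r n) (w n)" using inf by (auto simp: INFM_nat_le)
      then obtain k where k: "n = t + k" by (metis add_leD1 le_iff_add)
      have e: "r (t + k) = Ranked (S (t + k)) (obl t f k) (ranks A w t f k) (idx t f k)"
        using det det_run_eq[of t f k] by simp
      have "keep_set A (S (t + k)) (obl t f k) (ranks A w t f k) (idx t f k) (w (t + k)) = {}"
        using n(2) rb_acc_Ranked[OF aut w_in[of "t + k"] in_states[of k, unfolded e]]
        unfolding k e by (auto simp del: rb_next.simps rb_acc.simps split: if_splits)
      then have "rb_break A (det_run A w t f k) (w (t + k))"
        unfolding rb_break_def using e det[of k] by metis
      then show "\<exists>k\<ge>m. rb_break A (det_run A w t f k) (w (t + k))" using n(1) k by auto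
    qed
    then have "accepting_jump A w t f" using tight by (simp add: accepting_jump_def)
    then show ?thesis using t' by blast
  qed
qed

lemma NBA_lang_iff: "w \<in> NBA_lang C \<longleftrightarrow> (\<exists>k. S k = {}) \<or> (\<exists>t>0. \<exists>f. accepting_jump A w t f)"
proof
  assume "(\<exists>k. S k = {}) \<or> (\<exists>t>0. \<exists>f. accepting_jump A w t f)"
  \<comment> \<open>An empty \<open>S 0\<close> falls under the first case; in the second one the
    automaton therefore has states, as ranked states require.\<close>
  then consider k where "S k = {}" | t f where "S 0 \<noteq> {}" "t > 0" "accepting_jump A w t f" by blast
  then show "w \<in> NBA_lang C"
  proof cases
    case 1
    have "resolver_acc C (jump_resolver A 0 (\<lambda>_. None)) w"
      by (rule jump_resolver_acc_None[OF _ 1]) simp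
    then show ?thesis by (rule resolver_acc_imp_NBA) (simp add: jump_resolver_def)
  next
    case 2
    have "states A \<noteq> {}" using 2(1) S_states[of 0] by blast
    then have "resolver_acc C (jump_resolver A t (\<lambda>_. Some f)) w"
      by (intro jump_resolver_acc[OF 2(2) _ _ 2(3)]) simp_all
    then show ?thesis by (rule resolver_acc_imp_NBA) (use 2(2) in \<open>simp add: jump_resolver_def\<close>)
  qed
qed (rule NBA_imp_accepting_jump)

lemma NBA_lang_iff_UCA_lang: "w \<in> NBA_lang C \<longleftrightarrow> w \<in> UCA_lang A"
proof
  assume "w \<in> UCA_lang A"
  then show "w \<in> NBA_lang C" unfolding NBA_lang_iff by (rule UCA_imp_accepting_jump)
next
  assume "w \<in> NBA_lang C"
  then consider k where "S k = {}" | t f where "accepting_jump A w t f" unfolding NBA_lang_iff by blast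
  then show "w \<in> UCA_lang A"
  proof cases
    case 1
    have "r j \<in> S j" if "is_run A w r" for r j
    proof (induction j)
      case 0 then show ?case using that by (simp add: is_run_def)
    next
      case (Suc j) then show ?case using that S_step unfolding is_run_def by blast
    qed
    then have "\<not> is_run A w r" for r using 1 by blast
    then show ?thesis using word by (simp add: UCA_lang_def)
  next
    case 2
    then show ?thesis by (rule not_stuck_imp_UCA)
  qed
qed

end

lemma NBA_lang_rank_construction:
  assumes "automaton A"
  shows "NBA_lang (rank_construction A) = UCA_lang A"
proof -
  have "w \<in> NBA_lang (rank_construction A) \<longleftrightarrow> w \<in> UCA_lang A" if "w \<in> words (alphabet A)" for w
  proof -
    interpret word_run A w by unfold_locales fact+
    show ?thesis by (rule NBA_lang_iff_UCA_lang)
  qed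
  moreover have "NBA_lang (rank_construction A) \<subseteq> words (alphabet A)" "UCA_lang A \<subseteq> words (alphabet A)"
    by (auto simp: NBA_lang_def UCA_lang_def rank_construction_def)
  ultimately show ?thesis by blast
qed

section \<open>Resolving the nondeterminism with small error\<close>

text \<open>Replaces illegal choices of \<open>\<rho>\<close> by arbitrary legal ones; it recurses on the reversed word.\<close>

fun repair_rev :: "('q, 'l) aut \<Rightarrow> 'q \<Rightarrow> ('l list \<Rightarrow> 'q) \<Rightarrow> 'l list \<Rightarrow> 'q" where
  "repair_rev C q \<rho> [] = q"
| "repair_rev C q \<rho> (\<sigma> # x) =
     (if \<rho> (rev (\<sigma> # x)) \<in> trans C (repair_rev C q \<rho> x) \<sigma> then \<rho> (rev (\<sigma> # x))
      else SOME q'. q' \<in> trans C (repair_rev C q \<rho> x) \<sigma>)"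

definition repair :: "('q, 'l) aut \<Rightarrow> 'q \<Rightarrow> ('l list \<Rightarrow> 'q) \<Rightarrow> 'l list \<Rightarrow> 'q" where
  "repair C q \<rho> x = repair_rev C q \<rho> (rev x)"

lemma resolver_repair: "resolver C q (repair C q \<rho>)"
  by (auto simp: resolver_def repair_def some_in_eq)

text \<open>Along an accepted word all choices of \<open>\<rho>\<close> are legal, so no repair
  takes place.\<close>

lemma resolver_acc_repair:
  assumes acc: "resolver_acc C \<rho> w" and init: "\<rho> [] = q"
  shows "resolver_acc C (repair C q \<rho>) w"
proof -
  have eq: "repair C q \<rho> (map w [0..<k]) = \<rho> (map w [0..<k])" for k
  proof (induction k)
    case 0
    then show ?case using init by (simp add: repair_def)
  next
    case (Suc k)
    have "\<rho> (map w [0..<Suc k]) \<in> trans C (\<rho> (map w [0..<k])) (w k)"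
      using acc unfolding resolver_acc_def by blast
    then show ?case using Suc by (simp add: repair_def)
  qed
  show ?thesis using acc unfolding resolver_acc_def eq .
qed

section \<open>Measurability of the accepting jumps\<close>

lemma subsets_cong:
  assumes "\<And>j. j < k \<Longrightarrow> w j = w' j"
  shows "subsets A w k = subsets A w' k"
  using assms by (induction k) simp_all

lemma ranks_cong:
  assumes "\<And>j. j < t + k \<Longrightarrow> w j = w' j"
  shows "ranks A w t f k = ranks A w' t f k"
  using assms
proof (induction k)
  case (Suc k)
  have "subsets A w (t + k) = subsets A w' (t + k)" by (rule subsets_cong) (use Suc.prems in simp)
  moreover have "w (t + k) = w' (t + k)" using Suc.prems by simp
  ultimately show ?case using Suc by simp
qed simp

lemma det_run_cong:
  assumes "\<And>j. j < t + k \<Longrightarrow> w j = w' j"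
  shows "det_run A w t f k = det_run A w' t f k"
  using assms
proof (induction k)
  case 0
  have "subsets A w t = subsets A w' t" by (rule subsets_cong) (use 0 in simp)
  then show ?case by simp
next
  case (Suc k)
  have "w (t + k) = w' (t + k)" using Suc.prems by simp
  then show ?case using Suc by simp
qed

lemma words_eq_seqs: "words \<Sigma> = seqs \<Sigma>"
  by (simp add: words_def seqs_def)

locale word_measure =
  fixes A :: "('q, 'l) aut"
  assumes aut: "automaton A"
begin

abbreviation "\<Sigma> \<equiv> alphabet A"

lemma fin_\<Sigma>: "finite \<Sigma>"
  using aut by (simp add: automaton_def)

lemma sets_determinedI:
  assumes "\<And>w w'. (\<And>j. j < n \<Longrightarrow> w' j = w j) \<Longrightarrow> R w = R w'"
  shows "{w \<in> space (seq_space \<Sigma>). R w} \<in> sets (seq_space \<Sigma>)"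
  unfolding space_seq_space
proof (rule determined_sets[OF fin_\<Sigma>, of n], rule determined_Collect)
  fix w w' assume "\<And>j. j < n \<Longrightarrow> w' j = w j" "R w"
  then show "R w'" using assms[of w' w] by metis
qed

lemma empty_event: "{w \<in> seqs \<Sigma>. \<exists>k. subsets A w k = {}} \<in> sets (seq_space \<Sigma>)"
proof -
  have "{w \<in> space (seq_space \<Sigma>). subsets A w k = {}} \<in> sets (seq_space \<Sigma>)" for k
    by (rule sets_determinedI[of k]) (use subsets_cong in metis)
  then have "{w \<in> space (seq_space \<Sigma>). \<exists>k. subsets A w k = {}} \<in> sets (seq_space \<Sigma>)"
    by (rule sets.sets_Collect_countable_Ex)
  then show ?thesis by (simp only: space_seq_space)
qed

text \<open>Measurability is read off the definition through breaks: tightness and breaks at each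
  time depend on a finite prefix, and they are combined countably. The form with
  \<open>stuck\<close> quantifies over paths instead.\<close>

lemma jump_event: "{w \<in> seqs \<Sigma>. accepting_jump A w t f} \<in> sets (seq_space \<Sigma>)"
proof -
  have "{w \<in> space (seq_space \<Sigma>). ranks A w t f k \<in> tight_funs (subsets A w (t + k))} \<in> sets (seq_space \<Sigma>)" for k
  proof (rule sets_determinedI[of "t + k"])
    fix w w' :: "nat \<Rightarrow> 'l" assume *: "\<And>j. j < t + k \<Longrightarrow> w' j = w j"
    have "ranks A w' t f k = ranks A w t f k" "subsets A w' (t + k) = subsets A w (t + k)"
      by (rule ranks_cong, rule *, assumption) (rule subsets_cong, rule *, assumption)
    then show "(ranks A w t f k \<in> tight_funs (subsets A w (t + k)))
      = (ranks A w' t f k \<in> tight_funs (subsets A w' (t + k)))" by simp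
  qed
  then have 1: "{w \<in> space (seq_space \<Sigma>). always_tight A w t f} \<in> sets (seq_space \<Sigma>)"
    unfolding always_tight_def by (rule sets.sets_Collect_countable_All)
  have "{w \<in> space (seq_space \<Sigma>). rb_break A (det_run A w t f k) (w (t + k))} \<in> sets (seq_space \<Sigma>)" for k
  proof (rule sets_determinedI[of "Suc (t + k)"])
    fix w w' :: "nat \<Rightarrow> 'l" assume *: "\<And>j. j < Suc (t + k) \<Longrightarrow> w' j = w j"
    have "det_run A w' t f k = det_run A w t f k"
      by (rule det_run_cong, rule *) simp
    moreover have "w' (t + k) = w (t + k)" by (rule *) simp
    ultimately show "rb_break A (det_run A w t f k) (w (t + k)) = rb_break A (det_run A w' t f k) (w' (t + k))"
      by simp
  qed
  then have 2: "{w \<in> space (seq_space \<Sigma>). \<exists>\<^sub>\<infinity>k. rb_break A (det_run A w t f k) (w (t + k))} \<in> sets (seq_space \<Sigma>)"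
    by (rule sets_INFM)
  have "{w \<in> seqs \<Sigma>. accepting_jump A w t f} = {w \<in> space (seq_space \<Sigma>). always_tight A w t f}
      \<inter> {w \<in> space (seq_space \<Sigma>). \<exists>\<^sub>\<infinity>k. rb_break A (det_run A w t f k) (w (t + k))}"
    unfolding accepting_jump_def space_seq_space by blast
  then show ?thesis using sets.Int[OF 1 2] by metis
qed

definition tights :: "('q \<Rightarrow> nat) set" where
  "tights = (\<Union>S\<in>Pow (states A). tight_funs S)"

lemma finite_tights: "finite tights"
proof -
  have "finite (states A)" using aut by (simp add: automaton_def)
  then show ?thesis unfolding tights_def using finite_tight_funs finite_subset by auto
qed

lemma accepting_jump_tights:
  assumes "w \<in> seqs \<Sigma>" "accepting_jump A w t f"
  shows "f \<in> tights"
proof -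
  interpret word_run A w by unfold_locales (use aut assms in \<open>auto simp: words_eq_seqs\<close>)
  have "f \<in> tight_funs (subsets A w t)"
    using assms(2) unfolding accepting_jump_def always_tight_def by (metis add_0_right ranks.simps(1))
  then show ?thesis unfolding tights_def using S_states by blast
qed

text \<open>The index \<open>n\<close> belongs to jumps at time \<open>Suc n\<close>, since jumps
  land at positive times. \<open>None\<close> stands for waiting for the empty subset.\<close>

definition choice_event :: "nat \<Rightarrow> ('q \<Rightarrow> nat) option \<Rightarrow> (nat \<Rightarrow> 'l) set" where
  "choice_event n o' = (case o' of None \<Rightarrow> {w \<in> seqs \<Sigma>. \<exists>k. subsets A w k = {}}
     | Some f \<Rightarrow> {w \<in> seqs \<Sigma>. accepting_jump A w (Suc n) f})"

lemma choice_event_sets: "choice_event n o' \<in> sets (seq_space \<Sigma>)"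
  unfolding choice_event_def using empty_event jump_event by (cases o') simp_all

definition choices :: "('q \<Rightarrow> nat) option set" where
  "choices = insert None (Some ` tights)"

lemma finite_choices: "finite choices"
  by (simp add: choices_def finite_tights)

text \<open>A jump is postponed by one step, to the ranks it would have reached.\<close>

lemma choice_events_mono: "incseq (\<lambda>n. \<Union>o'\<in>choices. choice_event n o')"
proof (rule incseq_SucI, rule subsetI)
  fix n w assume "w \<in> (\<Union>o'\<in>choices. choice_event n o')"
  then obtain o' where o': "o' \<in> choices" "w \<in> choice_event n o'" by blast
  show "w \<in> (\<Union>o'\<in>choices. choice_event (Suc n) o')"
  proof (cases o')
    case None
    then have "w \<in> choice_event (Suc n) None" using o' by (simp add: choice_event_def)
    then show ?thesis by (auto simp: choices_def)
  next
    case (Some f)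
    then have w: "w \<in> seqs \<Sigma>" "accepting_jump A w (Suc n) f" using o' by (auto simp: choice_event_def)
    interpret word_run A w by unfold_locales (use aut w in \<open>auto simp: words_eq_seqs\<close>)
    have acc: "accepting_jump A w (Suc (Suc n)) (ranks A w (Suc n) f 1)"
      using accepting_jump_shift[OF w(2), of 1] by simp
    then have "ranks A w (Suc n) f 1 \<in> tights" using accepting_jump_tights w(1) by blast
    moreover have "w \<in> choice_event (Suc n) (Some (ranks A w (Suc n) f 1))"
      using acc w(1) by (simp add: choice_event_def)
    ultimately show ?thesis unfolding choices_def by blast
  qed
qed

lemma NBA_lang_choice_events:
  "NBA_lang (rank_construction A) = (\<Union>n. \<Union>o'\<in>choices. choice_event n o')"
proof (rule set_eqI)
  fix w
  show "w \<in> NBA_lang (rank_construction A) \<longleftrightarrow> w \<in> (\<Union>n. \<Union>o'\<in>choices. choice_event n o')"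
  proof (cases "w \<in> seqs \<Sigma>")
    case True
    interpret word_run A w by unfold_locales (use aut True in \<open>auto simp: words_eq_seqs\<close>)
    show ?thesis
    proof
      assume "w \<in> NBA_lang (rank_construction A)"
      then consider k where "S k = {}" | t f where "t > 0" "accepting_jump A w t f"
        unfolding NBA_lang_iff by blast
      then show "w \<in> (\<Union>n. \<Union>o'\<in>choices. choice_event n o')"
      proof cases
        case 1
        then have "w \<in> choice_event 0 None" using True by (auto simp: choice_event_def)
        then show ?thesis by (auto simp: choices_def)
      next
        case 2
        then obtain n where n: "t = Suc n" by (cases t) auto
        have "w \<in> choice_event n (Some f)" using 2 n True by (simp add: choice_event_def)
        moreover have "Some f \<in> choices" using accepting_jump_tights[OF True 2(2)] by (simp add: choices_def)
        ultimately show ?thesis by blast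
      qed
    next
      assume "w \<in> (\<Union>n. \<Union>o'\<in>choices. choice_event n o')"
      then obtain n o' where "w \<in> choice_event n o'" by blast
      then show "w \<in> NBA_lang (rank_construction A)"
        unfolding NBA_lang_iff by (cases o') (auto simp: choice_event_def)
    qed
  next
    case False
    then have "w \<notin> NBA_lang (rank_construction A)"
      by (auto simp: NBA_lang_def rank_construction_def words_eq_seqs)
    moreover have "choice_event n o' \<subseteq> seqs \<Sigma>" for n o'
      by (cases o') (auto simp: choice_event_def)
    ultimately show ?thesis using False by blast
  qed
qed

lemma NBA_lang_sets: "NBA_lang (rank_construction A) \<in> sets (seq_space \<Sigma>)"
  unfolding NBA_lang_choice_events
proof (rule sets.countable_UN)
  show "range (\<lambda>n. \<Union>o'\<in>choices. choice_event n o') \<subseteq> sets (seq_space \<Sigma>)"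
    by (intro image_subsetI sets.finite_UN finite_choices choice_event_sets)
qed

text \<open>Some fixed time \<open>Suc n\<close> is late enough for jumping up to probability \<open>e / 2\<close>. The jump with which
  a word is accepted depends on the whole word, but this dependence is approximated by the prefix of
  some length \<open>s \<ge> Suc n\<close>, so a resolver that waits until \<open>s\<close> and then jumps to the ranks that the
  chosen jump at \<open>Suc n\<close> would have reached by then is right up to probability \<open>e\<close>.\<close>

lemma ex_resolver:
  assumes \<mu>: "prob_space \<mu>" "sets \<mu> = sets (seq_space \<Sigma>)" and e: "e > 0" and \<sigma>0: "\<sigma>0 \<in> \<Sigma>"
  shows "\<exists>\<rho> X. resolver (rank_construction A) (Subset (initial A)) \<rho> \<and> X \<in> sets (seq_space \<Sigma>) \<and>
    (\<forall>w\<in>X. resolver_acc (rank_construction A) \<rho> w) \<and>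
    measure \<mu> (NBA_lang (rank_construction A)) \<le> measure \<mu> X + e"
proof -
  let ?C = "rank_construction A"
  interpret prob_space \<mu> by fact
  have fm: "finite_measure \<mu>" by unfold_locales
  let ?U = "\<lambda>n. \<Union>o'\<in>choices. choice_event n o'"
  have ce: "choice_event n o' \<in> sets \<mu>" for n o' using choice_event_sets \<mu>(2) by simp
  have U: "?U n \<in> sets \<mu>" for n using ce finite_choices by (intro sets.finite_UN)
  have "(\<lambda>n. measure \<mu> (?U n)) \<longlonglongrightarrow> measure \<mu> (\<Union>n. ?U n)"
    using U by (intro finite_Lim_measure_incseq choice_events_mono) blast
  then have "eventually (\<lambda>n. measure \<mu> (\<Union>n. ?U n) - e / 2 < measure \<mu> (?U n)) sequentially"
    using e by (intro order_tendstoD(1)) auto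
  then obtain n where n: "measure \<mu> (NBA_lang ?C) - e / 2 < measure \<mu> (?U n)"
    unfolding NBA_lang_choice_events by (auto simp: eventually_sequentially)
  \<comment> \<open>The other half of \<open>e\<close> is divided evenly among the finitely many
    choices.\<close>
  define d where "d = e / (2 * card choices)"
  have card_pos: "card choices > 0"
    using finite_choices by (auto simp: card_gt_0_iff choices_def)
  have d: "d > 0" using e card_pos by (simp add: d_def)
  have "\<exists>l D. determined \<Sigma> l D \<and> measure \<mu> (sym_diff (choice_event n o') D) < d" for o'
    using approx_determined[OF fm \<mu>(2) fm \<mu>(2) fin_\<Sigma> choice_event_sets d] by blast
  then obtain l D where D: "\<And>o'. determined \<Sigma> (l o') (D o')"
    "\<And>o'. measure \<mu> (sym_diff (choice_event n o') (D o')) < d" by metis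
  define s where "s = Max (insert (Suc n) (l ` choices))"
  have s: "Suc n \<le> s" "\<And>o'. o' \<in> choices \<Longrightarrow> l o' \<le> s"
    unfolding s_def using finite_choices by (auto intro!: Max_ge)
  have Ds: "determined \<Sigma> s (D o')" if "o' \<in> choices" for o'
    by (rule determined_mono[OF D(1) s(2)[OF that]])
  \<comment> \<open>Membership in \<open>D o'\<close> depends on the first \<open>s\<close> letters;
    padding with \<open>\<sigma>0\<close> makes a finite prefix a sequence that can be
    tested.\<close>
  define ext where "ext x k = (if k < s then x ! k else \<sigma>0)" for x and k :: nat
  define pick where "pick x = (SOME o'. o' \<in> choices \<and> ext x \<in> D o')" for x
  \<comment> \<open>Without states there is no ranked state to jump to, and the empty subset is
    there from time \<open>0\<close>. Otherwise the ranks picked for time \<open>Suc n\<close> are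
    advanced to time \<open>s\<close> along the known prefix.\<close>
  define sel where "sel x = (if states A = {} then None
    else map_option (\<lambda>f. ranks A (ext x) (Suc n) f (s - Suc n)) (pick x))" for x
  define \<rho> where "\<rho> = repair ?C (Subset (initial A)) (jump_resolver A s sel)"
  define err where "err = (\<Union>o'\<in>choices. sym_diff (choice_event n o') (D o'))"
  define X where "X = ?U n - err"
  have D_sets: "D o' \<in> sets \<mu>" for o'
    using determined_sets[OF fin_\<Sigma> D(1)] \<mu>(2) by simp
  have err_sets: "err \<in> sets \<mu>"
    unfolding err_def using ce D_sets finite_choices by (intro sets.finite_UN sets.Un sets.Diff)
  have "resolver_acc ?C \<rho> w" if w: "w \<in> X" for w
  proof -
    obtain o1 where o1: "o1 \<in> choices" "w \<in> choice_event n o1" using w unfolding X_def by blast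
    have "choice_event n o' \<subseteq> seqs \<Sigma>" for o'
      by (cases o') (auto simp: choice_event_def)
    then have w\<Sigma>: "w \<in> seqs \<Sigma>" using o1 by blast
    interpret word_run A w by unfold_locales (use aut w\<Sigma> in \<open>auto simp: words_eq_seqs\<close>)
    let ?x = "map w [0..<s]"
    have ext_w: "ext ?x j = w j" if "j < s" for j using that by (simp add: ext_def)
    have ext_\<Sigma>: "ext ?x \<in> seqs \<Sigma>" using w\<Sigma> \<sigma>0 by (auto simp: ext_def seqs_def)
    have ext_D: "ext ?x \<in> D o' \<longleftrightarrow> w \<in> D o'" if "o' \<in> choices" for o'
    proof
      assume "ext ?x \<in> D o'"
      then show "w \<in> D o'"
        using Ds[OF that] w\<Sigma> ext_w unfolding determined_def by metis
    next
      assume "w \<in> D o'"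
      then show "ext ?x \<in> D o'"
        using Ds[OF that] ext_\<Sigma> ext_w unfolding determined_def by metis
    qed
    \<comment> \<open>Outside \<open>err\<close> the finitary approximations are exact, so the pick
      is right for \<open>w\<close> itself.\<close>
    have agree: "w \<in> D o' \<longleftrightarrow> w \<in> choice_event n o'" if "o' \<in> choices" for o'
      using w that unfolding X_def err_def by blast
    have "\<exists>o'. o' \<in> choices \<and> ext ?x \<in> D o'" using o1 ext_D agree by blast
    then have "pick ?x \<in> choices \<and> ext ?x \<in> D (pick ?x)" unfolding pick_def by (rule someI_ex)
    then have pick: "w \<in> choice_event n (pick ?x)" using ext_D agree by blast
    have "resolver_acc ?C (jump_resolver A s sel) w"
    proof (cases "states A = {} \<or> pick ?x = None")
      case True
      have "\<exists>k. S k = {}"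
      proof (cases "states A = {}")
        case True
        then show ?thesis using S_states[of 0] by blast
      next
        case False
        then show ?thesis using True pick by (simp add: choice_event_def)
      qed
      then obtain k where "S k = {}" by blast
      then show ?thesis by (rule jump_resolver_acc_None[rotated]) (use True in \<open>auto simp: sel_def\<close>)
    next
      case False
      then obtain f where f: "pick ?x = Some f" by blast
      then have acc: "accepting_jump A w (Suc n) f" using pick by (simp add: choice_event_def)
      define f' where "f' = ranks A w (Suc n) f (s - Suc n)"
      have "ranks A (ext ?x) (Suc n) f (s - Suc n) = f'"
        unfolding f'_def by (rule ranks_cong, rule ext_w) (use s(1) in simp)
      then have sel: "sel ?x = Some f'" using False f by (simp add: sel_def)
      have acc': "accepting_jump A w s f'"
        using accepting_jump_shift[OF acc, of "s - Suc n"] s(1) by (simp add: f'_def)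
      show ?thesis by (rule jump_resolver_acc[where sel=sel and s=s, OF _ _ sel acc']) (use s(1) False in auto)
    qed
    then show ?thesis unfolding \<rho>_def
      by (rule resolver_acc_repair) (use s(1) in \<open>simp add: jump_resolver_def\<close>)
  qed
  moreover have "X \<in> sets (seq_space \<Sigma>)"
    unfolding X_def using U err_sets \<mu>(2) by auto
  moreover have "resolver ?C (Subset (initial A)) \<rho>"
    unfolding \<rho>_def by (rule resolver_repair)
  moreover have "measure \<mu> (NBA_lang ?C) \<le> measure \<mu> X + e"
  proof -
    have "measure \<mu> err \<le> (\<Sum>o'\<in>choices. measure \<mu> (sym_diff (choice_event n o') (D o')))"
      unfolding err_def using finite_choices ce D_sets by (intro measure_UNION_le) auto
    also have "\<dots> \<le> (\<Sum>o'\<in>choices. d)" using D(2) by (intro sum_mono less_imp_le)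
    also have "\<dots> = e / 2" using card_pos by (simp add: d_def)
    finally have err: "measure \<mu> err \<le> e / 2" .
    have "measure \<mu> (?U n) \<le> measure \<mu> (X \<union> err)"
      using U err_sets by (intro finite_measure_mono) (auto simp: X_def)
    also have "\<dots> \<le> measure \<mu> X + measure \<mu> err"
      using U err_sets by (intro measure_Un_le) (auto simp: X_def)
    finally show ?thesis using n err by linarith
  qed
  ultimately show ?thesis by blast
qed

end

text \<open>\<open>ex_resolver\<close> is applied to the distribution of label words under a given
  strategy, so the resolver depends on that strategy and on \<open>e\<close>; in the supremum the
  loss disappears.\<close>

lemma good_for_MDPs_rank_construction:
  fixes A :: "('q, 'l) aut"
  assumes aut: "automaton A"
  shows "good_for_MDPs TYPE('s) TYPE('a) (rank_construction A)"
  unfolding good_for_MDPs_def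
proof (intro allI impI)
  fix M :: "('s, 'a, 'l) mdp"
  let ?C = "rank_construction A" and ?q = "Subset (initial A)" and ?\<Sigma> = "alphabet A"
  let ?L = "NBA_lang ?C"
  assume fin: "finite_MDP (alphabet ?C) M"
  interpret word_measure A by unfold_locales fact
  interpret mdp_product M ?C ?q
  proof
    show "finite_MDP (alphabet ?C) M" by fact
    show "finite (states ?C)" using finite_rb_states[OF aut] by (simp add: rank_construction_def)
    show "?q \<in> states ?C" using aut by (auto simp: rank_construction_def rb_states_def automaton_def)
    \<comment> \<open>This holds for all \<open>q\<close> and \<open>\<sigma>\<close> because
      \<open>rb_trans\<close> intersects with \<open>rb_states\<close>.\<close>
    show "trans ?C q \<sigma> \<subseteq> states ?C" for q \<sigma>
      using rb_trans_in_states by (simp add: rank_construction_def)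
  qed
  have lab_in: "s \<in> mdp_states M \<Longrightarrow> mdp_label M s \<in> ?\<Sigma>" for s
    using fin by (simp add: finite_MDP_def rank_construction_def)
  have init: "mdp_init M \<in> mdp_states M" using fin by (simp add: finite_MDP_def)
  define \<sigma>0 where "\<sigma>0 = mdp_label M (mdp_init M)"
  have \<sigma>0: "\<sigma>0 \<in> ?\<Sigma>" using lab_in[OF init] by (simp add: \<sigma>0_def)
  \<comment> \<open>A default letter for \<open>None\<close> makes the labelling total and
    coordinatewise, hence measurable; on live paths it agrees with
    \<open>path_label\<close>.\<close>
  define g where "g e = (case e of None \<Rightarrow> \<sigma>0 | Some sa \<Rightarrow> mdp_label M (fst sa))" for e :: "('s \<times> 'a) option"
  define lab where "lab z k = g (z k)" for z and k :: nat
  have g_in: "g e \<in> ?\<Sigma>" if "e \<in> entries M" for e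
    using that \<sigma>0 lab_in by (auto simp: g_def entries_def)
  have lab_meas: "lab \<in> measurable (seq_space (entries M)) (seq_space ?\<Sigma>)"
    using coordinatewise_measurable[of "entries M" g ?\<Sigma>, OF g_in] unfolding lab_def by simp
  have lab_eq: "lab z = path_label M z" if "\<And>k. z k \<noteq> None" for z
  proof
    fix k
    have "z k \<noteq> None" by fact
    then obtain sa where "z k = Some sa" by blast
    then show "lab z k = path_label M z k" by (simp add: lab_def g_def path_label_def)
  qed
  define alive where "alive = {z \<in> seqs (entries M). \<forall>k. z k \<noteq> None}"
  have alive_sets: "alive \<in> sets (seq_space (entries M))"
  proof -
    have "{z \<in> space (seq_space (entries M)). z k \<noteq> None} \<in> sets (seq_space (entries M))" for k
      unfolding space_seq_space
      by (rule determined_sets[OF finite_entries[OF wf_M], of "Suc k"], rule determined_Collect) simp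
    then have "{z \<in> space (seq_space (entries M)). \<forall>k. z k \<noteq> None} \<in> sets (seq_space (entries M))"
      by (rule sets.sets_Collect_countable_All)
    then show ?thesis unfolding alive_def by (simp only: space_seq_space)
  qed
  have lang: "lang_event M ?L = alive \<inter> (lab -` ?L \<inter> space (seq_space (entries M)))"
  proof (rule set_eqI)
    fix z
    show "z \<in> lang_event M ?L \<longleftrightarrow> z \<in> alive \<inter> (lab -` ?L \<inter> space (seq_space (entries M)))"
    proof (cases "z \<in> alive")
      case True
      then have z: "\<And>k. z k \<noteq> None" "z \<in> seqs (entries M)" unfolding alive_def by blast+
      have "lab z = (\<lambda>k. mdp_label M (fst (the (z k))))"
        using lab_eq[OF z(1)] by (simp add: path_label_def fun_eq_iff)
      then show ?thesis using True z by (simp add: lang_event_def seqs_def)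
    next
      case False
      then have "z \<notin> lang_event M ?L" unfolding lang_event_def alive_def seqs_def by blast
      then show ?thesis using False by blast
    qed
  qed
  have lang_sets: "lang_event M ?L \<in> sets (seq_space (entries M))"
    unfolding lang by (intro sets.Int alive_sets measurable_sets[OF lab_meas NBA_lang_sets])
  show "sem_value M ?C = syn_value M ?C"
  proof (rule antisym)
    show "syn_value M ?C \<le> sem_value M ?C"
      unfolding syn_value_def
    proof (intro SUP_least)
      fix q \<pi> assume q: "q \<in> initial ?C" and "\<pi> \<in> strategies (product M ?C q)"
      then have [simp]: "q = ?q" and \<pi>: "\<pi> \<in> strategies (product M ?C ?q)"
        by (auto simp: rank_construction_def)
      have "emeasure (path_measure (product M ?C ?q) \<pi>) (acc_event M ?C ?q)
          \<le> emeasure (path_measure M (proj_strategy \<pi>)) (lang_event M ?L)"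
        using acc_event_le_lang_event[OF \<pi> _ lang_sets] q by simp
      also have "\<dots> \<le> sem_value M ?C"
        unfolding sem_value_def by (rule SUP_upper[OF proj_strategy_in[OF \<pi>]])
      finally show "emeasure (path_measure (product M ?C q) \<pi>) (acc_event M ?C q) \<le> sem_value M ?C"
        by simp
    qed
    show "sem_value M ?C \<le> syn_value M ?C"
      unfolding sem_value_def
    proof (intro SUP_least)
      fix \<pi> assume \<pi>: "\<pi> \<in> strategies M"
      let ?P = "path_measure M \<pi>"
      interpret P: seq_process "entries M" "step_pmf M \<pi>" ?P
        by (rule seq_process_path_measure[OF wf_M \<pi>])
      have lab: "lab \<in> measurable ?P (seq_space ?\<Sigma>)"
        using lab_meas unfolding measurable_cong_sets[OF P.sets_P refl] .
      define \<mu> where "\<mu> = distr ?P (seq_space ?\<Sigma>) lab"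
      have \<mu>: "prob_space \<mu>" "sets \<mu> = sets (seq_space ?\<Sigma>)"
        unfolding \<mu>_def by (rule P.prob_space_distr[OF lab]) simp
      have \<mu>_eq: "measure \<mu> Y = measure ?P (lab -` Y \<inter> space ?P)" if "Y \<in> sets (seq_space ?\<Sigma>)" for Y
        unfolding \<mu>_def by (rule measure_distr[OF lab that])
      have space: "space (seq_space (entries M)) = space ?P" by (simp add: P.space_P)
      show "emeasure ?P (lang_event M ?L) \<le> syn_value M ?C"
      proof (rule ennreal_le_epsilon)
        fix e :: real assume "e > 0"
        then obtain \<rho> X where \<rho>: "resolver ?C ?q \<rho>" and X: "X \<in> sets (seq_space ?\<Sigma>)"
          "\<And>w. w \<in> X \<Longrightarrow> resolver_acc ?C \<rho> w" "measure \<mu> ?L \<le> measure \<mu> X + e"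
          using ex_resolver[OF \<mu> _ \<sigma>0, of e] by blast
        define X' where "X' = alive \<inter> (lab -` X \<inter> space ?P)"
        have X'_sets: "X' \<in> sets ?P"
          unfolding X'_def using alive_sets P.sets_P measurable_sets[OF lab X(1)] by auto
        have "measure ?P (lang_event M ?L) \<le> measure ?P (lab -` ?L \<inter> space ?P)"
          unfolding lang space using measurable_sets[OF lab NBA_lang_sets] by (intro P.finite_measure_mono) auto
        also have "\<dots> \<le> measure ?P (lab -` X \<inter> space ?P) + e"
          using X(3) unfolding \<mu>_eq[OF NBA_lang_sets] \<mu>_eq[OF X(1)] .
        also have "measure ?P (lab -` X \<inter> space ?P) \<le> measure ?P X'"
        proof (rule P.finite_measure_mono_AE[OF _ X'_sets])
          show "AE z in ?P. z \<in> lab -` X \<inter> space ?P \<longrightarrow> z \<in> X'"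
            using AE_alive[OF fin \<pi>] AE_space
          proof eventually_elim
            case (elim z)
            then show ?case by (simp add: X'_def alive_def P.space_P)
          qed
        qed
        finally have "emeasure ?P (lang_event M ?L) \<le> emeasure ?P X' + ennreal e"
          using \<open>e > 0\<close> by (simp add: P.emeasure_eq_measure flip: ennreal_plus)
        also have "emeasure ?P X' \<le> emeasure (path_measure (product M ?C ?q) (lift_strategy M ?C ?q \<rho> \<pi>)) (acc_event M ?C ?q)"
        proof (rule lift_resolver[OF \<pi> \<rho> X'_sets])
          fix z assume "z \<in> X'"
          then have "\<And>k. z k \<noteq> None" "lab z \<in> X" unfolding X'_def alive_def by blast+
          then show "resolver_acc ?C \<rho> (path_label M z)" using X(2) lab_eq by metis
        qed
        also have "\<dots> \<le> syn_value M ?C"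
          unfolding syn_value_def
          by (rule SUP_upper2[of ?q]) (auto simp: rank_construction_def intro!: SUP_upper lift_strategy_in[OF \<pi>, of \<rho>, unfolded rank_construction_def])
        finally show "emeasure ?P (lang_event M ?L) \<le> syn_value M ?C + ennreal e"
          by (simp add: add_right_mono)
      qed
    qed
  qed
qed

theorem theorem5:
  fixes A :: "('q, 'l) aut"
  assumes "automaton A"
  shows "NBA_lang (rank_construction A) = UCA_lang A \<and>
    good_for_MDPs TYPE('s) TYPE('a) (rank_construction A)"
  using NBA_lang_rank_construction[OF assms] good_for_MDPs_rank_construction[OF assms] by blast

end
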